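(* Let $n \geq 2$ and let $S$ be the unit sphere in $\mathbb{R}^n$. Then $$Q_{\rm loc}(\alpha,\infty) \geq \left\{ \begin{array}{ll} (n-1)/n & \text{ if } n \geq 3 \text{ and } 0 < \alpha \leq (n-1)^2/(2n), \\ 2\alpha/(n-1) & \text{ if } n \geq 3 \text{ and } (n-1)^2/(2n) \leq \alpha \leq n, \\ 1/2 & \text{ if } n = 2 \text{ and } 0 < \alpha \leq 1/6, \\ 3\alpha & \text{ if } n = 2 \text{ and } 1/6 \leq \alpha \leq 1, \\ \alpha + 2 & \text{ if } n=2 \text{ and } 1 \leq \alpha \leq 2. \end{array} \right.$$
   Context: $\sigma$ denotes the surface area measure on $S$, $L^p(S)=L^p(\sigma)$, and the extension operator $E=E_S$ is $$Ef(x) = \widehat{f d\sigma}(x)=\int_S e^{-2 \pi i x \cdot \xi} f(\xi)\, d\sigma(\xi), \qquad f \in L^1(S).$$ For $0 < \alpha \leq n$ and a Lebesgue measurable function $H: \mathbb{R}^n \to [0,1]$, define $$A_\alpha(H)= \inf \Big\{ C : \int_{B(x_0,R)} H(x)\, dx \leq C R^\alpha \text{ for all } x_0 \in \mathbb{R}^n \text{ and } R \geq 1 \Big\},$$ where $B(x_0,R)$ is the closed ball of center $x_0$ and radius $R$. Such an $H$ is called a weight of dimension $\alpha$ if $A_\alpha(H) < \infty$. For $0<\alpha\le n$ and $1 \le p \le \infty$, $Q_{\rm loc}(\alpha,p)$ is the infimum of all numbers $q > 0$ such that the following holds: to every $\epsilon > 0$ there is a constant $C_\epsilon$ (allowed to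 depend on $\epsilon$, $n$, $\alpha$, $p$, $q$, but not on $f$, $H$, $R$) such that $$\int_{B(0,R)} |Ef(x)|^q H(x)\, dx \leq C_\epsilon R^\epsilon A_\alpha(H) \| f \|_{L^p(S)}^q$$ for all functions $f \in L^p(S)$, weights $H$ on $\mathbb{R}^n$ of dimension $\alpha$, and radii $R \geq 1$. (The infimum of the empty set is $+\infty$.) *)

theory Defs
  imports "HOL-Analysis.Analysis" "HOL-Probability.Essential_Supremum"
begin

text \<open>
  Surface area measure on the unit sphere, as a Borel measure whose underlying space is the sphere.
  The library has no surface measure, so the usual definition through polar coordinates is taken:
  the area of a Borel set \<open>A\<close> is \<open>n\<close> times the volume of the cone over \<open>A\<close> with vertex at the origin;
  see \<open>emeasure_sphere_measure\<close> and \<open>emeasure_sphere_measure_space\<close> below.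
\<close>

definition sphere_measure :: "'a::euclidean_space measure" where
  "sphere_measure =
     scale_measure (of_nat DIM('a))
       (distr (restrict_space lborel (cball 0 1 - {0})) (restrict_space borel (sphere 0 1))
          (\<lambda>x. x /\<^sub>R norm x))"

text \<open>
  \<open>p = \<infinity>\<close> is allowed. Functions are represented by Borel measurable functions; each class in
  \<open>L\<^sup>p\<close> has such a representative.
\<close>

definition in_Lp :: "ennreal \<Rightarrow> 'a measure \<Rightarrow> ('a \<Rightarrow> complex) \<Rightarrow> bool" where
  "in_Lp p M f \<longleftrightarrow> f \<in> borel_measurable M \<and>
     (if p = \<infinity> then esssup M (\<lambda>x. ennreal (norm (f x))) < \<infinity>
      else (\<integral>\<^sup>+x. ennreal (norm (f x) powr enn2real p) \<partial>M) < \<infinity>)"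

definition Lp_norm :: "ennreal \<Rightarrow> 'a measure \<Rightarrow> ('a \<Rightarrow> complex) \<Rightarrow> real" where
  "Lp_norm p M f =
     (if p = \<infinity> then enn2real (esssup M (\<lambda>x. ennreal (norm (f x))))
      else enn2real (\<integral>\<^sup>+x. ennreal (norm (f x) powr enn2real p) \<partial>M) powr (1 / enn2real p))"

text \<open>
  The surface enters the following definitions only through its surface measure \<open>\<sigma>\<close>.
\<close>

definition extension_op ::
    "'a::euclidean_space measure \<Rightarrow> ('a \<Rightarrow> complex) \<Rightarrow> 'a \<Rightarrow> complex" where
  "extension_op \<sigma> f x =
     (\<integral>\<xi>. exp (- 2 * complex_of_real pi * \<i> * complex_of_real (x \<bullet> \<xi>)) * f \<xi> \<partial>\<sigma>)"

text \<open>
  The infimum is taken in \<open>[0, \<infinity>]\<close>; \<open>C = \<infinity>\<close> is always admissible and \<open>R > 0\<close>, so the value is \<open>\<infinity>\<close>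
  exactly if no finite \<open>C\<close> is admissible.
\<close>

definition weight_const :: "real \<Rightarrow> ('a::euclidean_space \<Rightarrow> real) \<Rightarrow> ennreal" where
  "weight_const \<alpha> H =
     Inf {C. \<forall>x0. \<forall>R\<ge>1. (\<integral>\<^sup>+x\<in>cball x0 R. ennreal (H x) \<partial>lebesgue) \<le> C * ennreal (R powr \<alpha>)}"

definition is_weight :: "real \<Rightarrow> ('a::euclidean_space \<Rightarrow> real) \<Rightarrow> bool" where
  "is_weight \<alpha> H \<longleftrightarrow>
     H \<in> borel_measurable lebesgue \<and> (\<forall>x. 0 \<le> H x \<and> H x \<le> 1) \<and> weight_const \<alpha> H < \<infinity>"

definition local_estimate ::
    "'a::euclidean_space measure \<Rightarrow> real \<Rightarrow> ennreal \<Rightarrow> real \<Rightarrow> bool" where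
  "local_estimate \<sigma> \<alpha> p q \<longleftrightarrow>
     (\<forall>\<epsilon>>0. \<exists>C>0. \<forall>f H R. in_Lp p \<sigma> f \<longrightarrow> is_weight \<alpha> H \<longrightarrow> R \<ge> 1 \<longrightarrow>
        (\<integral>\<^sup>+x\<in>cball 0 R. ennreal (norm (extension_op \<sigma> f x) powr q * H x) \<partial>lebesgue)
          \<le> ennreal (C * R powr \<epsilon>) * weight_const \<alpha> H * ennreal (Lp_norm p \<sigma> f powr q))"

definition Q_loc :: "'a::euclidean_space measure \<Rightarrow> real \<Rightarrow> ennreal \<Rightarrow> ereal" where
  "Q_loc \<sigma> \<alpha> p = Inf (ereal ` {q. q > 0 \<and> local_estimate \<sigma> \<alpha> p q})"


lemma space_sphere_measure [simp]: "space sphere_measure = sphere 0 1"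
  by (simp add: sphere_measure_def space_scale_measure space_restrict_space)

lemma sets_sphere_measure [simp, measurable_cong]:
  "sets sphere_measure = sets (restrict_space borel (sphere 0 1))"
  by (simp add: sphere_measure_def)

lemma emeasure_sphere_measure:
  fixes A :: "'a::euclidean_space set"
  assumes A: "A \<in> sets borel" "A \<subseteq> sphere 0 1"
  shows "emeasure sphere_measure A =
    of_nat DIM('a) * emeasure lborel {t *\<^sub>R x | t x. 0 < t \<and> t \<le> 1 \<and> x \<in> A}"
proof -
  let ?B = "cball 0 1 - {0::'a}"
  let ?g = "\<lambda>x::'a. x /\<^sub>R norm x"
  have g: "?g \<in> restrict_space lborel ?B \<rightarrow>\<^sub>M restrict_space borel (sphere 0 1)"
    by (intro measurable_restrict_space2 measurable_restrict_space1) (auto simp: space_restrict_space)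
  have A': "A \<in> sets (restrict_space borel (sphere 0 1))"
    using A by (auto simp: sets_restrict_space)
  have eq: "?g -` A \<inter> ?B = {t *\<^sub>R x | t x. 0 < t \<and> t \<le> 1 \<and> x \<in> A}"
  proof (intro equalityI subsetI)
    fix y assume y: "y \<in> ?g -` A \<inter> ?B"
    then have "y = norm y *\<^sub>R ?g y" "0 < norm y" "norm y \<le> 1" "?g y \<in> A" by auto
    then show "y \<in> {t *\<^sub>R x | t x. 0 < t \<and> t \<le> 1 \<and> x \<in> A}" by blast
  next
    fix y assume "y \<in> {t *\<^sub>R x | t x. 0 < t \<and> t \<le> 1 \<and> x \<in> A}"
    then obtain t x where y: "y = t *\<^sub>R x" "0 < t" "t \<le> 1" "x \<in> A" by blast
    moreover have "norm x = 1" using y A by auto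
    ultimately show "y \<in> ?g -` A \<inter> ?B" by auto
  qed
  have "emeasure sphere_measure A =
      of_nat DIM('a) * emeasure (restrict_space lborel ?B) (?g -` A \<inter> ?B)"
    unfolding sphere_measure_def emeasure_scale_measure
    by (subst emeasure_distr[OF g A']) (simp add: space_restrict_space)
  also have "emeasure (restrict_space lborel ?B) (?g -` A \<inter> ?B) = emeasure lborel (?g -` A \<inter> ?B)"
    by (rule emeasure_restrict_space) auto
  finally show ?thesis by (simp add: eq)
qed

lemma emeasure_sphere_measure_space:
  "emeasure (sphere_measure :: 'a::euclidean_space measure) (sphere 0 1) =
     ennreal (real DIM('a) * unit_ball_vol (real DIM('a)))"
proof -
  let ?T = "{t *\<^sub>R x | t x. 0 < t \<and> t \<le> 1 \<and> x \<in> sphere 0 1} :: 'a set"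
  have "?T = cball 0 1 - {0}"
  proof (intro equalityI subsetI)
    fix y :: 'a assume y: "y \<in> cball 0 1 - {0}"
    then have "y = norm y *\<^sub>R (y /\<^sub>R norm y)" "0 < norm y" "norm y \<le> 1" "y /\<^sub>R norm y \<in> sphere 0 1"
      by auto
    then show "y \<in> ?T" by blast
  qed auto
  then have "emeasure lborel ?T = emeasure lborel (cball 0 1 :: 'a set)"
    by (simp add: emeasure_Diff)
  also have "\<dots> = ennreal (unit_ball_vol (real DIM('a)))"
    using emeasure_cball[of 1 "0::'a"] by simp
  finally have "emeasure lborel ?T = ennreal (unit_ball_vol (real DIM('a)))" .
  then show ?thesis
    by (subst emeasure_sphere_measure) (simp_all add: ennreal_mult ennreal_of_nat_eq_real_of_nat)
qed

end

theory Submission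
  imports Defs "HOL-Real_Asymp.Real_Asymp"
begin

text \<open>
  Each bound comes from testing a supposed estimate with exponent \<open>q\<close> on an explicit pair \<open>(f, H)\<close>,
  where \<open>H\<close> is the indicator of a bounded set \<open>Y\<close>. Three examples suffice.

  (1) \<open>q \<ge> 2\<close> for every \<open>\<alpha> > 0\<close>. Let \<open>f\<close> be a Rudin--Shapiro polynomial with \<open>N\<close> terms in
  \<open>exp (2 \<pi> i D \<xi>\<^sub>b)\<close>, divided by the square root of \<open>N\<close> so that it is bounded, and cut off so that \<open>\<xi>\<^sub>b\<close> becomes
  uniformly distributed. By orthogonality \<open>|Ef|\<close> is about \<open>N powr (-1/2)\<close> at the \<open>N\<close> points \<open>D m b\<close>, and for
  \<open>D \<ge> N powr (1/\<alpha>)\<close> tiny balls around these points form a set with the same \<open>A\<^sub>\<alpha>\<close> as a single one.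

  (2) \<open>q \<ge> 2 \<alpha> / (n - 1)\<close>. With \<open>R^(n - 1)\<close> disjoint caps of radius about \<open>1 / R\<close> and suitable signs, the
  integral of \<open>|Ef|^2\<close> over the ball of radius \<open>R\<close> is at least \<open>c R\<close>; take \<open>Y\<close> to be that ball.

  (3) \<open>q \<ge> min (\<alpha> + 2) (3 \<alpha>)\<close> in the plane. For \<open>f = exp (i N \<theta>)\<close> on an arc, \<open>Ef\<close> behaves like the Bessel
  function \<open>J\<^sub>N\<close> of \<open>2 \<pi> |x|\<close>, which has size \<open>N powr (-1/3)\<close> on an annulus of width \<open>N powr (1/3)\<close> at its
  turning point \<open>2 \<pi> |x| = N\<close>.
\<close>

section \<open>Testing the estimate on indicator functions\<close>

text \<open>The loss \<open>R powr \<epsilon>\<close> and all constants disappear at the end: each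
  example is a family whose parameter tends to infinity, only the exponents of that parameter are
  compared, and then \<epsilon> tends to 0. Tiny balls are possible because
  \<open>weight_const\<close> tests radii at least 1 only: the balls may shrink until the
  oscillation of the extension is harmless, their common volume occurs on both sides and cancels,
  and what remains is a count of centres. Since p is infinite, multiplying \<open>f\<close> by a
  bounded density costs a constant. This replaces polar coordinates: volume on a suitable cone
  projects to a measure dominated by surface measure, hence with bounded density, and one more
  bounded factor makes a latitude uniformly distributed. The disjoint caps control only a mean
  square; passing from there to exponent q requires q \<ge> 2, which the first example provides. The
  bound 2 also settles the ranges with the values (n - 1) / n and 1 / 2.\<close>

lemma emeasure_bounded_borel:
  fixes Y :: "'a::euclidean_space set"
  assumes "Y \<in> sets borel" "bounded Y"
  shows "emeasure lborel Y = ennreal (measure lborel Y)"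
  using emeasure_bounded_finite[OF assms(2)] by (intro emeasure_eq_ennreal_measure) (simp add: less_top)

text \<open>The bound \<open>B\<close> on \<open>f\<close> is fixed in advance, so its power is
  absorbed in \<open>C\<close>, and the mass bound for \<open>Y\<close> says that its indicator has
  weight constant at most \<open>A\<close>. As \<open>C\<close> precedes \<open>f\<close>,
  \<open>Y\<close>, \<open>R\<close> and \<open>A\<close>, one constant serves a whole family of
  examples.\<close>

lemma local_estimate_set:
  fixes \<sigma> :: "'a::euclidean_space measure"
  assumes loc: "local_estimate \<sigma> \<alpha> \<infinity> q" and "q > 0" "\<epsilon> > 0" "B > 0"
  obtains C where "C > 0"
    "\<And>f Y R A. f \<in> borel_measurable \<sigma> \<Longrightarrow> (AE \<xi> in \<sigma>. norm (f \<xi>) \<le> B) \<Longrightarrow> Y \<in> sets borel \<Longrightarrow>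
       Y \<subseteq> cball 0 R \<Longrightarrow> R \<ge> 1 \<Longrightarrow> A \<ge> 0 \<Longrightarrow>
       (\<And>x0 r. r \<ge> 1 \<Longrightarrow> measure lborel (Y \<inter> cball x0 r) \<le> A * r powr \<alpha>) \<Longrightarrow>
       (\<integral>\<^sup>+x. ennreal (norm (extension_op \<sigma> f x) powr q) * indicator Y x \<partial>lborel)
         \<le> ennreal (C * R powr \<epsilon> * A)"
proof -
  obtain C where C: "C > 0" and est: "\<And>f H R. in_Lp \<infinity> \<sigma> f \<Longrightarrow> is_weight \<alpha> H \<Longrightarrow> R \<ge> 1 \<Longrightarrow>
        (\<integral>\<^sup>+x\<in>cball 0 R. ennreal (norm (extension_op \<sigma> f x) powr q * H x) \<partial>lebesgue)
          \<le> ennreal (C * R powr \<epsilon>) * weight_const \<alpha> H * ennreal (Lp_norm \<infinity> \<sigma> f powr q)"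
    using loc \<open>\<epsilon> > 0\<close> unfolding local_estimate_def by blast
  show ?thesis
  proof (rule that[of "C * B powr q"])
    show "C * B powr q > 0" using C \<open>B > 0\<close> by simp
  next
    fix f :: "'a \<Rightarrow> complex" and Y :: "'a set" and R A :: real
    assume f[measurable]: "f \<in> borel_measurable \<sigma>" and AE: "AE \<xi> in \<sigma>. norm (f \<xi>) \<le> B"
      and Y: "Y \<in> sets borel" and sub: "Y \<subseteq> cball 0 R" and R: "R \<ge> 1" and A: "A \<ge> 0"
      and mass: "\<And>x0 r. r \<ge> 1 \<Longrightarrow> measure lborel (Y \<inter> cball x0 r) \<le> A * r powr \<alpha>"
    let ?H = "indicat_real Y"
    have ess: "esssup \<sigma> (\<lambda>x. ennreal (norm (f x))) \<le> ennreal B"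
      using AE by (intro esssup_I) (auto intro: ennreal_leI)
    have Lp: "in_Lp \<infinity> \<sigma> f"
      using ess by (auto simp: in_Lp_def less_top[symmetric] top_unique)
    have Lpn: "Lp_norm \<infinity> \<sigma> f powr q \<le> B powr q"
    proof (rule powr_mono2)
      show "Lp_norm \<infinity> \<sigma> f \<le> B"
        using enn2real_mono[OF ess] \<open>B > 0\<close> by (simp add: Lp_norm_def)
    qed (use \<open>q > 0\<close> in \<open>auto simp: Lp_norm_def\<close>)
    have wc: "weight_const \<alpha> ?H \<le> ennreal A"
      unfolding weight_const_def
    proof (rule Inf_lower, safe)
      fix x0 :: 'a and r :: real assume r: "1 \<le> r"
      have "(\<integral>\<^sup>+x\<in>cball x0 r. ennreal (?H x) \<partial>lebesgue) = (\<integral>\<^sup>+x. indicator (Y \<inter> cball x0 r) x \<partial>lborel)"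
        unfolding nn_integral_completion
        by (intro nn_integral_cong) (auto simp: indicator_def)
      also have "\<dots> = emeasure lborel (Y \<inter> cball x0 r)"
        using Y by simp
      also have "\<dots> = ennreal (measure lborel (Y \<inter> cball x0 r))"
        using Y by (intro emeasure_bounded_borel) auto
      also have "\<dots> \<le> ennreal (A * r powr \<alpha>)"
        using mass[OF r] by (rule ennreal_leI)
      also have "\<dots> = ennreal A * ennreal (r powr \<alpha>)"
        using A by (simp add: ennreal_mult)
      finally show "(\<integral>\<^sup>+x\<in>cball x0 r. ennreal (?H x) \<partial>lebesgue) \<le> ennreal A * ennreal (r powr \<alpha>)" .
    qed
    have H: "is_weight \<alpha> ?H"
      unfolding is_weight_def
    proof (intro conjI allI)
      show "?H \<in> borel_measurable lebesgue"
        using Y by (intro borel_measurable_indicator) (auto intro: sets_completionI_sets)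
      show "weight_const \<alpha> ?H < \<infinity>"
        using wc by (auto simp: less_top[symmetric] top_unique)
    qed (auto simp: indicator_def)
    have "(\<integral>\<^sup>+x. ennreal (norm (extension_op \<sigma> f x) powr q) * indicator Y x \<partial>lborel) =
        (\<integral>\<^sup>+x\<in>cball 0 R. ennreal (norm (extension_op \<sigma> f x) powr q * ?H x) \<partial>lebesgue)"
      unfolding nn_integral_completion
      using sub by (intro nn_integral_cong) (auto simp: indicator_def)
    also have "\<dots> \<le> ennreal (C * R powr \<epsilon>) * weight_const \<alpha> ?H * ennreal (Lp_norm \<infinity> \<sigma> f powr q)"
      by (rule est[OF Lp H R])
    also have "\<dots> \<le> ennreal (C * R powr \<epsilon>) * ennreal A * ennreal (B powr q)"
      by (intro mult_mono wc ennreal_leI Lpn order_refl) auto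
    also have "\<dots> = ennreal (C * B powr q * R powr \<epsilon> * A)"
      using C A by (simp add: ennreal_mult[symmetric] mult_ac)
    finally show "(\<integral>\<^sup>+x. ennreal (norm (extension_op \<sigma> f x) powr q) * indicator Y x \<partial>lborel) \<le>
        ennreal (C * B powr q * R powr \<epsilon> * A)" .
  qed
qed

text \<open>The form for examples in which the extension is bounded below pointwise on
  \<open>Y\<close>; the disjoint caps, known only in mean square, need the integral form
  above.\<close>

lemma local_estimate_lower:
  fixes \<sigma> :: "'a::euclidean_space measure"
  assumes loc: "local_estimate \<sigma> \<alpha> \<infinity> q" and "q > 0" "\<epsilon> > 0" "B > 0"
  obtains C where "C > 0"
    "\<And>f Y R A l. f \<in> borel_measurable \<sigma> \<Longrightarrow> (AE \<xi> in \<sigma>. norm (f \<xi>) \<le> B) \<Longrightarrow> Y \<in> sets borel \<Longrightarrow>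
       Y \<subseteq> cball 0 R \<Longrightarrow> R \<ge> 1 \<Longrightarrow> A \<ge> 0 \<Longrightarrow> l \<ge> 0 \<Longrightarrow>
       (\<And>x0 r. r \<ge> 1 \<Longrightarrow> measure lborel (Y \<inter> cball x0 r) \<le> A * r powr \<alpha>) \<Longrightarrow>
       (\<And>x. x \<in> Y \<Longrightarrow> l \<le> norm (extension_op \<sigma> f x)) \<Longrightarrow>
       l powr q * measure lborel Y \<le> C * R powr \<epsilon> * A"
proof (rule local_estimate_set[OF assms])
  fix C assume C: "C > 0" and est: "\<And>(f :: 'a \<Rightarrow> complex) Y R A. f \<in> borel_measurable \<sigma> \<Longrightarrow>
       (AE \<xi> in \<sigma>. norm (f \<xi>) \<le> B) \<Longrightarrow> Y \<in> sets borel \<Longrightarrow>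
       Y \<subseteq> cball 0 R \<Longrightarrow> R \<ge> 1 \<Longrightarrow> A \<ge> 0 \<Longrightarrow>
       (\<And>x0 r. r \<ge> 1 \<Longrightarrow> measure lborel (Y \<inter> cball x0 r) \<le> A * r powr \<alpha>) \<Longrightarrow>
       (\<integral>\<^sup>+x. ennreal (norm (extension_op \<sigma> f x) powr q) * indicator Y x \<partial>lborel)
         \<le> ennreal (C * R powr \<epsilon> * A)"
  show thesis
  proof (rule that[OF C])
    fix f :: "'a \<Rightarrow> complex" and Y :: "'a set" and R A l :: real
    assume *: "f \<in> borel_measurable \<sigma>" "AE \<xi> in \<sigma>. norm (f \<xi>) \<le> B" "Y \<in> sets borel"
       "Y \<subseteq> cball 0 R" "R \<ge> 1" "A \<ge> 0"
       "\<And>x0 r. r \<ge> 1 \<Longrightarrow> measure lborel (Y \<inter> cball x0 r) \<le> A * r powr \<alpha>"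
      and l: "l \<ge> 0" "\<And>x. x \<in> Y \<Longrightarrow> l \<le> norm (extension_op \<sigma> f x)"
    have "bounded Y" using *(4) bounded_subset bounded_cball by blast
    then have "ennreal (l powr q * measure lborel Y) = ennreal (l powr q) * emeasure lborel Y"
      using *(3) by (simp add: emeasure_bounded_borel ennreal_mult)
    also have "\<dots> = (\<integral>\<^sup>+x. ennreal (l powr q) * indicator Y x \<partial>lborel)"
      using *(3) by (simp add: nn_integral_cmult_indicator)
    also have "\<dots> \<le> (\<integral>\<^sup>+x. ennreal (norm (extension_op \<sigma> f x) powr q) * indicator Y x \<partial>lborel)"
      using l \<open>q > 0\<close>
      by (intro nn_integral_mono) (auto simp: indicator_def intro!: ennreal_leI powr_mono2)
    also have "\<dots> \<le> ennreal (C * R powr \<epsilon> * A)"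
      by (rule est[OF *])
    finally show "l powr q * measure lborel Y \<le> C * R powr \<epsilon> * A"
      using C *(6) by (simp add: ennreal_le_iff)
  qed
qed

section \<open>From estimates with \<epsilon>-loss to exponents\<close>

lemma Q_loc_ge:
  assumes "\<And>q. q > 0 \<Longrightarrow> local_estimate \<sigma> \<alpha> p q \<Longrightarrow> t \<le> q"
  shows "Q_loc \<sigma> \<alpha> p \<ge> ereal t"
  unfolding Q_loc_def using assms by (auto intro!: Inf_greatest)

text \<open>If \<open>v < u\<close>, then \<open>real n powr (u - v)\<close> eventually exceeds
  every constant. An inequality valid infinitely often is enough, since the Rudin--Shapiro example
  exists only for powers of two.\<close>

lemma powr_exponent_le:
  fixes u v c C :: real
  assumes "c > 0" and ev: "\<exists>\<^sub>F n in sequentially. c * real n powr u \<le> C * real n powr v"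
  shows "u \<le> v"
proof (rule ccontr)
  assume "\<not> u \<le> v"
  then have "filterlim (\<lambda>n. real n powr (u - v)) at_top sequentially"
    by real_asymp
  then have "\<forall>\<^sub>F n in sequentially. real n powr (u - v) > \<bar>C\<bar> / c"
    by (simp add: filterlim_at_top_dense)
  then have "\<forall>\<^sub>F n in sequentially. \<not> (c * real n powr u \<le> C * real n powr v)"
    using eventually_gt_at_top[of 0]
  proof eventually_elim
    case (elim n)
    then have "c * real n powr (u - v) > C"
      using \<open>c > 0\<close> by (simp add: field_simps)
    then have "c * real n powr (u - v) * real n powr v > C * real n powr v"
      using elim by simp
    moreover have "real n powr (u - v) * real n powr v = real n powr u"
      by (simp add: powr_add[symmetric])
    ultimately show ?case by (simp add: mult.assoc)
  qed
  then show False using ev by (simp add: frequently_def)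
qed

lemma le_of_all_eps:
  fixes u v :: real
  assumes "v \<ge> 0" "\<And>\<epsilon>. \<epsilon> > 0 \<Longrightarrow> u \<le> w + v * \<epsilon>"
  shows "u \<le> w"
proof (rule field_le_epsilon)
  fix e :: real assume "e > 0"
  then have "u \<le> w + v * (e / (v + 1))"
    using assms by (intro assms(2)) auto
  also have "v * (e / (v + 1)) \<le> e"
    using assms(1) \<open>e > 0\<close> by (simp add: field_simps)
  finally show "u \<le> w + e" by simp
qed

section \<open>Measures dominated by the surface measure\<close>

text \<open>The Radon--Nikodym derivative is at most \<open>C\<close> almost everywhere, because its
  excess over \<open>C\<close> integrates to 0 on the set where it exceeds \<open>C\<close>.
  Truncation then gives a real version bounded at every point, ready to serve as a factor of
  \<open>f\<close>.\<close>

lemma bounded_Radon_Nikodym: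
  assumes "finite_measure M" and sets_eq: "sets N = sets M" and "C \<ge> 0"
    and dom: "\<And>A. A \<in> sets M \<Longrightarrow> emeasure N A \<le> ennreal C * emeasure M A"
  obtains g :: "'a \<Rightarrow> real" where "g \<in> borel_measurable M" "\<And>x. 0 \<le> g x" "\<And>x. g x \<le> C"
    "N = density M (\<lambda>x. ennreal (g x))"
proof -
  interpret finite_measure M by fact
  have "absolutely_continuous M N"
    unfolding absolutely_continuous_def
  proof
    fix A assume "A \<in> null_sets M"
    then show "A \<in> null_sets N"
      using dom[of A] by (auto simp: null_sets_def sets_eq)
  qed
  then obtain h where h[measurable]: "h \<in> borel_measurable M" and N: "density M h = N"
    using Radon_Nikodym[OF _ sets_eq] by blast
  define A where "A = {x \<in> space M. ennreal C < h x}"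
  have A[measurable]: "A \<in> sets M" by (simp add: A_def)
  have "(\<integral>\<^sup>+x. (h x - ennreal C) * indicator A x \<partial>M) = (\<integral>\<^sup>+x. h x * indicator A x - ennreal C * indicator A x \<partial>M)"
    by (intro nn_integral_cong) (auto simp: indicator_def)
  also have "\<dots> = (\<integral>\<^sup>+x. h x * indicator A x \<partial>M) - (\<integral>\<^sup>+x. ennreal C * indicator A x \<partial>M)"
  proof (rule nn_integral_diff)
    show "(\<integral>\<^sup>+x. ennreal C * indicator A x \<partial>M) \<noteq> \<infinity>"
      using emeasure_finite[of A] by (simp add: nn_integral_cmult_indicator ennreal_mult_eq_top_iff)
  qed (auto simp: A_def indicator_def intro: less_imp_le)
  also have "\<dots> = emeasure N A - ennreal C * emeasure M A"
    by (simp add: N[symmetric] emeasure_density nn_integral_cmult_indicator)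
  also have "\<dots> = 0"
    using dom[OF A] emeasure_finite[of A]
    by (auto simp: diff_eq_0_iff_ennreal ennreal_mult_eq_top_iff less_top[symmetric] top_unique)
  finally have "AE x in M. (h x - ennreal C) * indicator A x = 0"
    by (subst (asm) nn_integral_0_iff_AE) auto
  then have AE: "AE x in M. h x \<le> ennreal C"
  proof (rule AE_mp, intro AE_I2 impI)
    fix x assume "x \<in> space M" "(h x - ennreal C) * indicator A x = 0"
    then show "h x \<le> ennreal C"
      by (cases "x \<in> A") (auto simp: A_def not_less diff_eq_0_iff_ennreal)
  qed
  define g where "g x = enn2real (min (h x) (ennreal C))" for x
  have gh: "ennreal (g x) = min (h x) (ennreal C)" for x
  proof -
    have "min (h x) (ennreal C) \<le> ennreal C" by simp
    then show ?thesis unfolding g_def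
      by (metis ennreal_enn2real_if ennreal_neq_top top_unique)
  qed
  show ?thesis
  proof (rule that[of g])
    show "g \<in> borel_measurable M" by (simp add: g_def[abs_def])
    show "g x \<le> C" for x
      using gh[of x] \<open>C \<ge> 0\<close> by (metis ennreal_le_iff min.cobounded2)
    have "N = density M h" by (simp add: N)
    also have "\<dots> = density M (\<lambda>x. ennreal (g x))"
      using AE by (intro density_cong) (auto simp: gh min_def elim!: eventually_mono)
    finally show "N = density M (\<lambda>x. ennreal (g x))" .
  qed (simp add: g_def)
qed

section \<open>Bounded functions on the sphere and radial projection\<close>

lemma finite_measure_sphere_measure [simp]: "finite_measure (sphere_measure :: 'a::euclidean_space measure)"
  by (rule finite_measureI) (simp only: space_sphere_measure emeasure_sphere_measure_space, simp)

lemma measurable_sphere_measure [simp]: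
  "borel_measurable sphere_measure = borel_measurable (restrict_space borel (sphere 0 1))"
  by (rule measurable_cong_sets) simp_all

lemma measurable_normalize:
  assumes "Z \<subseteq> - {0 :: 'a::euclidean_space}"
  shows "(\<lambda>x. x /\<^sub>R norm x) \<in> restrict_space lborel Z \<rightarrow>\<^sub>M restrict_space borel (sphere 0 1)"
proof (intro measurable_restrict_space2 measurable_restrict_space1)
  show "(\<lambda>x. x /\<^sub>R norm x) \<in> space (restrict_space lborel Z) \<rightarrow> sphere 0 1"
  proof
    fix x assume "x \<in> space (restrict_space lborel Z)"
    then have "x \<noteq> 0" using assms by (auto simp: space_restrict_space)
    then show "x /\<^sub>R norm x \<in> sphere 0 1" by simp
  qed
qed simp

lemma bounded_extension_integrable:
  fixes f :: "'a::euclidean_space \<Rightarrow> complex"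
  assumes [measurable]: "f \<in> borel_measurable sphere_measure"
    and "AE \<xi> in sphere_measure. norm (f \<xi>) \<le> B"
  shows "integrable sphere_measure
    (\<lambda>\<xi>. exp (- 2 * complex_of_real pi * \<i> * complex_of_real (x \<bullet> \<xi>)) * f \<xi>)"
proof (rule finite_measure.integrable_const_bound[of _ _ B])
  show "AE \<xi> in sphere_measure. norm (exp (- 2 * complex_of_real pi * \<i> * complex_of_real (x \<bullet> \<xi>)) * f \<xi>) \<le> B"
    using assms(2) by eventually_elim (simp add: norm_mult)
  have "(\<lambda>\<xi>. exp (- 2 * complex_of_real pi * \<i> * complex_of_real (x \<bullet> \<xi>)))
          \<in> borel_measurable (restrict_space borel (sphere 0 1))"
    by (intro measurable_restrict_space1) simp
  then show "(\<lambda>\<xi>. exp (- 2 * complex_of_real pi * \<i> * complex_of_real (x \<bullet> \<xi>)) * f \<xi>)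
          \<in> borel_measurable sphere_measure"
    using assms(1) by simp
qed simp

text \<open>Dominated convergence with the constant \<open>B\<close>. Continuity spreads a value at
  one point to a small ball and makes the extension Borel.\<close>

lemma continuous_extension_op:
  fixes f :: "'a::euclidean_space \<Rightarrow> complex"
  assumes f: "f \<in> borel_measurable sphere_measure"
    and bd: "AE \<xi> in sphere_measure. norm (f \<xi>) \<le> B"
  shows "continuous_on UNIV (extension_op sphere_measure f)"
  unfolding continuous_on_sequentially
proof (safe)
  fix X :: "nat \<Rightarrow> 'a" and x assume lim: "X \<longlonglongrightarrow> x"
  show "(extension_op sphere_measure f \<circ> X) \<longlonglongrightarrow> extension_op sphere_measure f x"
    unfolding extension_op_def comp_def
  proof (rule integral_dominated_convergence[where w = "\<lambda>_. B"])
    show "integrable sphere_measure (\<lambda>_::'a. B)"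
      by (rule finite_measure.integrable_const) simp
    show "AE \<xi> in sphere_measure. (\<lambda>i. exp (- 2 * complex_of_real pi * \<i> * complex_of_real (X i \<bullet> \<xi>)) * f \<xi>)
        \<longlonglongrightarrow> exp (- 2 * complex_of_real pi * \<i> * complex_of_real (x \<bullet> \<xi>)) * f \<xi>"
      using lim by (intro AE_I2 tendsto_intros)
    show "AE \<xi> in sphere_measure. norm (exp (- 2 * complex_of_real pi * \<i> * complex_of_real (X i \<bullet> \<xi>)) * f \<xi>) \<le> B" for i
      using bd by eventually_elim (simp add: norm_mult)
  qed (use bounded_extension_integrable[OF assms] in \<open>blast intro: borel_measurable_integrable\<close>)+
qed

text \<open>The area of \<open>A\<close> is the dimension times the volume of the full cone over
  \<open>A\<close>; \<open>Z\<close> meets only part of that cone, and the dimension is at least 1.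
  This serves both to dominate projected volume and to bound caps from below.\<close>

lemma emeasure_cone_le:
  fixes Z :: "'a::euclidean_space set"
  assumes Z[measurable]: "Z \<in> sets borel" and sub: "Z \<subseteq> cball 0 1 - {0}" and A: "A \<in> sets sphere_measure"
  shows "emeasure lborel ((\<lambda>x. x /\<^sub>R norm x) -` A \<inter> Z) \<le> emeasure sphere_measure A"
proof -
  let ?h = "\<lambda>x::'a. x /\<^sub>R norm x"
  let ?S = "restrict_space borel (sphere 0 1) :: 'a measure"
  let ?B = "cball 0 1 - {0::'a}"
  have hB: "?h \<in> restrict_space lborel ?B \<rightarrow>\<^sub>M ?S"
    by (intro measurable_normalize) auto
  have A': "A \<in> sets ?S" using A by simp
  have mB: "?h -` A \<inter> ?B \<in> sets lborel"
    using measurable_sets[OF hB A'] by (simp add: sets_restrict_space_iff space_restrict_space)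
  have "emeasure lborel (?h -` A \<inter> Z) \<le> emeasure lborel (?h -` A \<inter> ?B)"
    using sub mB by (intro emeasure_mono) auto
  also have "\<dots> = emeasure (restrict_space lborel ?B) (?h -` A \<inter> ?B)"
    by (rule emeasure_restrict_space[symmetric]) auto
  also have "\<dots> \<le> of_nat DIM('a) * emeasure (restrict_space lborel ?B) (?h -` A \<inter> ?B)"
  proof -
    have "(1::ennreal) \<le> of_nat DIM('a)"
      by (metis DIM_positive One_nat_def Suc_leI of_nat_1 of_nat_mono)
    from mult_right_mono[OF this] show ?thesis by simp
  qed
  also have "\<dots> = emeasure sphere_measure A"
    unfolding sphere_measure_def emeasure_scale_measure
    by (subst emeasure_distr[OF hB A']) (simp add: space_restrict_space)
  finally show ?thesis .
qed

text \<open>Volume on \<open>Z\<close>, projected radially, is dominated by surface measure and so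
  has a density between 0 and 1. Integrals against that density become volume integrals, and the
  shape of \<open>Z\<close> is free to choose.\<close>

lemma sphere_density_of_cone:
  fixes Z :: "'a::euclidean_space set"
  assumes Z[measurable]: "Z \<in> sets borel" and sub: "Z \<subseteq> cball 0 1 - {0}"
  obtains g :: "'a \<Rightarrow> real" where "g \<in> borel_measurable sphere_measure" "\<And>\<xi>. 0 \<le> g \<xi>" "\<And>\<xi>. g \<xi> \<le> 1"
    "\<And>G :: 'a \<Rightarrow> complex. G \<in> borel_measurable sphere_measure \<Longrightarrow>
       (\<integral>\<xi>. complex_of_real (g \<xi>) * G \<xi> \<partial>sphere_measure) = (LINT x:Z|lborel. G (x /\<^sub>R norm x))"
proof -
  let ?h = "\<lambda>x::'a. x /\<^sub>R norm x"
  let ?S = "restrict_space borel (sphere 0 1) :: 'a measure"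
  define N where "N = distr (restrict_space lborel Z) ?S ?h"
  have hZ: "?h \<in> restrict_space lborel Z \<rightarrow>\<^sub>M ?S"
    using sub by (auto intro!: measurable_normalize)
  have dom: "emeasure N A \<le> ennreal 1 * emeasure sphere_measure A" if "A \<in> sets sphere_measure" for A
  proof -
    have A: "A \<in> sets ?S" using that by simp
    have "emeasure N A = emeasure (restrict_space lborel Z) (?h -` A \<inter> Z)"
      unfolding N_def by (subst emeasure_distr[OF hZ A]) (simp add: space_restrict_space)
    also have "\<dots> = emeasure lborel (?h -` A \<inter> Z)"
      by (rule emeasure_restrict_space) auto
    also have "\<dots> \<le> emeasure sphere_measure A"
      by (rule emeasure_cone_le[OF Z sub that])
    finally show ?thesis by simp
  qed
  obtain g :: "'a \<Rightarrow> real" where g: "g \<in> borel_measurable sphere_measure" "\<And>x. 0 \<le> g x" "\<And>x. g x \<le> 1"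
    and N: "N = density sphere_measure (\<lambda>x. ennreal (g x))"
    by (rule bounded_Radon_Nikodym[of sphere_measure N 1]) (use dom in \<open>auto simp: N_def\<close>)
  show ?thesis
  proof (rule that[OF g])
    fix G :: "'a \<Rightarrow> complex" assume G: "G \<in> borel_measurable sphere_measure"
    have "(\<integral>\<xi>. complex_of_real (g \<xi>) * G \<xi> \<partial>sphere_measure) = (\<integral>\<xi>. G \<xi> \<partial>N)"
      unfolding N using g G by (subst integral_density) (auto simp: scaleR_conv_of_real)
    also have "\<dots> = (\<integral>x. G (?h x) \<partial>restrict_space lborel Z)"
      unfolding N_def using G hZ by (subst integral_distr) auto
    also have "\<dots> = (LINT x:Z|lborel. G (?h x))"
      unfolding set_lebesgue_integral_def by (subst integral_restrict_space) auto
    finally show "(\<integral>\<xi>. complex_of_real (g \<xi>) * G \<xi> \<partial>sphere_measure) = (LINT x:Z|lborel. G (?h x))" .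
  qed
qed

text \<open>The norm of \<open>x - (x \<bullet> b) *\<^sub>R b\<close> is the distance to the axis
  through \<open>b\<close>; \<open>x \<bullet> b\<close> divided by it is the tangent of the
  latitude. Truncating at this distance instead of at \<open>norm x\<close> makes the sets
  correspond under stretching along \<open>b\<close>, and 1/2 keeps the cone of slope 1 in the unit
  ball. The condition on \<open>a\<close> keeps the distance positive and, in the plane, selects one
  quarter.\<close>

definition slope_cone :: "'a::euclidean_space \<Rightarrow> 'a \<Rightarrow> real \<Rightarrow> 'a set" where
  "slope_cone a b t = {x. norm (x - (x \<bullet> b) *\<^sub>R b) \<le> 1 / 2 \<and> 0 < x \<bullet> a \<and> 0 < x \<bullet> b \<and>
     x \<bullet> b \<le> t * norm (x - (x \<bullet> b) *\<^sub>R b)}"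

lemma slope_cone_borel [measurable]: "slope_cone a b t \<in> sets borel"
  unfolding slope_cone_def by measurable

context
  fixes a b :: "'a::euclidean_space"
  assumes a: "a \<in> Basis" and b: "b \<in> Basis" and ab: "a \<noteq> b"
begin

lemma norm_perp_pos:
  assumes "0 < x \<bullet> a"
  shows "0 < norm (x - (x \<bullet> b) *\<^sub>R b)"
proof -
  have "(x - (x \<bullet> b) *\<^sub>R b) \<bullet> a = x \<bullet> a"
    using a b ab by (simp add: inner_diff_left inner_not_same_Basis)
  then show ?thesis using assms by auto
qed

lemma norm_perp_sq: "(norm x)\<^sup>2 = (norm (x - (x \<bullet> b) *\<^sub>R b))\<^sup>2 + (x \<bullet> b)\<^sup>2"
  using b unfolding power2_norm_eq_inner
  by (simp add: inner_diff_left inner_diff_right power2_eq_square inner_commute[of b x])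

lemma slope_cone_subset: "slope_cone a b 1 \<subseteq> cball 0 1 - {0}"
proof
  fix x assume x: "x \<in> slope_cone a b 1"
  let ?N = "norm (x - (x \<bullet> b) *\<^sub>R b)"
  have N: "?N \<le> 1 / 2" "0 < x \<bullet> b" "x \<bullet> b \<le> ?N" using x by (auto simp: slope_cone_def)
  have "?N\<^sup>2 \<le> (1/2)\<^sup>2" "(x \<bullet> b)\<^sup>2 \<le> (1/2)\<^sup>2"
    using N by (intro power_mono; linarith)+
  then have "(norm x)\<^sup>2 \<le> 1\<^sup>2"
    unfolding norm_perp_sq[of x] by (simp add: power2_eq_square)
  then have "norm x \<le> 1" by (rule power2_le_imp_le) simp
  with N show "x \<in> cball 0 1 - {0}" by auto
qed

text \<open>
  Stretching the \<open>b\<close>-axis by \<open>t\<close> maps the cone of slope \<open>1\<close> onto the cone of slope \<open>t\<close>. This makes the slope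
  uniformly distributed and replaces polar coordinates.
\<close>

lemma emeasure_slope_cone:
  assumes "t > 0"
  shows "emeasure lborel (slope_cone a b t) = ennreal t * emeasure lborel (slope_cone a b 1)"
proof -
  define c where "c j = (if j = b then t else 1)" for j
  define T where "T x = 0 + (\<Sum>j\<in>Basis. (c j * (x \<bullet> j)) *\<^sub>R j)" for x :: 'a
  have Tj: "T x \<bullet> j = c j * (x \<bullet> j)" if "j \<in> Basis" for x j
    using that by (simp add: T_def)
  have Tb: "T x \<bullet> b = t * (x \<bullet> b)" and Ta: "T x \<bullet> a = x \<bullet> a" for x
    using Tj[OF b] Tj[OF a] ab by (auto simp: c_def)
  have Tp: "T x - (T x \<bullet> b) *\<^sub>R b = x - (x \<bullet> b) *\<^sub>R b" for x
  proof (rule euclidean_eqI)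
    fix j :: 'a assume "j \<in> Basis"
    then show "(T x - (T x \<bullet> b) *\<^sub>R b) \<bullet> j = (x - (x \<bullet> b) *\<^sub>R b) \<bullet> j"
      using b Tb[of x] Tj[of j x] by (cases "j = b") (auto simp: inner_diff_left inner_not_same_Basis c_def)
  qed
  have [measurable]: "T \<in> borel \<rightarrow>\<^sub>M borel" unfolding T_def by measurable
  have "(\<Prod>j\<in>Basis. \<bar>c j\<bar>) = (\<Prod>j\<in>Basis. if j = b then t else 1)"
    using \<open>t > 0\<close> by (intro prod.cong) (auto simp: c_def)
  also have "\<dots> = t" using b by simp
  finally have p: "(\<Prod>j\<in>Basis. \<bar>c j\<bar>) = t" .
  have eq: "lborel = density (distr lborel borel T) (\<lambda>_. ennreal t)"
    unfolding T_def p[symmetric] by (rule lborel_affine_euclidean) (use \<open>t > 0\<close> in \<open>simp add: c_def\<close>)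
  have "emeasure lborel (slope_cone a b t) = ennreal t * emeasure (distr lborel borel T) (slope_cone a b t)"
    by (subst eq) (simp add: emeasure_density nn_integral_cmult_indicator)
  also have "emeasure (distr lborel borel T) (slope_cone a b t) = emeasure lborel (T -` slope_cone a b t)"
    by (subst emeasure_distr) auto
  also have "T -` slope_cone a b t = slope_cone a b 1"
    using \<open>t > 0\<close> by (auto simp: slope_cone_def Tp[unfolded Tb] Tb Ta zero_less_mult_iff)
  finally show ?thesis .
qed

lemma slope_cone_measure_pos: "0 < measure lborel (slope_cone a b 1)"
proof -
  let ?U = "{x. norm (x - (x \<bullet> b) *\<^sub>R b) < 1 / 2 \<and> 0 < x \<bullet> a \<and> 0 < x \<bullet> b \<and>
     x \<bullet> b < norm (x - (x \<bullet> b) *\<^sub>R b)}"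
  have op: "open ?U"
    by (intro open_Collect_conj open_Collect_less continuous_intros)
  define x where "x = (1/4) *\<^sub>R a + (1/8) *\<^sub>R b"
  have xb: "x \<bullet> b = 1/8" and xa: "x \<bullet> a = 1/4"
    using a b ab by (auto simp: x_def inner_add_left inner_not_same_Basis)
  have "x - (x \<bullet> b) *\<^sub>R b = (1/4) *\<^sub>R a"
    unfolding xb by (simp add: x_def)
  then have "norm (x - (x \<bullet> b) *\<^sub>R b) = 1/4"
    using a by simp
  with xa xb have "x \<in> ?U" by simp
  then have "\<not> negligible ?U" using open_not_negligible[OF op] by blast
  moreover have "?U \<subseteq> slope_cone a b 1" by (auto simp: slope_cone_def)
  ultimately have "\<not> negligible (slope_cone a b 1)" using negligible_subset by blast
  then have "emeasure lborel (slope_cone a b 1) \<noteq> 0"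
    by (simp add: negligible_iff_emeasure0)
  moreover have "emeasure lborel (slope_cone a b 1) = ennreal (measure lborel (slope_cone a b 1))"
    using slope_cone_subset by (intro emeasure_bounded_borel) (auto intro: bounded_subset[OF bounded_cball])
  ultimately show ?thesis by (metis ennreal_0 measure_nonneg order_le_less)
qed

text \<open>Finite measures on the line are determined by the rays \<open>{s<..}\<close>. For 0 < s
  < 1 the part of the cone with slope above s is the complement of the cone of slope s, whose volume
  is s times the whole.\<close>

lemma slope_uniform:
  "distr (restrict_space lborel (slope_cone a b 1)) borel (\<lambda>x. (x \<bullet> b) / norm (x - (x \<bullet> b) *\<^sub>R b)) =
     density lborel (\<lambda>s. ennreal (measure lborel (slope_cone a b 1)) * indicator {0<..1} s)"
  (is "distr ?M borel ?k = ?D")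
proof -
  let ?V = "measure lborel (slope_cone a b 1)"
  have V: "emeasure lborel (slope_cone a b 1) = ennreal ?V"
    using slope_cone_subset by (intro emeasure_bounded_borel) (auto intro: bounded_subset[OF bounded_cball])
  have L: "emeasure (distr ?M borel ?k) {s<..} = emeasure lborel {x \<in> slope_cone a b 1. s < ?k x}" for s
  proof -
    have k: "?k \<in> ?M \<rightarrow>\<^sub>M borel" by (intro measurable_restrict_space1) measurable
    have "emeasure (distr ?M borel ?k) {s<..} = emeasure ?M {x \<in> slope_cone a b 1. s < ?k x}"
      by (subst emeasure_distr[OF k]) (auto simp: space_restrict_space intro!: arg_cong[where f="emeasure ?M"])
    also have "\<dots> = emeasure lborel {x \<in> slope_cone a b 1. s < ?k x}"
      by (rule emeasure_restrict_space) auto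
    finally show ?thesis .
  qed
  have R: "emeasure ?D {s<..} = ennreal ?V * emeasure lborel ({0<..1} \<inter> {s<..})" for s
  proof -
    have "emeasure ?D {s<..} = (\<integral>\<^sup>+x. ennreal ?V * indicator ({0<..1} \<inter> {s<..}) x \<partial>lborel)"
      by (subst emeasure_density) (auto simp: indicator_def intro!: nn_integral_cong)
    then show ?thesis by (simp add: nn_integral_cmult_indicator)
  qed
  have eq: "emeasure lborel {x \<in> slope_cone a b 1. s < ?k x} = ennreal ?V * emeasure lborel ({0<..1} \<inter> {s<..})" for s
  proof -
    consider "s \<le> 0" | "0 < s" "s < 1" | "1 \<le> s" by linarith
    then show ?thesis
    proof cases
      case 1
      have "{x \<in> slope_cone a b 1. s < ?k x} = slope_cone a b 1"
      proof -
        have "s < ?k x" if "x \<in> slope_cone a b 1" for x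
        proof -
          have "0 < x \<bullet> b" "0 < norm (x - (x \<bullet> b) *\<^sub>R b)"
            using that norm_perp_pos[of x] by (auto simp: slope_cone_def)
          then have "0 < ?k x" by (rule divide_pos_pos)
          then show ?thesis using 1 by simp
        qed
        then show ?thesis by blast
      qed
      moreover have "{0<..1} \<inter> {s<..} = {0<..1::real}" using 1 by auto
      ultimately show ?thesis using V by simp
    next
      case 2
      have "{x \<in> slope_cone a b 1. s < ?k x} = slope_cone a b 1 - slope_cone a b s"
      proof (intro equalityI subsetI)
        fix x assume x: "x \<in> {x \<in> slope_cone a b 1. s < ?k x}"
        then have "0 < norm (x - (x \<bullet> b) *\<^sub>R b)" using norm_perp_pos[of x] by (auto simp: slope_cone_def)
        then show "x \<in> slope_cone a b 1 - slope_cone a b s"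
          using x by (auto simp: slope_cone_def pos_less_divide_eq)
      next
        fix x assume x: "x \<in> slope_cone a b 1 - slope_cone a b s"
        then have "0 < norm (x - (x \<bullet> b) *\<^sub>R b)" using norm_perp_pos[of x] by (auto simp: slope_cone_def)
        then show "x \<in> {x \<in> slope_cone a b 1. s < ?k x}"
          using x by (auto simp: slope_cone_def pos_less_divide_eq)
      qed
      moreover have "slope_cone a b s \<subseteq> slope_cone a b 1"
      proof
        fix x assume x: "x \<in> slope_cone a b s"
        have "s * norm (x - (x \<bullet> b) *\<^sub>R b) \<le> 1 * norm (x - (x \<bullet> b) *\<^sub>R b)"
          using 2 by (intro mult_right_mono) auto
        then show "x \<in> slope_cone a b 1" using x unfolding slope_cone_def mem_Collect_eq by linarith
      qed
      moreover have s: "emeasure lborel (slope_cone a b s) = ennreal (s * ?V)"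
        using 2 V emeasure_slope_cone[of s] by (simp add: ennreal_mult)
      ultimately have "emeasure lborel {x \<in> slope_cone a b 1. s < ?k x} = ennreal ?V - ennreal (s * ?V)"
        using V by (simp add: emeasure_Diff)
      also have "\<dots> = ennreal (?V * (1 - s))"
        using 2 by (subst ennreal_minus) (auto simp: algebra_simps)
      also have "{0<..1} \<inter> {s<..} = {s<..1}" using 2 by auto
      then have "ennreal (?V * (1 - s)) = ennreal ?V * emeasure lborel ({0<..1} \<inter> {s<..})"
        using 2 by (simp add: ennreal_mult)
      finally show ?thesis .
    next
      case 3
      have "\<not> s < ?k x" if "x \<in> slope_cone a b 1" for x
      proof -
        have "x \<bullet> b \<le> norm (x - (x \<bullet> b) *\<^sub>R b)" "0 < norm (x - (x \<bullet> b) *\<^sub>R b)"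
          using that norm_perp_pos[of x] by (auto simp: slope_cone_def)
        then have "?k x \<le> 1" by simp
        then show ?thesis using 3 by simp
      qed
      then have e: "{x \<in> slope_cone a b 1. s < ?k x} = {}" by blast
      have "{0<..1} \<inter> {s<..} = {}" using 3 by auto
      then show ?thesis unfolding e by simp
    qed
  qed
  show ?thesis
  proof (rule measure_eqI_lessThan)
    fix s
    have "emeasure (distr ?M borel ?k) {s<..} \<le> emeasure lborel (slope_cone a b 1)"
      unfolding L by (intro emeasure_mono) auto
    from le_less_trans[OF this, of \<infinity>] show "emeasure (distr ?M borel ?k) {s<..} < \<infinity>"
      unfolding V by simp
    show "emeasure (distr ?M borel ?k) {s<..} = emeasure ?D {s<..}"
      unfolding L R eq ..
  qed simp_all
qed

lemma slope_integral:
  fixes g :: "real \<Rightarrow> complex"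
  assumes [measurable]: "g \<in> borel_measurable borel" and cont: "continuous_on {0..1} g"
  shows "(LINT x:slope_cone a b 1|lborel. g ((x \<bullet> b) / norm (x - (x \<bullet> b) *\<^sub>R b))) =
     complex_of_real (measure lborel (slope_cone a b 1)) * integral {0..1} g"
proof -
  let ?V = "measure lborel (slope_cone a b 1)"
  let ?k = "\<lambda>x. (x \<bullet> b) / norm (x - (x \<bullet> b) *\<^sub>R b)"
  let ?M = "restrict_space lborel (slope_cone a b 1)"
  have k: "?k \<in> ?M \<rightarrow>\<^sub>M borel" by (intro measurable_restrict_space1) measurable
  have "(LINT x:slope_cone a b 1|lborel. g (?k x)) = (\<integral>x. g (?k x) \<partial>?M)"
    unfolding set_lebesgue_integral_def by (subst integral_restrict_space) auto
  also have "\<dots> = (\<integral>s. g s \<partial>distr ?M borel ?k)"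
    using k by (subst integral_distr) auto
  also have "\<dots> = (\<integral>s. g s \<partial>density lborel (\<lambda>s. ennreal (?V * indicator {0<..1} s)))"
  proof -
    have "(\<lambda>s::real. ennreal ?V * indicator {0<..1} s) = (\<lambda>s. ennreal (?V * indicator {0<..1} s))"
      by (auto simp: fun_eq_iff indicator_def)
    then show ?thesis unfolding slope_uniform by (rule arg_cong)
  qed
  also have "\<dots> = (\<integral>s. (?V * indicator {0<..1} s) *\<^sub>R g s \<partial>lborel)"
    by (subst integral_density) auto
  also have "\<dots> = (\<integral>s. ?V *\<^sub>R (indicator {0..1} s *\<^sub>R g s) \<partial>lborel)"
  proof (rule integral_cong_AE)
    show "AE s in lborel. (?V * indicator {0<..1} s) *\<^sub>R g s = ?V *\<^sub>R (indicator {0..1} s *\<^sub>R g s)"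
      using AE_lborel_singleton[of 0] by eventually_elim (auto simp: indicator_def)
  qed auto
  also have "\<dots> = ?V *\<^sub>R (LINT s:{0..1}|lborel. g s)"
    unfolding set_lebesgue_integral_def by (simp del: scaleR_scaleR)
  also have "(LINT s:{0..1}|lborel. g s) = integral {0..1} g"
    using cont by (intro set_borel_integral_eq_integral borel_integrable_atLeastAtMost')
  finally show ?thesis by (simp add: scaleR_conv_of_real)
qed

end

text \<open>The substitute for polar coordinates: under the weight \<open>w\<close> the latitude
  \<open>arcsin (\<xi> \<bullet> b)\<close> is uniformly distributed on [0, pi/4], where the end
  pi/4 corresponds to slope 1. Only points with positive coordinates along \<open>a\<close> and
  \<open>b\<close> are seen; in the plane these are determined by their latitude.\<close>

lemma sphere_arc:
  fixes a b :: "'a::euclidean_space"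
  assumes a: "a \<in> Basis" and b: "b \<in> Basis" and ab: "a \<noteq> b"
  obtains w :: "'a \<Rightarrow> real" and C where "w \<in> borel_measurable sphere_measure" "\<And>\<xi>. \<xi> \<in> sphere 0 1 \<Longrightarrow> 0 \<le> w \<xi> \<and> w \<xi> \<le> C"
    "\<And>(F :: 'a \<Rightarrow> complex) G. F \<in> borel_measurable sphere_measure \<Longrightarrow> continuous_on UNIV G \<Longrightarrow>
       (\<And>\<xi>. norm \<xi> = 1 \<Longrightarrow> 0 < \<xi> \<bullet> a \<Longrightarrow> 0 < \<xi> \<bullet> b \<Longrightarrow> F \<xi> = G (arcsin (\<xi> \<bullet> b))) \<Longrightarrow>
       (\<integral>\<xi>. complex_of_real (w \<xi>) * F \<xi> \<partial>sphere_measure) = integral {0..pi/4} G"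
proof -
  let ?Z = "slope_cone a b 1"
  let ?V = "measure lborel ?Z"
  let ?k = "\<lambda>x. (x \<bullet> b) / norm (x - (x \<bullet> b) *\<^sub>R b)"
  have V: "?V > 0" by (rule slope_cone_measure_pos[OF assms])
  obtain g :: "'a \<Rightarrow> real" where g: "g \<in> borel_measurable sphere_measure" "\<And>\<xi>. 0 \<le> g \<xi>" "\<And>\<xi>. g \<xi> \<le> 1"
    and gI: "\<And>G :: 'a \<Rightarrow> complex. G \<in> borel_measurable sphere_measure \<Longrightarrow>
       (\<integral>\<xi>. complex_of_real (g \<xi>) * G \<xi> \<partial>sphere_measure) = (LINT x:?Z|lborel. G (x /\<^sub>R norm x))"
    by (rule sphere_density_of_cone[OF slope_cone_borel slope_cone_subset[OF assms]]) (rule that)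
  \<comment> \<open>Under \<open>g\<close> the slope k = tan \<theta> is uniform on [0, 1] with
    total mass \<open>?V\<close>. Since dk = (1 + k^2) d\<theta>, the factor 1 - sin^2 \<theta> = 1
    / (1 + k^2) turns this into d\<theta>.\<close>
  define w where "w \<xi> = g \<xi> * ((1 - (\<xi> \<bullet> b)\<^sup>2) / ?V)" for \<xi>
  have mb: "(\<lambda>\<xi>. (1 - (\<xi> \<bullet> b)\<^sup>2) / ?V) \<in> borel_measurable (restrict_space borel (sphere 0 1))"
    by (intro measurable_restrict_space1) measurable
  show ?thesis
  proof (rule that[of w "1 / ?V"])
    show "w \<in> borel_measurable sphere_measure"
      using borel_measurable_times[OF g(1)[unfolded measurable_sphere_measure] mb]
      unfolding w_def[abs_def] by simp
  next
    fix \<xi> :: 'a assume \<xi>: "\<xi> \<in> sphere 0 1"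
    have "\<bar>\<xi> \<bullet> b\<bar> \<le> 1" using Basis_le_norm[OF b, of \<xi>] \<xi> by simp
    then have q: "(\<xi> \<bullet> b)\<^sup>2 \<le> 1" by (simp add: abs_square_le_1)
    have "g \<xi> * ((1 - (\<xi> \<bullet> b)\<^sup>2) / ?V) \<le> 1 * (1 / ?V)"
      using g(2,3)[of \<xi>] q V by (intro mult_mono divide_right_mono) auto
    then show "0 \<le> w \<xi> \<and> w \<xi> \<le> 1 / ?V"
      using g(2)[of \<xi>] q V by (simp add: w_def)
  next
    fix F :: "'a \<Rightarrow> complex" and G :: "real \<Rightarrow> complex"
    assume F: "F \<in> borel_measurable sphere_measure" and G: "continuous_on UNIV G"
      and FG: "\<And>\<xi>. norm \<xi> = 1 \<Longrightarrow> 0 < \<xi> \<bullet> a \<Longrightarrow> 0 < \<xi> \<bullet> b \<Longrightarrow> F \<xi> = G (arcsin (\<xi> \<bullet> b))"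
    define h where "h k = complex_of_real (1 / (1 + k\<^sup>2) / ?V) * G (arctan k)" for k
    have ch: "continuous_on UNIV h"
      unfolding h_def using V
      by (intro continuous_intros continuous_on_compose2[OF G]) (auto simp: add_nonneg_eq_0_iff sum_power2_eq_zero_iff)
    have key: "complex_of_real ((1 - ((x /\<^sub>R norm x) \<bullet> b)\<^sup>2) / ?V) * F (x /\<^sub>R norm x) = h (?k x)"
      if x: "x \<in> ?Z" for x
    proof -
      define N where "N = norm (x - (x \<bullet> b) *\<^sub>R b)"
      have xa: "0 < x \<bullet> a" and xb: "0 < x \<bullet> b" using x by (auto simp: slope_cone_def)
      have N: "0 < N" unfolding N_def by (rule norm_perp_pos[OF assms xa])
      have nx: "(norm x)\<^sup>2 = N\<^sup>2 + (x \<bullet> b)\<^sup>2"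
        unfolding N_def by (rule norm_perp_sq[OF assms])
      have x0: "0 < norm x" using xa by auto
      have sq: "sqrt (1 + (?k x)\<^sup>2) = norm x / N"
      proof (rule real_sqrt_unique)
        show "(norm x / N)\<^sup>2 = 1 + (?k x)\<^sup>2"
          using N nx unfolding N_def[symmetric] by (simp add: field_simps)
      qed (use N in simp)
      have s: "(x /\<^sub>R norm x) \<bullet> b = sin (arctan (?k x))"
        using N x0 unfolding sin_arctan sq unfolding N_def[symmetric] by (simp add: field_simps)
      then have as: "arcsin ((x /\<^sub>R norm x) \<bullet> b) = arctan (?k x)"
        using arctan_bounded[of "?k x"] by (simp add: arcsin_sin)
      have "1 - ((x /\<^sub>R norm x) \<bullet> b)\<^sup>2 = ((norm x)\<^sup>2 - (x \<bullet> b)\<^sup>2) / (norm x)\<^sup>2"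
        using x0 by (simp add: field_simps)
      also have "\<dots> = (N / norm x)\<^sup>2"
        using nx by (simp add: power_divide)
      also have "\<dots> = 1 / (sqrt (1 + (?k x)\<^sup>2))\<^sup>2"
        unfolding sq using N x0 by (simp add: field_simps)
      also have "\<dots> = 1 / (1 + (?k x)\<^sup>2)" by simp
      finally have c: "1 - ((x /\<^sub>R norm x) \<bullet> b)\<^sup>2 = 1 / (1 + (?k x)\<^sup>2)" .
      have "F (x /\<^sub>R norm x) = G (arcsin ((x /\<^sub>R norm x) \<bullet> b))"
        using xa xb x0 by (intro FG) auto
      then show ?thesis unfolding h_def c as by simp
    qed
    have "(\<integral>\<xi>. complex_of_real (w \<xi>) * F \<xi> \<partial>sphere_measure) =
        (\<integral>\<xi>. complex_of_real (g \<xi>) * (complex_of_real ((1 - (\<xi> \<bullet> b)\<^sup>2) / ?V) * F \<xi>) \<partial>sphere_measure)"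
      by (simp add: w_def mult.assoc)
    also have "\<dots> = (LINT x:?Z|lborel. complex_of_real ((1 - ((x /\<^sub>R norm x) \<bullet> b)\<^sup>2) / ?V) * F (x /\<^sub>R norm x))"
      by (rule gI) (simp only: measurable_sphere_measure borel_measurable_times
        measurable_compose[OF mb borel_measurable_of_real] F[unfolded measurable_sphere_measure])
    also have "\<dots> = (LINT x:?Z|lborel. h (?k x))"
      using key by (intro set_lebesgue_integral_cong) auto
    also have "\<dots> = complex_of_real ?V * integral {0..1} h"
      using ch by (intro slope_integral[OF assms]) (auto intro: borel_measurable_continuous_onI continuous_on_subset)
    also have "\<dots> = integral {0..1} (\<lambda>k. complex_of_real ?V * h k)" by simp
    also have "(\<lambda>k. complex_of_real ?V * h k) = (\<lambda>k. (1 / (1 + k\<^sup>2)) *\<^sub>R G (arctan k))"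
      using V by (auto simp: h_def fun_eq_iff scaleR_conv_of_real)
    also have "integral {0..1} \<dots> = integral {0..pi/4} G"
    proof (rule integral_unique)
      have "((\<lambda>k. (1 / (1 + k\<^sup>2)) *\<^sub>R G (arctan k)) has_integral integral {arctan 0..arctan 1} G) {0..1}"
      proof (rule has_integral_substitution)
        show "arctan ` {0..1} \<subseteq> {arctan 0..arctan 1}" 
          using arctan_monotone'[of _ 1] arctan_monotone'[of 0] by (auto simp: arctan_one)
        show "(arctan has_field_derivative 1 / (1 + x\<^sup>2)) (at x within {0..1})" for x
          by (auto intro!: derivative_eq_intros simp: inverse_eq_divide)
      qed (use G in \<open>auto intro: continuous_on_subset simp: arctan_one\<close>)
      then show "((\<lambda>k. (1 / (1 + k\<^sup>2)) *\<^sub>R G (arctan k)) has_integral integral {0..pi/4} G) {0..1}"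
        by (simp add: arctan_one)
    qed
    finally show "(\<integral>\<xi>. complex_of_real (w \<xi>) * F \<xi> \<partial>sphere_measure) = integral {0..pi/4} G" .
  qed
qed

section \<open>The lower bound 2\<close>

lemma measure_Union_cball_Int_le:
  fixes X :: "'a::euclidean_space set"
  assumes "finite X" "0 \<le> \<rho>"
  shows "measure lborel ((\<Union>x\<in>X. cball x \<rho>) \<inter> cball y r)
           \<le> real (card {x\<in>X. dist x y \<le> r + \<rho>}) * measure lborel (cball (0::'a) \<rho>)"
proof -
  let ?X = "{x\<in>X. dist x y \<le> r + \<rho>}"
  have "(\<Union>x\<in>X. cball x \<rho>) \<inter> cball y r \<subseteq> (\<Union>x\<in>?X. cball x \<rho>)"
  proof
    fix z assume "z \<in> (\<Union>x\<in>X. cball x \<rho>) \<inter> cball y r"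
    then obtain x where x: "x \<in> X" "dist x z \<le> \<rho>" "dist y z \<le> r" by auto
    have "dist x y \<le> dist x z + dist y z" by (rule dist_triangle2)
    with x show "z \<in> (\<Union>x\<in>?X. cball x \<rho>)" by auto
  qed
  then have "measure lborel ((\<Union>x\<in>X. cball x \<rho>) \<inter> cball y r) \<le> measure lborel (\<Union>x\<in>?X. cball x \<rho>)"
  proof (rule measure_mono_fmeasurable)
    show "(\<Union>x\<in>?X. cball x \<rho>) \<in> fmeasurable lborel"
      using assms(1) by (intro fmeasurable.finite_UN) (auto intro!: fmeasurableI simp: emeasure_lborel_cball_finite[unfolded infinity_ennreal_def])
    show "(\<Union>x\<in>X. cball x \<rho>) \<inter> cball y r \<in> sets lborel"
      using assms(1) by (intro sets.Int sets.finite_UN) auto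
  qed
  also have "\<dots> \<le> (\<Sum>x\<in>?X. measure lborel (cball x \<rho>))"
    using assms(1) by (intro measure_UNION_le) auto
  also have "\<dots> = (\<Sum>x\<in>?X. measure lborel (cball (0::'a) \<rho>))"
    using assms(2) by (intro sum.cong refl) (simp add: content_cball)
  finally show ?thesis by simp
qed

lemma measure_Union_disjoint_cball:
  fixes X :: "'a::euclidean_space set"
  assumes "finite X" "0 \<le> \<rho>" "\<And>x y. x \<in> X \<Longrightarrow> y \<in> X \<Longrightarrow> x \<noteq> y \<Longrightarrow> 2 * \<rho> < dist x y"
  shows "measure lborel (\<Union>x\<in>X. cball x \<rho>) = real (card X) * measure lborel (cball (0::'a) \<rho>)"
proof -
  have "disjoint_family_on (\<lambda>x. cball x \<rho>) X"
    unfolding disjoint_family_on_def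
  proof (intro ballI impI, rule ccontr)
    fix x y assume xy: "x \<in> X" "y \<in> X" "x \<noteq> y" "cball x \<rho> \<inter> cball y \<rho> \<noteq> {}"
    then obtain z where "dist x z \<le> \<rho>" "dist y z \<le> \<rho>" by auto
    then have "dist x y \<le> 2 * \<rho>" using dist_triangle2[of x y z] by simp
    then show False using assms(3)[OF xy(1-3)] by simp
  qed
  then have "measure lborel (\<Union>x\<in>X. cball x \<rho>) = (\<Sum>x\<in>X. measure lborel (cball x \<rho>))"
    using assms(1) by (intro measure_finite_Union) (auto simp: less_top emeasure_lborel_cball_finite[unfolded infinity_ennreal_def])
  also have "\<dots> = (\<Sum>x\<in>X. measure lborel (cball (0::'a) \<rho>))"
    using assms(2) by (intro sum.cong refl) (simp add: content_cball)
  finally show ?thesis by simp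
qed

section \<open>Rudin--Shapiro polynomials\<close>

lemma parallelogram: "(norm (x + y))\<^sup>2 + (norm (x - y))\<^sup>2 = 2 * (norm x)\<^sup>2 + 2 * (norm (y::'a::real_inner))\<^sup>2"
  unfolding power2_norm_eq_inner by (simp add: inner_add_left inner_add_right inner_diff_left inner_diff_right)

text \<open>A pair P, Q is continued by P + z^(2^k) Q and P - z^(2^k) Q; for |z| = 1 the
  parallelogram law doubles the sum of squares. Carrying both polynomials is what closes the
  induction.\<close>

lemma Rudin_Shapiro_pair:
  "\<exists>c d :: nat \<Rightarrow> complex. (\<forall>j. norm (c j) = 1 \<and> norm (d j) = 1) \<and>
     (\<forall>z. norm z = 1 \<longrightarrow>
        (norm (\<Sum>j<2^k. c j * z^j))\<^sup>2 + (norm (\<Sum>j<2^k. d j * z^j))\<^sup>2 = 2 * 2^k)"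
proof (induction k)
  case 0
  show ?case by (intro exI[of _ "\<lambda>_. 1"]) simp
next
  case (Suc k)
  then obtain c d :: "nat \<Rightarrow> complex" where cd: "\<And>j. norm (c j) = 1" "\<And>j. norm (d j) = 1"
    and IH: "\<And>z. norm z = 1 \<Longrightarrow> (norm (\<Sum>j<2^k. c j * z^j))\<^sup>2 + (norm (\<Sum>j<2^k. d j * z^j))\<^sup>2 = 2 * 2^k"
    by blast
  define c' where "c' s j = (if j < 2^k then c j else s * d (j - 2^k))" for s :: complex and j
  have split: "(\<Sum>j<2^Suc k. c' s j * z^j) = (\<Sum>j<2^k. c j * z^j) + s * (z^(2^k) * (\<Sum>j<2^k. d j * z^j))" for s z
  proof -
    have "(\<Sum>j<2^Suc k. c' s j * z^j) = (\<Sum>j<2^k. c' s j * z^j) + (\<Sum>j=2^k..<2^k+2^k. c' s j * z^j)"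
      unfolding lessThan_atLeast0 by (subst sum.atLeastLessThan_concat) (auto simp: mult_2)
    also have "(\<Sum>j=2^k..<2^k+2^k. c' s j * z^j) = (\<Sum>j<2^k. c' s (j + 2^k) * z^(j + 2^k))"
      using sum.shift_bounds_nat_ivl[of "\<lambda>j. c' s j * z^j" 0 "2^k" "2^k"] by (simp add: lessThan_atLeast0)
    also have "\<dots> = s * (z^(2^k) * (\<Sum>j<2^k. d j * z^j))"
      by (simp add: c'_def sum_distrib_left power_add mult_ac)
    also have "(\<Sum>j<2^k. c' s j * z^j) = (\<Sum>j<2^k. c j * z^j)"
      by (simp add: c'_def)
    finally show ?thesis .
  qed
  show ?case
  proof (rule exI[of _ "c' 1"], rule exI[of _ "c' (-1)"], intro conjI allI impI)
    fix z :: complex assume z: "norm z = 1"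
    show "(norm (\<Sum>j<2^Suc k. c' 1 j * z^j))\<^sup>2 + (norm (\<Sum>j<2^Suc k. c' (-1) j * z^j))\<^sup>2 = 2 * 2^Suc k"
      unfolding split
      using parallelogram[of "\<Sum>j<2^k. c j * z^j" "z^(2^k) * (\<Sum>j<2^k. d j * z^j)"] IH[OF z] z
      by (simp add: norm_mult norm_power)
  qed (auto simp: c'_def cd)
qed

lemma Rudin_Shapiro:
  obtains c :: "nat \<Rightarrow> complex" where "\<And>j. norm (c j) = 1"
    "\<And>z. norm z = 1 \<Longrightarrow> norm (\<Sum>j<2^k. c j * z^j) \<le> sqrt (2 * 2^k)"
proof -
  obtain c d :: "nat \<Rightarrow> complex" where c: "\<And>j. norm (c j) = 1"
    and s: "\<And>z. norm z = 1 \<Longrightarrow> (norm (\<Sum>j<2^k. c j * z^j))\<^sup>2 + (norm (\<Sum>j<2^k. d j * z^j))\<^sup>2 = 2 * 2^k"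
    using Rudin_Shapiro_pair[of k] by blast
  show ?thesis
  proof (rule that[OF c])
    fix z :: complex assume "norm z = 1"
    have "(norm (\<Sum>j<2^k. c j * z^j))\<^sup>2 \<le> 2 * 2^k"
      unfolding s[OF \<open>norm z = 1\<close>, symmetric] by simp
    then show "norm (\<Sum>j<2^k. c j * z^j) \<le> sqrt (2 * 2^k)" by (rule real_le_rsqrt)
  qed
qed

text \<open>With u = sin \<theta> this is a pure oscillation integrated over [0, sqrt 2 / 2], and
  the factor sqrt 2 times \<open>L\<close> makes it run through exactly \<open>L * i\<close>
  periods. Frequencies that are multiples of sqrt 2 times \<open>L\<close> are therefore orthogonal
  on this interval.\<close>

lemma integral_cos_exp_sin:
  fixes i :: int and L :: nat
  assumes "L > 0"
  shows "((\<lambda>\<theta>. complex_of_real (cos \<theta>) * exp (2 * pi * \<i> * (sqrt 2 * L * i * sin \<theta>)))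
     has_integral (if i = 0 then sqrt 2 / 2 else 0)) {0..pi/4}"
proof (cases "i = 0")
  case True
  have "(cos has_integral (sin (pi/4) - sin 0)) {0..pi/4}"
    by (rule fundamental_theorem_of_calculus)
      (auto intro!: derivative_eq_intros simp: has_real_derivative_iff_has_vector_derivative[symmetric])
  then have "((\<lambda>\<theta>. complex_of_real (cos \<theta>)) has_integral (sin (pi/4) - sin 0)) {0..pi/4}"
    by (rule has_integral_of_real)
  then show ?thesis using True by (simp add: sin_45)
next
  case False
  define s where "s = 2 * pi * \<i> * (sqrt 2 * L * i)"
  have s0: "s \<noteq> 0" using False assms by (simp add: s_def)
  have "((\<lambda>\<theta>. complex_of_real (cos \<theta>) * exp (s * sin \<theta>)) has_integral
      (exp (s * sin (pi/4)) / s - exp (s * complex_of_real (sin 0)) / s)) {0..pi/4}"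
  proof (rule fundamental_theorem_of_calculus)
    fix x :: real
    have "((\<lambda>z. exp (s * sin z) / s) has_field_derivative (cos (complex_of_real x) * exp (s * sin x)))
        (at (complex_of_real x))"
      using s0 by (auto intro!: derivative_eq_intros simp: sin_of_real)
    then have "((\<lambda>\<theta>. exp (s * sin (complex_of_real \<theta>)) / s) has_vector_derivative
        (cos (complex_of_real x) * exp (s * sin x))) (at x within {0..pi/4})"
      by (rule has_vector_derivative_real_field)
    then show "((\<lambda>\<theta>. exp (s * complex_of_real (sin \<theta>)) / s) has_vector_derivative
        (complex_of_real (cos x) * exp (s * complex_of_real (sin x)))) (at x within {0..pi/4})"
      by (simp add: sin_of_real cos_of_real)
  qed simp
  moreover have "exp (s * sin (pi/4)) = 1"
  proof -
    have "s * sin (pi/4) = complex_of_real (2 * of_int (int L * i) * pi) * \<i>"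
      by (simp add: s_def sin_45 complex_eq_iff)
    then show ?thesis using exp_integer_2pi[of "of_int (int L * i)"] by simp
  qed
  ultimately show ?thesis using False by (simp add: s_def mult_ac)
qed

text \<open>Evaluation at the point with index \<open>m\<close> selects the coefficient
  \<open>c m\<close>, of modulus 1, so all the values are equally large. The bound \<open>C\<close>
  must not depend on \<open>k\<close> or \<open>L\<close>, since the length of the polynomial and
  the spacing of the points both tend to infinity.\<close>

lemma flat_extension:
  fixes a b :: "'a::euclidean_space"
  assumes a: "a \<in> Basis" and b: "b \<in> Basis" and ab: "a \<noteq> b"
  obtains C where "\<And>k L. L > 0 \<Longrightarrow> \<exists>f. f \<in> borel_measurable sphere_measure \<and>
     (AE \<xi> in sphere_measure. norm (f \<xi>) \<le> C) \<and>
     (\<forall>m<2^k. norm (extension_op sphere_measure f ((sqrt 2 * real L * real m) *\<^sub>R b)) = 1 / (2 * sqrt (2^k)))"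
proof -
  obtain w :: "'a \<Rightarrow> real" and C where w: "w \<in> borel_measurable sphere_measure"
    and wC: "\<And>\<xi>. \<xi> \<in> sphere 0 1 \<Longrightarrow> 0 \<le> w \<xi> \<and> w \<xi> \<le> C"
    and wI: "\<And>(F :: 'a \<Rightarrow> complex) G. F \<in> borel_measurable sphere_measure \<Longrightarrow> continuous_on UNIV G \<Longrightarrow>
       (\<And>\<xi>. norm \<xi> = 1 \<Longrightarrow> 0 < \<xi> \<bullet> a \<Longrightarrow> 0 < \<xi> \<bullet> b \<Longrightarrow> F \<xi> = G (arcsin (\<xi> \<bullet> b))) \<Longrightarrow>
       (\<integral>\<xi>. complex_of_real (w \<xi>) * F \<xi> \<partial>sphere_measure) = integral {0..pi/4} G"
    using sphere_arc[OF assms] by blast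
  show ?thesis
  proof (rule that[of C])
    fix k L :: nat assume L: "L > 0"
    obtain c :: "nat \<Rightarrow> complex" where c: "\<And>j. norm (c j) = 1"
      and P: "\<And>z. norm z = 1 \<Longrightarrow> norm (\<Sum>j<2^k. c j * z^j) \<le> sqrt (2 * 2^k)"
      by (rule Rudin_Shapiro[of k]) (rule that)
    define D where "D = sqrt 2 * real L"
    define e where "e t = exp (2 * pi * \<i> * complex_of_real t)" for t
    have e_norm: "norm (e t) = 1" for t by (simp add: e_def)
    have e_add: "e (s + t) = e s * e t" for s t by (simp add: e_def exp_add[symmetric] algebra_simps)
    have e_pow: "e t ^ j = e (real j * t)" for t j by (simp add: e_def exp_of_nat_mult[symmetric] mult_ac)
    \<comment> \<open>The root in the numerator is cos \<theta>, the Jacobian that makes sin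
      \<theta> uniform; dividing by \<open>sqrt (2 * 2^k)\<close>, the Rudin--Shapiro bound, keeps
      \<open>p\<close> at most 1 on the sphere.\<close>
    define p where "p \<xi> = (sqrt (1 - (\<xi> \<bullet> b)\<^sup>2) / sqrt (2 * 2^k)) * (\<Sum>j<2^k. c j * e (D * (\<xi> \<bullet> b)) ^ j)" for \<xi>
    define f where "f \<xi> = complex_of_real (w \<xi>) * p \<xi>" for \<xi>
    have "p \<in> borel_measurable borel" unfolding p_def e_def by measurable
    then have p: "p \<in> borel_measurable (restrict_space borel (sphere 0 1))"
      by (rule measurable_restrict_space1)
    have f: "f \<in> borel_measurable sphere_measure"
      unfolding f_def[abs_def] using w p by simp
    have pb: "norm (p \<xi>) \<le> 1" if "\<xi> \<in> sphere 0 1" for \<xi>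
    proof -
      have "\<bar>\<xi> \<bullet> b\<bar> \<le> 1" using Basis_le_norm[OF b, of \<xi>] that by simp
      then have q: "(\<xi> \<bullet> b)\<^sup>2 \<le> 1" by (simp add: abs_square_le_1)
      have "norm (p \<xi>) = (sqrt (1 - (\<xi> \<bullet> b)\<^sup>2) / sqrt (2 * 2^k)) * norm (\<Sum>j<2^k. c j * e (D * (\<xi> \<bullet> b)) ^ j)"
        using q by (simp add: p_def norm_mult norm_divide)
      also have "\<dots> \<le> (1 / sqrt (2 * 2^k)) * sqrt (2 * 2^k)"
        using q P[OF e_norm] by (intro mult_mono divide_right_mono) auto
      finally show ?thesis by simp
    qed
    have fb: "AE \<xi> in sphere_measure. norm (f \<xi>) \<le> C"
    proof (rule AE_I2)
      fix \<xi> :: 'a assume "\<xi> \<in> space sphere_measure"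
      then have \<xi>: "\<xi> \<in> sphere 0 1" by simp
      have "norm (f \<xi>) = w \<xi> * norm (p \<xi>)" using wC[OF \<xi>] by (simp add: f_def norm_mult)
      also have "\<dots> \<le> C * 1" using wC[OF \<xi>] pb[OF \<xi>] by (intro mult_mono) auto
      finally show "norm (f \<xi>) \<le> C" by simp
    qed
    have val: "norm (extension_op sphere_measure f ((sqrt 2 * real L * real m) *\<^sub>R b)) = 1 / (2 * sqrt (2^k))"
      if m: "m < 2^k" for m
    proof -
      define F where "F \<xi> = e (- D * real m * (\<xi> \<bullet> b)) * p \<xi>" for \<xi>
      define G where "G \<theta> = (\<Sum>j<2^k. (c j / sqrt (2 * 2^k)) *
        (complex_of_real (cos \<theta>) * exp (2 * pi * \<i> * (sqrt 2 * L * (int j - int m) * sin \<theta>))))" for \<theta>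
      have e1: "(\<lambda>\<xi>. e (- D * real m * (\<xi> \<bullet> b))) \<in> borel_measurable (restrict_space borel (sphere 0 1))"
        unfolding e_def by (intro measurable_restrict_space1) measurable
      have F: "F \<in> borel_measurable sphere_measure"
        unfolding F_def[abs_def] using p e1 by simp
      have G: "continuous_on UNIV G" unfolding G_def by (intro continuous_intros)
      have "extension_op sphere_measure f ((sqrt 2 * real L * real m) *\<^sub>R b) =
          (\<integral>\<xi>. complex_of_real (w \<xi>) * F \<xi> \<partial>sphere_measure)"
        unfolding extension_op_def
        by (intro Bochner_Integration.integral_cong) (auto simp: f_def F_def e_def D_def inner_commute mult_ac)
      also have "\<dots> = integral {0..pi/4} G"
      proof (rule wI[OF F G])
        fix \<xi> :: 'a assume n: "norm \<xi> = 1"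
        have bd: "\<bar>\<xi> \<bullet> b\<bar> \<le> 1" using Basis_le_norm[OF b, of \<xi>] n by simp
        then have si: "sin (arcsin (\<xi> \<bullet> b)) = \<xi> \<bullet> b" by (intro sin_arcsin) auto
        have co: "cos (arcsin (\<xi> \<bullet> b)) = sqrt (1 - (\<xi> \<bullet> b)\<^sup>2)" using bd by (intro cos_arcsin) auto
        have ee: "e (- D * real m * (\<xi> \<bullet> b)) * e (D * (\<xi> \<bullet> b)) ^ j =
            exp (2 * pi * \<i> * (sqrt 2 * L * (int j - int m) * (\<xi> \<bullet> b)))" for j
          unfolding e_pow e_add[symmetric] by (simp add: e_def D_def algebra_simps)
        have "F \<xi> = (\<Sum>j<2^k. (c j / sqrt (2 * 2^k)) * (complex_of_real (sqrt (1 - (\<xi> \<bullet> b)\<^sup>2)) *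
            (e (- D * real m * (\<xi> \<bullet> b)) * e (D * (\<xi> \<bullet> b)) ^ j)))"
          unfolding F_def p_def sum_distrib_left by (intro sum.cong) (auto simp: mult_ac)
        then show "F \<xi> = G (arcsin (\<xi> \<bullet> b))"
          unfolding G_def si co ee .
      qed
      also have "\<dots> = (\<Sum>j<2^k. (c j / sqrt (2 * 2^k)) * (if int j - int m = 0 then sqrt 2 / 2 else 0))"
        unfolding G_def
        by (intro integral_unique has_integral_sum has_integral_mult_right integral_cos_exp_sin[OF L]) auto
      also have "\<dots> = (\<Sum>j<2^k. if j = m then (c j / sqrt (2 * 2^k)) * (sqrt 2 / 2) else 0)"
        by (intro sum.cong) auto
      also have "\<dots> = (c m / sqrt (2 * 2^k)) * (sqrt 2 / 2)"
        using m by simp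
      finally have "norm (extension_op sphere_measure f ((sqrt 2 * real L * real m) *\<^sub>R b)) =
         norm (c m) / sqrt (2 * 2^k) * (sqrt 2 / 2)" by (simp add: norm_mult norm_divide)
      then show ?thesis by (simp add: c real_sqrt_mult)
    qed
    show "\<exists>f. f \<in> borel_measurable sphere_measure \<and>
     (AE \<xi> in sphere_measure. norm (f \<xi>) \<le> C) \<and>
     (\<forall>m<2^k. norm (extension_op sphere_measure f ((sqrt 2 * real L * real m) *\<^sub>R b)) = 1 / (2 * sqrt (2^k)))"
      using f fb val by blast
  qed
qed

text \<open>With N = 2^k the test reads N^(-q/2) N \<le> C R^\<epsilon> up to constants, where R is
  about N^(K + 1); hence 1 - q/2 \<le> (K + 1) \<epsilon>.\<close>

lemma local_estimate_exponent_ge_2: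
  fixes a b :: "'a::euclidean_space"
  assumes ab: "a \<in> Basis" "b \<in> Basis" "a \<noteq> b" and \<alpha>: "\<alpha> > 0" and q: "q > 0"
    and loc: "local_estimate (sphere_measure :: 'a measure) \<alpha> \<infinity> q"
  shows "2 \<le> q"
proof -
  obtain B where B: "\<And>k L. L > 0 \<Longrightarrow> \<exists>f. f \<in> borel_measurable (sphere_measure :: 'a measure) \<and>
     (AE \<xi> in sphere_measure. norm (f \<xi>) \<le> B) \<and>
     (\<forall>m<2^k. norm (extension_op sphere_measure f ((sqrt 2 * real L * real m) *\<^sub>R b)) = 1 / (2 * sqrt (2^k)))"
    using flat_extension[OF ab] by blast
  \<comment> \<open>An integer at least 1 / \<alpha>, so that the spacing built from N^K is an
    integer multiple of sqrt 2, as orthogonality demands.\<close>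
  obtain K :: nat where K: "real K * \<alpha> \<ge> 1"
    using reals_Archimedean3[OF \<alpha>] less_imp_le by metis
  have "1 - q / 2 \<le> 0 + (real K + 1) * \<epsilon>" if "\<epsilon> > 0" for \<epsilon>
  proof (rule local_estimate_lower[OF loc q that, of "\<bar>B\<bar> + 1"])
    fix C :: real
    assume C: "C > 0" and est: "\<And>(f :: 'a \<Rightarrow> complex) Y R A l. f \<in> borel_measurable sphere_measure \<Longrightarrow>
       (AE \<xi> in sphere_measure. norm (f \<xi>) \<le> \<bar>B\<bar> + 1) \<Longrightarrow> Y \<in> sets borel \<Longrightarrow>
       Y \<subseteq> cball 0 R \<Longrightarrow> R \<ge> 1 \<Longrightarrow> A \<ge> 0 \<Longrightarrow> l \<ge> 0 \<Longrightarrow>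
       (\<And>x0 r. r \<ge> 1 \<Longrightarrow> measure lborel (Y \<inter> cball x0 r) \<le> A * r powr \<alpha>) \<Longrightarrow>
       (\<And>x. x \<in> Y \<Longrightarrow> l \<le> norm (extension_op sphere_measure f x)) \<Longrightarrow>
       l powr q * measure lborel Y \<le> C * R powr \<epsilon> * A"
    have key: "(1 / 4 powr q) * real (2^k) powr (1 - q / 2) \<le>
        (C * (sqrt 2 * 4) powr \<epsilon>) * real (2^k) powr ((real K + 1) * \<epsilon>)" for k :: nat
    proof -
      define N :: nat where "N = 2^k"
      \<comment> \<open>The factor 4 serves the count of centres: a ball of radius r \<ge> 1 that
        meets two of the small balls has 2 (r + \<rho>) \<ge> 4 N^K, hence r \<ge> N^K because 2
        \<rho> \<le> 1.\<close>
      define L :: nat where "L = 4 * N^K"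
      define D where "D = sqrt 2 * real L"
      define x where "x m = (D * real m) *\<^sub>R b" for m
      have N: "N \<ge> 1" and NK: "N^K \<ge> 1" by (simp_all add: N_def)
      have L: "L > 0" using N by (simp add: L_def)
      have "1 * real L \<le> D" unfolding D_def by (intro mult_right_mono) auto
      then have D: "4 * real N ^ K \<le> D" by (simp add: L_def)
      have NK': "1 \<le> real N ^ K" using N by simp
      have D1: "1 \<le> D" using D NK' by linarith
      obtain f where f: "f \<in> borel_measurable (sphere_measure :: 'a measure)"
        and fB: "AE \<xi> in sphere_measure. norm (f \<xi>) \<le> B"
        and val: "\<And>m. m < N \<Longrightarrow> norm (extension_op sphere_measure f (x m)) = 1 / (2 * sqrt N)"
        using B[OF L, of k] unfolding N_def x_def D_def by auto
      have fB': "AE \<xi> in sphere_measure. norm (f \<xi>) \<le> \<bar>B\<bar> + 1"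
        using fB by eventually_elim linarith
      have cont: "continuous_on UNIV (extension_op sphere_measure f)"
        by (rule continuous_extension_op[OF f fB])
      have "\<exists>d>0. \<forall>y. dist y (x m) < d \<longrightarrow> dist (extension_op sphere_measure f y) (extension_op sphere_measure f (x m)) < 1 / (4 * sqrt N)" for m
        using cont N unfolding continuous_on_iff by simp
      then obtain d where d: "\<And>m. d m > 0"
        "\<And>m y. dist y (x m) < d m \<Longrightarrow> dist (extension_op sphere_measure f y) (extension_op sphere_measure f (x m)) < 1 / (4 * sqrt N)"
        by metis
      \<comment> \<open>Half of \<open>d m\<close> puts the closed ball inside the neighbourhood
        where the extension varies by less than 1 / (4 sqrt N), half of its value at the centre. The
        entry 1/2 bounds the radius for the separation and the count.\<close>
      define \<rho> where "\<rho> = Min (insert (1/2) ((\<lambda>m. d m / 2) ` {..<N}))"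
      have \<rho>0: "0 < \<rho>" unfolding \<rho>_def using d(1) by (subst Min_gr_iff) auto
      have \<rho>2: "\<rho> \<le> 1/2" unfolding \<rho>_def by (rule Min_le) auto
      have \<rho>d: "\<rho> \<le> d m / 2" if "m < N" for m unfolding \<rho>_def using that by (intro Min_le) auto
      define v where "v = measure lborel (cball (0::'a) \<rho>)"
      have v: "v > 0" unfolding v_def using content_cball_pos[OF \<rho>0] by simp
      define Y where "Y = (\<Union>y\<in>x ` {..<N}. cball y \<rho>)"
      have dx: "dist (x i) (x j) = D * \<bar>real i - real j\<bar>" for i j
      proof -
        have "x i - x j = (D * (real i - real j)) *\<^sub>R b" by (simp add: x_def algebra_simps)
        then show ?thesis using D NK' ab(2) by (simp add: dist_norm abs_mult)
      qed
      have sep: "D \<le> dist (x i) (x j)" if "i \<noteq> j" for i j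
      proof -
        have "1 \<le> \<bar>real i - real j\<bar>" using that by linarith
        then show ?thesis unfolding dx using D NK' by simp
      qed
      have inj: "inj_on x {..<N}"
      proof (rule inj_onI, rule ccontr)
        fix i j assume "x i = x j" "i \<noteq> j"
        then show False using sep[of i j] D1 by simp
      qed
      have mY: "measure lborel Y = real N * v"
      proof -
        have "measure lborel Y = real (card (x ` {..<N})) * v"
          unfolding Y_def v_def
        proof (rule measure_Union_disjoint_cball)
          fix y z assume yz: "y \<in> x ` {..<N}" "z \<in> x ` {..<N}" "y \<noteq> z"
          then obtain i j where "y = x i" "z = x j" "i \<noteq> j" by auto
          then have "D \<le> dist y z" using sep by simp
          then show "2 * \<rho> < dist y z" using D NK' \<rho>2 by linarith
        qed (use \<rho>0 in auto)
        then show ?thesis using inj by (simp add: card_image)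
      qed
      have "(1 / (4 * sqrt N)) powr q * measure lborel Y \<le> C * (D * real N) powr \<epsilon> * v"
      proof (rule est[OF f fB'])
        show "Y \<in> sets borel" unfolding Y_def by (intro sets.finite_UN) auto
        show "Y \<subseteq> cball 0 (D * real N)"
        proof
          fix y assume "y \<in> Y"
          then obtain m where m: "m < N" "dist (x m) y \<le> \<rho>" by (auto simp: Y_def)
          have "norm y \<le> norm (x m) + dist (x m) y"
            unfolding dist_norm using norm_triangle_ineq4[of "x m" "x m - y"] by simp
          also have "norm (x m) = D * real m" using ab(2) D NK' by (simp add: x_def)
          also have "\<dots> \<le> D * (real N - 1)" using m D NK' by (intro mult_left_mono) linarith+
          finally show "y \<in> cball 0 (D * real N)"
            using m(2) \<rho>2 D NK' by (simp add: algebra_simps)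
        qed
        have "1 * 1 \<le> D * real N" using D1 N by (intro mult_mono) auto
        then show "1 \<le> D * real N" by simp
        show "0 \<le> v" using v by simp
        fix y assume "y \<in> Y"
        then obtain m where m: "m < N" "dist (x m) y \<le> \<rho>" by (auto simp: Y_def)
        have "dist y (x m) < d m" using m \<rho>d[OF m(1)] \<rho>0 by (simp add: dist_commute)
        from d(2)[OF this] have "norm (extension_op sphere_measure f (x m)) - norm (extension_op sphere_measure f y) < 1 / (4 * sqrt N)"
          unfolding dist_norm using norm_triangle_ineq2[of "extension_op sphere_measure f (x m)" "extension_op sphere_measure f y"]
          by (simp add: norm_minus_commute)
        then show "1 / (4 * sqrt N) \<le> norm (extension_op sphere_measure f y)"
          unfolding val[OF m(1)] by (simp add: field_simps)
      next
        fix y0 :: 'a and r :: real assume r: "r \<ge> 1"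
        let ?X = "{y \<in> x ` {..<N}. dist y y0 \<le> r + \<rho>}"
        have le: "measure lborel (Y \<inter> cball y0 r) \<le> real (card ?X) * v"
          unfolding Y_def v_def using \<rho>0 by (intro measure_Union_cball_Int_le) auto
        have "real (card ?X) \<le> r powr \<alpha>"
        \<comment> \<open>Either the ball reaches at most one centre, or r is at least N^K and all N
          centres are admissible because N \<le> (N^K)^\<alpha>.\<close>
        proof (cases "2 * (r + \<rho>) < D")
          case True
          have "card ?X \<le> 1"
          proof (rule card_le_Suc0_iff_eq[THEN iffD2, unfolded One_nat_def[symmetric]])
            show "finite ?X" by simp
            show "\<forall>y\<in>?X. \<forall>z\<in>?X. y = z"
            proof (intro ballI, rule ccontr)
              fix y z assume yz: "y \<in> ?X" "z \<in> ?X" "y \<noteq> z"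
              then obtain i j where "y = x i" "z = x j" "i \<noteq> j" by auto
          then have "D \<le> dist y z" using sep by simp
              moreover have "dist y z \<le> dist y y0 + dist z y0" by (rule dist_triangle2)
              ultimately show False using yz True by auto
            qed
          qed
          then show ?thesis using ge_one_powr_ge_zero[OF r, of \<alpha>] \<alpha> by linarith
        next
          case False
          have "D \<le> 2 * r + 2 * \<rho>" using False by (simp add: not_less algebra_simps)
          then have rN: "real N ^ K \<le> r" using \<rho>2 D NK' by linarith
          have "card ?X \<le> card (x ` {..<N})" by (intro card_mono) auto
          also have "\<dots> \<le> N" using card_image_le[of "{..<N}" x] by simp
          finally have "real (card ?X) \<le> real N powr 1" using N by simp
          also have "\<dots> \<le> real N powr (real K * \<alpha>)" using K N by (intro powr_mono) auto
          also have "\<dots> = (real N ^ K) powr \<alpha>"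
            using N by (simp add: powr_powr[symmetric] powr_realpow)
          also have "\<dots> \<le> r powr \<alpha>" using rN \<alpha> by (intro powr_mono2) auto
          finally show ?thesis .
        qed
        then show "measure lborel (Y \<inter> cball y0 r) \<le> v * r powr \<alpha>"
          using le v by (smt (verit, best) mult.commute mult_left_mono)
      qed simp
      then have "(1 / (4 * sqrt N)) powr q * real N \<le> C * (D * real N) powr \<epsilon>"
        using v unfolding mY by simp
      moreover have "(1 / (4 * sqrt N)) powr q * real N = (1 / 4 powr q) * real N powr (1 - q / 2)"
      proof -
        have "(1 / (4 * sqrt N)) powr q = 1 / (4 powr q * (real N powr (1/2)) powr q)"
          using N by (simp add: powr_divide powr_mult powr_half_sqrt)
        also have "\<dots> = (1 / 4 powr q) * real N powr (- (q/2))"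
          by (simp add: powr_powr powr_minus_divide)
        finally have e: "(1 / (4 * sqrt N)) powr q = (1 / 4 powr q) * real N powr (- (q/2))" .
        have "real N powr (1 - q / 2) = real N powr (- (q / 2)) * real N powr 1"
          unfolding powr_add[symmetric] by simp
        then show ?thesis unfolding e using N by simp
      qed
      moreover have "(D * real N) powr \<epsilon> = (sqrt 2 * 4) powr \<epsilon> * real N powr ((real K + 1) * \<epsilon>)"
      proof -
        have "D * real N = (sqrt 2 * 4) * real N powr (real K + 1)"
          using N by (simp add: D_def L_def powr_add powr_realpow)
        then show ?thesis by (simp add: powr_mult powr_powr)
      qed
      ultimately show ?thesis unfolding N_def[symmetric] by simp
    qed
    have "\<exists>\<^sub>F n in sequentially. (1 / 4 powr q) * real n powr (1 - q / 2) \<le>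
        (C * (sqrt 2 * 4) powr \<epsilon>) * real n powr ((real K + 1) * \<epsilon>)"
      unfolding frequently_sequentially
    proof
      fix k :: nat
      have "k \<le> 2^k" by (rule less_imp_le) (rule less_exp)
      then show "\<exists>n\<ge>k. (1 / 4 powr q) * real n powr (1 - q / 2) \<le>
        (C * (sqrt 2 * 4) powr \<epsilon>) * real n powr ((real K + 1) * \<epsilon>)"
        using key[of k] by blast
    qed
    then have "1 - q / 2 \<le> (real K + 1) * \<epsilon>" by (rule powr_exponent_le[rotated]) simp
    then show ?thesis by simp
  qed simp
  then have "1 - q / 2 \<le> 0" by (rule le_of_all_eps[rotated]) simp_all
  then show ?thesis by simp
qed

section \<open>The lower bound from disjoint caps\<close>

lemma sphere_cap_sets [measurable]: "sphere 0 1 \<inter> cball p \<delta> \<in> sets (sphere_measure :: 'a::euclidean_space measure)"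
  by (auto simp: sets_restrict_space)

text \<open>The cone over a cap of radius \<open>\<delta>\<close> contains about \<open>1 / \<delta>\<close> disjoint balls of radius \<open>\<delta> / 8\<close> along its axis.\<close>

lemma sphere_cap_lower:
  obtains c where "c > 0"
    "\<And>(p :: 'a::euclidean_space) \<delta>. norm p = 1 \<Longrightarrow> 0 < \<delta> \<Longrightarrow> \<delta> \<le> 1 \<Longrightarrow>
       c * \<delta> ^ (DIM('a) - 1) \<le> measure sphere_measure (sphere 0 1 \<inter> cball p \<delta>)"
proof -
  let ?n = "DIM('a)"
  let ?V = "unit_ball_vol (real ?n)"
  have V: "?V > 0" by simp
  show ?thesis
  proof (rule that[of "?V / 8 ^ ?n"])
    show "?V / 8 ^ ?n > 0" using V by simp
  next
    fix p :: 'a and \<delta> :: real assume p: "norm p = 1" and \<delta>: "0 < \<delta>" "\<delta> \<le> 1"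
    let ?cap = "sphere 0 1 \<inter> cball p \<delta>"
    define J where "J = nat \<lceil>1 / \<delta>\<rceil>"
    have J1: "1 / \<delta> \<le> real J" unfolding J_def by (rule real_nat_ceiling_ge)
    have "0 < 1 / \<delta>" using \<delta> by simp
    then have J2: "real J < 1 / \<delta> + 1" unfolding J_def by linarith
    \<comment> \<open>Steps of \<delta>/3 exceed the diameter \<delta>/4, so the balls are disjoint;
      j \<delta> < 1 keeps the centres at heights between 1/2 and 5/6, so the balls stay in the unit
      ball and away from 0. Radial projection then takes them to within (\<delta>/4) / (3/8) <
      \<delta> of \<open>p\<close>.\<close>
    define y where "y j = (1/2 + real j * \<delta> / 3) *\<^sub>R p" for j
    define Z where "Z = (\<Union>z\<in>y ` {..<J}. cball z (\<delta> / 8))"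
    have dy: "dist (y i) (y j) = \<bar>real i - real j\<bar> * \<delta> / 3" for i j
    proof -
      have "y i - y j = ((real i - real j) * \<delta> / 3) *\<^sub>R p"
        by (simp add: y_def algebra_simps diff_divide_distrib)
      then show ?thesis using p \<delta> by (simp add: dist_norm abs_mult)
    qed
    have sep: "2 * (\<delta> / 8) < dist (y i) (y j)" if "i \<noteq> j" for i j
    proof -
      have "1 \<le> \<bar>real i - real j\<bar>" using that by linarith
      then have "1 * \<delta> / 3 \<le> \<bar>real i - real j\<bar> * \<delta> / 3"
        using \<delta> by (intro divide_right_mono mult_right_mono) auto
      then show ?thesis unfolding dy using \<delta> by linarith
    qed
    have inj: "inj_on y {..<J}"
    proof (rule inj_onI, rule ccontr)
      fix i j assume "y i = y j" "i \<noteq> j"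
      then show False using sep[of i j] \<delta> by simp
    qed
    have Zb: "Z \<in> sets borel" unfolding Z_def by (intro sets.finite_UN) auto
    have geo: "z \<noteq> 0 \<and> norm z \<le> 1 \<and> z /\<^sub>R norm z \<in> ?cap" if z: "z \<in> Z" for z
    proof -
      obtain j where j: "j < J" "dist (y j) z \<le> \<delta> / 8" using z by (auto simp: Z_def)
      define t where "t = 1/2 + real j * \<delta> / 3"
      have yt: "y j = t *\<^sub>R p" by (simp add: y_def t_def)
      have "real j \<le> real J - 1" using j by linarith
      then have "real j < 1 / \<delta>" using J2 by linarith
      then have "real j * \<delta> < 1" using \<delta> by (simp add: field_simps)
      moreover have "0 \<le> real j * \<delta>" using \<delta> by simp
      ultimately have t: "1/2 \<le> t" "t \<le> 5/6" unfolding t_def by linarith+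
      have dz: "norm (z - t *\<^sub>R p) \<le> \<delta> / 8" using j(2) by (simp add: yt dist_norm norm_minus_commute)
      have nt: "norm (t *\<^sub>R p) = t" using t p by simp
      have nz: "\<bar>norm z - t\<bar> \<le> \<delta> / 8"
        using norm_triangle_ineq3[of z "t *\<^sub>R p"] dz nt by linarith
      then have z1: "3/8 \<le> norm z" "norm z \<le> 1" using t \<delta> by linarith+
      have "norm (z - norm z *\<^sub>R p) \<le> norm (z - t *\<^sub>R p) + norm ((t - norm z) *\<^sub>R p)"
        using norm_triangle_ineq[of "z - t *\<^sub>R p" "(t - norm z) *\<^sub>R p"] by (simp add: algebra_simps)
      also have "norm ((t - norm z) *\<^sub>R p) = \<bar>norm z - t\<bar>" using p by simp
      finally have d4: "norm (z - norm z *\<^sub>R p) \<le> \<delta> / 4" using dz nz by linarith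
      have z0: "z \<noteq> 0" using z1 by auto
      have "z - norm z *\<^sub>R p = norm z *\<^sub>R (z /\<^sub>R norm z - p)" using z0 by (simp add: algebra_simps)
      then have "norm z * norm (z /\<^sub>R norm z - p) \<le> \<delta> / 4" using d4 by (metis norm_scaleR abs_norm_cancel)
      moreover have "3/8 * norm (z /\<^sub>R norm z - p) \<le> norm z * norm (z /\<^sub>R norm z - p)"
        using z1 by (intro mult_right_mono) auto
      ultimately have "norm (z /\<^sub>R norm z - p) \<le> \<delta>" using \<delta> by linarith
      then have "z /\<^sub>R norm z \<in> ?cap" using z0 by (simp add: dist_norm norm_minus_commute)
      with z0 z1 show ?thesis by simp
    qed
    have sub: "Z \<subseteq> cball 0 1 - {0}" using geo by auto
    have "measure lborel Z = real (card (y ` {..<J})) * measure lborel (cball (0::'a) (\<delta> / 8))"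
      unfolding Z_def
    proof (rule measure_Union_disjoint_cball)
      fix u v assume "u \<in> y ` {..<J}" "v \<in> y ` {..<J}" "u \<noteq> v"
      then obtain i j where "u = y i" "v = y j" "i \<noteq> j" by auto
      then show "2 * (\<delta> / 8) < dist u v" using sep by simp
    qed (use \<delta> in auto)
    also have "\<dots> = real J * (?V * (\<delta> / 8) ^ ?n)"
      using inj \<delta> by (simp add: card_image content_cball)
    finally have mZ: "measure lborel Z = real J * (?V * (\<delta> / 8) ^ ?n)" .
    have "\<delta> ^ ?n = \<delta> * \<delta> ^ (?n - 1)"
      by (metis DIM_positive Suc_pred' power_Suc)
    then have "?V / 8 ^ ?n * \<delta> ^ (?n - 1) = 1 / \<delta> * (?V * (\<delta> / 8) ^ ?n)"
      using \<delta> by (simp add: power_divide)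
    also have "\<dots> \<le> measure lborel Z"
      unfolding mZ using J1 V \<delta> by (intro mult_right_mono) auto
    finally have low: "?V / 8 ^ ?n * \<delta> ^ (?n - 1) \<le> measure lborel Z" .
    have "ennreal (measure lborel Z) = emeasure lborel ((\<lambda>x. x /\<^sub>R norm x) -` ?cap \<inter> Z)"
    proof -
      have "(\<lambda>x. x /\<^sub>R norm x) -` ?cap \<inter> Z = Z" using geo by auto
      then show ?thesis using Zb sub by (simp add: emeasure_bounded_borel bounded_subset[OF bounded_cball, of Z 0 1] subset_iff)
    qed
    also have "\<dots> \<le> emeasure sphere_measure ?cap"
      by (intro emeasure_cone_le Zb sub sphere_cap_sets)
    also have "\<dots> = ennreal (measure sphere_measure ?cap)"
      by (intro finite_measure.emeasure_eq_measure) simp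
    finally have "measure lborel Z \<le> measure sphere_measure ?cap" by simp
    with low show "?V / 8 ^ ?n * \<delta> ^ (?n - 1) \<le> measure sphere_measure ?cap" by linarith
  qed
qed

text \<open>Once the phase at \<open>p\<close> is removed, the phases on the cap lie within 2 pi |x|
  \<delta> \<le> pi/3 of 0, where the cosine is at least 1/2: there is no cancellation.\<close>

lemma extension_cap_lower:
  fixes p x :: "'a::euclidean_space"
  assumes "norm x * \<delta> \<le> 1 / 6"
  shows "measure sphere_measure (sphere 0 1 \<inter> cball p \<delta>) / 2 \<le>
    norm (extension_op sphere_measure (indicator (sphere 0 1 \<inter> cball p \<delta>)) x)"
proof -
  let ?cap = "sphere 0 1 \<inter> cball p \<delta>"
  let ?e = "\<lambda>t. exp (- 2 * complex_of_real pi * \<i> * complex_of_real t)"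
  have int: "integrable sphere_measure (\<lambda>\<xi>. ?e (x \<bullet> \<xi>) * indicator ?cap \<xi>)"
  proof (rule bounded_extension_integrable[where B = 1])
    show "(indicator ?cap :: 'a \<Rightarrow> complex) \<in> borel_measurable sphere_measure"
      by (rule borel_measurable_indicator[OF sphere_cap_sets])
  qed (simp add: indicator_def)
  have cap: "sphere 0 1 \<inter> cball p \<delta> \<inter> sphere 0 1 = ?cap" by auto
  have fin: "emeasure sphere_measure ?cap < \<infinity>"
    using finite_measure.emeasure_finite[OF finite_measure_sphere_measure, of ?cap] by (simp add: less_top)
  have "measure sphere_measure ?cap / 2 = (\<integral>\<xi>. (1/2) * indicator ?cap \<xi> \<partial>sphere_measure)"
    by (simp add: cap)
  also have "\<dots> \<le> (\<integral>\<xi>. Re (?e (- (x \<bullet> p)) * (?e (x \<bullet> \<xi>) * indicator ?cap \<xi>)) \<partial>sphere_measure)"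
  proof (rule integral_mono)
    show "integrable sphere_measure (\<lambda>\<xi>. (1/2) * indicator ?cap \<xi> :: real)"
      by (intro integrable_mult_right integrable_real_indicator sphere_cap_sets fin)
    show "integrable sphere_measure (\<lambda>\<xi>. Re (?e (- (x \<bullet> p)) * (?e (x \<bullet> \<xi>) * indicator ?cap \<xi>)))"
      using int by (intro integrable_Re integrable_mult_right)
    fix \<xi> :: 'a
    show "(1/2) * indicator ?cap \<xi> \<le> Re (?e (- (x \<bullet> p)) * (?e (x \<bullet> \<xi>) * indicator ?cap \<xi>))"
    proof (cases "\<xi> \<in> ?cap")
      case True
      have "\<bar>x \<bullet> (\<xi> - p)\<bar> \<le> norm x * norm (\<xi> - p)" by (rule Cauchy_Schwarz_ineq2)
      also have "\<dots> \<le> norm x * \<delta>" using True by (intro mult_left_mono) (auto simp: dist_norm norm_minus_commute)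
      finally have s: "\<bar>x \<bullet> (\<xi> - p)\<bar> \<le> 1/6" using assms by linarith
      have "cos (pi / 3) \<le> cos \<bar>2 * pi * (x \<bullet> (\<xi> - p))\<bar>"
        using s by (intro cos_monotone_0_pi_le) (auto simp: abs_mult)
      moreover have "?e (- (x \<bullet> p)) * ?e (x \<bullet> \<xi>) = cis (- 2 * pi * (x \<bullet> (\<xi> - p)))"
        by (simp add: exp_add[symmetric] cis_conv_exp inner_diff_right algebra_simps)
      ultimately show ?thesis using True by (simp add: cos_60)
    qed simp
  qed
  also have "\<dots> = Re (?e (- (x \<bullet> p)) * extension_op sphere_measure (indicator ?cap) x)"
    using int unfolding extension_op_def by (subst integral_Re) auto
  also have "\<dots> \<le> norm (?e (- (x \<bullet> p)) * extension_op sphere_measure (indicator ?cap) x)"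
    by (rule complex_Re_le_cmod)
  also have "\<dots> = norm (extension_op sphere_measure (indicator ?cap) x)"
    by (simp add: norm_mult)
  finally show ?thesis .
qed

text \<open>The parallelogram law chooses the signs one by one, instead of averaging over random signs.\<close>

lemma square_signs:
  fixes g :: "'i \<Rightarrow> 'a \<Rightarrow> complex"
  assumes "finite I" "\<And>i. i \<in> I \<Longrightarrow> g i \<in> borel_measurable M"
  shows "\<exists>s :: 'i \<Rightarrow> complex. (\<forall>i. norm (s i) = 1) \<and>
    (\<Sum>i\<in>I. \<integral>\<^sup>+x. ennreal ((norm (g i x))\<^sup>2) \<partial>M) \<le> (\<integral>\<^sup>+x. ennreal ((norm (\<Sum>i\<in>I. s i * g i x))\<^sup>2) \<partial>M)"
  using assms
proof (induction rule: finite_induct)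
  case empty
  show ?case by (intro exI[of _ "\<lambda>_. 1"]) simp
next
  case (insert j I)
  then obtain s :: "'i \<Rightarrow> complex" where s: "\<And>i. norm (s i) = 1"
    and IH: "(\<Sum>i\<in>I. \<integral>\<^sup>+x. ennreal ((norm (g i x))\<^sup>2) \<partial>M) \<le> (\<integral>\<^sup>+x. ennreal ((norm (\<Sum>i\<in>I. s i * g i x))\<^sup>2) \<partial>M)"
    by auto
  define F where "F x = (\<Sum>i\<in>I. s i * g i x)" for x
  have [measurable]: "F \<in> borel_measurable M" "g j \<in> borel_measurable M"
    unfolding F_def[abs_def] using insert.prems by auto
  define a where "a = (\<integral>\<^sup>+x. ennreal ((norm (F x + g j x))\<^sup>2) \<partial>M)"
  define b where "b = (\<integral>\<^sup>+x. ennreal ((norm (F x - g j x))\<^sup>2) \<partial>M)"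
  define S where "S = (\<integral>\<^sup>+x. ennreal ((norm (g j x))\<^sup>2) \<partial>M) + (\<integral>\<^sup>+x. ennreal ((norm (F x))\<^sup>2) \<partial>M)"
  have "a + b = (\<integral>\<^sup>+x. ennreal ((norm (F x + g j x))\<^sup>2) + ennreal ((norm (F x - g j x))\<^sup>2) \<partial>M)"
    unfolding a_def b_def by (intro nn_integral_add[symmetric]) auto
  also have "\<dots> = (\<integral>\<^sup>+x. 2 * (ennreal ((norm (g j x))\<^sup>2) + ennreal ((norm (F x))\<^sup>2)) \<partial>M)"
  proof (rule nn_integral_cong)
    fix x
    have "ennreal ((norm (F x + g j x))\<^sup>2) + ennreal ((norm (F x - g j x))\<^sup>2) =
        ennreal (2 * ((norm (g j x))\<^sup>2 + (norm (F x))\<^sup>2))"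
      using parallelogram[of "F x" "g j x"] by (simp add: ennreal_plus[symmetric] algebra_simps del: ennreal_plus)
    then show "ennreal ((norm (F x + g j x))\<^sup>2) + ennreal ((norm (F x - g j x))\<^sup>2) =
        2 * (ennreal ((norm (g j x))\<^sup>2) + ennreal ((norm (F x))\<^sup>2))"
      by (simp add: ennreal_mult)
  qed
  also have "\<dots> = 2 * (\<integral>\<^sup>+x. (ennreal ((norm (g j x))\<^sup>2) + ennreal ((norm (F x))\<^sup>2)) \<partial>M)"
    by (rule nn_integral_cmult) measurable
  also have "(\<integral>\<^sup>+x. (ennreal ((norm (g j x))\<^sup>2) + ennreal ((norm (F x))\<^sup>2)) \<partial>M) = S"
    unfolding S_def by (rule nn_integral_add) measurable
  finally have ab: "a + b = 2 * S" .
  \<comment> \<open>The integrals may be infinite, so the larger of the two is compared with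
    \<open>S\<close> by cancelling a factor 2 and not by subtraction.\<close>
  have half: "S \<le> c" if "2 * S \<le> c + c" for c
  proof -
    have "2 * S \<le> 2 * c" using that by (simp add: mult_2)
    then show ?thesis by (subst (asm) ennreal_mult_le_mult_iff) auto
  qed
  obtain r :: complex where r: "norm r = 1" and rS: "S \<le> (\<integral>\<^sup>+x. ennreal ((norm (F x + r * g j x))\<^sup>2) \<partial>M)"
  proof (cases "a \<le> b")
    case True
    then have "S \<le> b" using ab add_right_mono[OF True, of b] by (intro half) simp
    then show ?thesis by (intro that[of "-1"]) (simp_all add: b_def)
  next
    case False
    then have "S \<le> a" using ab add_left_mono[of b a a] by (intro half) simp
    then show ?thesis by (intro that[of 1]) (simp_all add: a_def)
  qed
  show ?case
  proof (intro exI[of _ "s(j := r)"] conjI allI)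
    show "norm ((s(j := r)) i) = 1" for i using s r by simp
    have e: "(\<Sum>i\<in>insert j I. (s(j := r)) i * g i x) = F x + r * g j x" for x
    proof -
      have "(\<Sum>i\<in>I. (s(j := r)) i * g i x) = F x"
        unfolding F_def using insert.hyps by (intro sum.cong) auto
      then show ?thesis using insert.hyps by simp
    qed
    have "(\<Sum>i\<in>insert j I. \<integral>\<^sup>+x. ennreal ((norm (g i x))\<^sup>2) \<partial>M) \<le> S"
      unfolding S_def F_def using insert.hyps IH by (simp add: add_left_mono)
    also note rS
    finally show "(\<Sum>i\<in>insert j I. \<integral>\<^sup>+x. ennreal ((norm (g i x))\<^sup>2) \<partial>M) \<le>
        (\<integral>\<^sup>+x. ennreal ((norm (\<Sum>i\<in>insert j I. (s(j := r)) i * g i x))\<^sup>2) \<partial>M)"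
      unfolding e .
  qed
qed

text \<open>A grid with \<open>m\<close> values below 1 / n in every coordinate except that along
  \<open>a\<close>, where n is the dimension, lifted to the sphere by solving for the remaining
  coordinate. The squares of the grid coordinates sum to at most 1, so the lift exists, and two grid
  points already differ by one step in a grid coordinate.\<close>

lemma sphere_separated_points:
  fixes m :: nat
  assumes "m \<ge> 1"
  obtains P :: "'a::euclidean_space set" where "finite P" "card P = m ^ (DIM('a) - 1)" "P \<subseteq> sphere 0 1"
    "\<And>p q. p \<in> P \<Longrightarrow> q \<in> P \<Longrightarrow> p \<noteq> q \<Longrightarrow> 1 / (real m * real DIM('a)) \<le> dist p q"
proof -
  let ?n = "DIM('a)"
  obtain a :: 'a where a: "a \<in> Basis" using nonempty_Basis by blast
  define I where "I = (Basis - {a} :: 'a set)"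
  have I: "finite I" "card I = ?n - 1" using a by (auto simp: I_def)
  define K where "K = (\<Pi>\<^sub>E i\<in>I. {..<m})"
  define h where "h k i = real (k i) / (real m * real ?n)" for k :: "'a \<Rightarrow> nat" and i
  define S where "S k = (\<Sum>i\<in>I. (h k i)\<^sup>2)" for k
  define p where "p k = (\<Sum>i\<in>Basis. (if i = a then sqrt (1 - S k) else h k i) *\<^sub>R i)" for k
  have n: "real ?n \<ge> 1" by (simp add: Suc_leI)
  have S1: "S k \<le> 1" if "k \<in> K" for k
  proof -
    have "S k \<le> (\<Sum>i\<in>I. 1 / real ?n)" unfolding S_def
    proof (rule sum_mono)
      fix i assume "i \<in> I"
      then have "k i < m" using that by (auto simp: K_def PiE_def Pi_def)
      then have "h k i \<le> real m / (real m * real ?n)" unfolding h_def by (intro divide_right_mono) auto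
      then have h1: "h k i \<le> 1 / real ?n" using assms by simp
      moreover have "0 \<le> h k i" by (simp add: h_def)
      ultimately have "(h k i)\<^sup>2 \<le> (1 / real ?n)\<^sup>2" by (intro power_mono)
      also have "\<dots> = (1 / real ?n) * (1 / real ?n)" by (simp add: power2_eq_square)
      also have "\<dots> \<le> 1 * (1 / real ?n)" using n by (intro mult_right_mono) auto
      finally show "(h k i)\<^sup>2 \<le> 1 / real ?n" by simp
    qed
    also have "\<dots> = real (?n - 1) / real ?n" using I by simp
    also have "\<dots> \<le> 1" by simp
    finally show ?thesis .
  qed
  have pi: "p k \<bullet> i = h k i" if "i \<in> I" for k i
    using that by (simp add: p_def I_def)
  have norm_p: "norm (p k) = 1" if "k \<in> K" for k
  proof -
    have "(norm (p k))\<^sup>2 = (\<Sum>i\<in>Basis. (p k \<bullet> i)\<^sup>2)"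
      unfolding power2_norm_eq_inner euclidean_inner[of "p k" "p k"] by (simp add: power2_eq_square)
    also have "\<dots> = (p k \<bullet> a)\<^sup>2 + (\<Sum>i\<in>I. (p k \<bullet> i)\<^sup>2)"
      unfolding I_def using a by (intro sum.remove) auto
    also have "(\<Sum>i\<in>I. (p k \<bullet> i)\<^sup>2) = S k" unfolding S_def by (intro sum.cong) (auto simp: pi)
    also have "p k \<bullet> a = sqrt (1 - S k)" using a by (simp add: p_def)
    finally have "(norm (p k))\<^sup>2 = 1" using S1[OF that] by simp
    then show ?thesis by (intro power2_eq_imp_eq[of "norm (p k)" 1]) auto
  qed
  have sep: "1 / (real m * real ?n) \<le> dist (p k) (p l)" if kl: "k \<in> K" "l \<in> K" "k \<noteq> l" for k l
  proof -
    obtain i where i: "i \<in> I" "k i \<noteq> l i"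
      using kl unfolding K_def by (metis PiE_ext)
    have "1 \<le> \<bar>real (k i) - real (l i)\<bar>" using i by linarith
    then have "1 / (real m * real ?n) \<le> \<bar>real (k i) - real (l i)\<bar> / (real m * real ?n)"
      by (intro divide_right_mono) auto
    also have "\<dots> = \<bar>(p k - p l) \<bullet> i\<bar>"
      using i by (simp add: inner_diff_left pi h_def diff_divide_distrib[symmetric] abs_divide)
    also have "\<dots> \<le> dist (p k) (p l)"
      unfolding dist_norm using i by (intro Basis_le_norm) (auto simp: I_def)
    finally show ?thesis .
  qed
  have pos: "0 < 1 / (real m * real ?n)" using assms by simp
  have inj: "inj_on p K"
  proof (rule inj_onI, rule ccontr)
    fix k l assume "k \<in> K" "l \<in> K" "p k = p l" "k \<noteq> l"
    then show False using sep[of k l] pos by simp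
  qed
  show ?thesis
  proof (rule that[of "p ` K"])
    show "finite (p ` K)" unfolding K_def using I by (intro finite_imageI finite_PiE) auto
    show "card (p ` K) = m ^ (?n - 1)"
      using inj I by (simp add: card_image K_def card_PiE)
    show "p ` K \<subseteq> sphere 0 1" using norm_p by auto
    fix x y assume "x \<in> p ` K" "y \<in> p ` K" "x \<noteq> y"
    then show "1 / (real m * real ?n) \<le> dist x y" using sep by auto
  qed
qed

text \<open>A cap of radius about 1/m contributes at least the square of its area, of order m^(-2 (n
  - 1)), times the volume of order m^n; the m^(n - 1) caps together give m. The signs prevent the
  cross terms from destroying this.\<close>

lemma extension_square_lower:
  obtains c where "c > 0"
    "\<And>m :: nat. m \<ge> 1 \<Longrightarrow> \<exists>f. f \<in> borel_measurable (sphere_measure :: 'a::euclidean_space measure) \<and>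
       (\<forall>\<xi>. norm (f \<xi>) \<le> 1) \<and>
       ennreal (c * real m) \<le>
         (\<integral>\<^sup>+x. ennreal ((norm (extension_op sphere_measure f x))\<^sup>2) * indicator (cball 0 (real m)) x \<partial>lborel)"
proof -
  let ?n = "DIM('a)"
  let ?\<sigma> = "sphere_measure :: 'a measure"
  let ?V = "unit_ball_vol (real ?n)"
  have V: "?V > 0" by simp
  have n: "real ?n \<ge> 1" by (simp add: Suc_leI)
  obtain c where c: "c > 0" and cap: "\<And>(p :: 'a) \<delta>. norm p = 1 \<Longrightarrow> 0 < \<delta> \<Longrightarrow> \<delta> \<le> 1 \<Longrightarrow>
       c * \<delta> ^ (?n - 1) \<le> measure ?\<sigma> (sphere 0 1 \<inter> cball p \<delta>)"
    using sphere_cap_lower[where 'a = 'a] by blast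
  define C where "C = ?V * (c * (1 / (6 * real ?n)) ^ (?n - 1) / 2)\<^sup>2"
  have C: "C > 0" unfolding C_def using V c n by simp
  show ?thesis
  proof (rule that[OF C])
    fix m :: nat assume m: "m \<ge> 1"
    obtain P :: "'a set" where P: "finite P" "card P = m ^ (?n - 1)" "P \<subseteq> sphere 0 1"
      and sep: "\<And>p q. p \<in> P \<Longrightarrow> q \<in> P \<Longrightarrow> p \<noteq> q \<Longrightarrow> 1 / (real m * real ?n) \<le> dist p q"
      using sphere_separated_points[OF m, where 'a = 'a] by blast
    \<comment> \<open>Two requirements meet: the points are at least 6 \<delta> apart, so the caps
      are disjoint and \<open>f\<close> stays bounded by 1, and m \<delta> \<le> 1/6, so within a
      cap there is no cancellation anywhere on the ball of radius m.\<close>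
    define \<delta> where "\<delta> = 1 / (6 * real m * real ?n)"
    have mn: "1 * 1 \<le> real m * real ?n" using m n by (intro mult_mono) auto
    have \<delta>: "0 < \<delta>" "\<delta> \<le> 1" using mn m n by (auto simp: \<delta>_def)
    have m\<delta>: "real m * \<delta> \<le> 1 / 6" using m n by (simp add: \<delta>_def)
    define A where "A p = sphere 0 1 \<inter> cball p \<delta>" for p :: 'a
    have A: "A p \<in> sets ?\<sigma>" for p unfolding A_def by (rule sphere_cap_sets)
    have disj: "p = q" if "p \<in> P" "q \<in> P" "\<xi> \<in> A p" "\<xi> \<in> A q" for p q \<xi>
    proof (rule ccontr)
      assume "p \<noteq> q"
      then have "6 * \<delta> \<le> dist p q" using sep[OF that(1,2)] by (simp add: \<delta>_def mult.assoc)
      moreover have "dist p q \<le> dist p \<xi> + dist q \<xi>" by (rule dist_triangle2)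
      ultimately show False using that(3,4) \<delta> by (auto simp: A_def)
    qed
    define g where "g p = extension_op ?\<sigma> (indicator (A p))" for p
    have ind: "(indicator (A p) :: 'a \<Rightarrow> complex) \<in> borel_measurable ?\<sigma>" for p
      by (rule borel_measurable_indicator[OF A])
    have gm: "g p \<in> borel_measurable borel" for p
      unfolding g_def
      by (rule borel_measurable_continuous_onI, rule continuous_extension_op[where B = 1])
        (use ind in \<open>auto simp: indicator_def simp del: measurable_sphere_measure\<close>)
    let ?M = "restrict_space lborel (cball (0::'a) (real m))"
    have gM: "g p \<in> borel_measurable ?M" for p
      by (rule measurable_restrict_space1) (use gm in simp)
    obtain s :: "'a \<Rightarrow> complex" where s: "\<And>p. norm (s p) = 1"
      and sI: "(\<Sum>p\<in>P. \<integral>\<^sup>+x. ennreal ((norm (g p x))\<^sup>2) \<partial>?M) \<le> (\<integral>\<^sup>+x. ennreal ((norm (\<Sum>p\<in>P. s p * g p x))\<^sup>2) \<partial>?M)"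
      using square_signs[OF P(1), of g ?M] gM by blast
    define f where "f \<xi> = (\<Sum>p\<in>P. s p * indicator (A p) \<xi>)" for \<xi>
    have f: "f \<in> borel_measurable ?\<sigma>"
      unfolding f_def[abs_def] by (intro borel_measurable_sum borel_measurable_times ind) simp
    have f1: "norm (f \<xi>) \<le> 1" for \<xi>
    proof (cases "\<exists>p\<in>P. \<xi> \<in> A p")
      case True
      then obtain p where p: "p \<in> P" "\<xi> \<in> A p" by blast
      have "f \<xi> = (\<Sum>q\<in>P. if q = p then s p else 0)"
        unfolding f_def using p disj by (intro sum.cong) (auto simp: indicator_def)
      then show ?thesis using p P(1) s by simp
    next
      case False
      then have "f \<xi> = 0" unfolding f_def by (intro sum.neutral) (auto simp: indicator_def)
      then show ?thesis by simp
    qed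
    have Ef: "extension_op ?\<sigma> f x = (\<Sum>p\<in>P. s p * g p x)" for x
    proof -
      let ?e = "\<lambda>\<xi>. exp (- 2 * complex_of_real pi * \<i> * complex_of_real (x \<bullet> \<xi>))"
      have i: "integrable ?\<sigma> (\<lambda>\<xi>. s p * (?e \<xi> * indicator (A p) \<xi>))" for p
        by (intro integrable_mult_right impI bounded_extension_integrable[where B = 1] ind)
          (simp add: indicator_def)
      have "extension_op ?\<sigma> f x = (\<integral>\<xi>. (\<Sum>p\<in>P. s p * (?e \<xi> * indicator (A p) \<xi>)) \<partial>?\<sigma>)"
        unfolding extension_op_def f_def by (simp only: sum_distrib_left mult.left_commute)
      also have "\<dots> = (\<Sum>p\<in>P. \<integral>\<xi>. s p * (?e \<xi> * indicator (A p) \<xi>) \<partial>?\<sigma>)"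
        by (rule Bochner_Integration.integral_sum) (rule i)
      also have "\<dots> = (\<Sum>p\<in>P. s p * g p x)"
        unfolding g_def extension_op_def by simp
      finally show ?thesis .
    qed
    let ?l = "c * \<delta> ^ (?n - 1) / 2"
    have l: "ennreal (?l\<^sup>2 * (?V * real m ^ ?n)) \<le> (\<integral>\<^sup>+x. ennreal ((norm (g p x))\<^sup>2) \<partial>?M)" if p: "p \<in> P" for p
    proof -
      have "ennreal (?l\<^sup>2 * (?V * real m ^ ?n)) = ennreal (?l\<^sup>2) * emeasure lborel (cball (0::'a) (real m))"
        by (simp add: emeasure_cball ennreal_mult)
      also have "\<dots> = (\<integral>\<^sup>+x. ennreal (?l\<^sup>2) * indicator (cball (0::'a) (real m)) x \<partial>lborel)"
        by (simp add: nn_integral_cmult_indicator)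
      also have "\<dots> = (\<integral>\<^sup>+x. ennreal (?l\<^sup>2) \<partial>?M)"
        by (rule nn_integral_restrict_space[symmetric]) simp
      also have "\<dots> \<le> (\<integral>\<^sup>+x. ennreal ((norm (g p x))\<^sup>2) \<partial>?M)"
      proof (rule nn_integral_mono)
        fix x :: 'a assume "x \<in> space ?M"
        then have "norm x \<le> real m" by (simp add: space_restrict_space)
        then have "norm x * \<delta> \<le> real m * \<delta>" using \<delta> by (intro mult_right_mono) auto
        then have "norm x * \<delta> \<le> 1 / 6" using m\<delta> by linarith
        then have "measure ?\<sigma> (A p) / 2 \<le> norm (g p x)"
          unfolding A_def g_def by (rule extension_cap_lower)
        moreover have "c * \<delta> ^ (?n - 1) \<le> measure ?\<sigma> (A p)"
          unfolding A_def using P p \<delta> by (intro cap) auto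
        ultimately have "?l \<le> norm (g p x)" by linarith
        then have "?l\<^sup>2 \<le> (norm (g p x))\<^sup>2" using c \<delta> by (intro power_mono) auto
        then show "ennreal (?l\<^sup>2) \<le> ennreal ((norm (g p x))\<^sup>2)" by (rule ennreal_leI)
      qed
      finally show ?thesis .
    qed
    have "real m ^ ?n = real m * real m ^ (?n - 1)"
      by (metis DIM_positive Suc_pred' power_Suc)
    then have "C * real m = real (card P) * (?l\<^sup>2 * (?V * real m ^ ?n))"
      unfolding C_def P(2) \<delta>_def using m n
      by (simp add: power_mult_distrib power_divide power2_eq_square field_simps)
    also have "ennreal \<dots> = (\<Sum>p\<in>P. ennreal (?l\<^sup>2 * (?V * real m ^ ?n)))"
      by (simp add: ennreal_mult ennreal_of_nat_eq_real_of_nat)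
    also have "\<dots> \<le> (\<Sum>p\<in>P. \<integral>\<^sup>+x. ennreal ((norm (g p x))\<^sup>2) \<partial>?M)"
      by (intro sum_mono l)
    also note sI
    also have "(\<integral>\<^sup>+x. ennreal ((norm (\<Sum>p\<in>P. s p * g p x))\<^sup>2) \<partial>?M) =
        (\<integral>\<^sup>+x. ennreal ((norm (extension_op ?\<sigma> f x))\<^sup>2) * indicator (cball 0 (real m)) x \<partial>lborel)"
      unfolding Ef by (rule nn_integral_restrict_space) simp
    finally have "ennreal (C * real m) \<le>
        (\<integral>\<^sup>+x. ennreal ((norm (extension_op ?\<sigma> f x))\<^sup>2) * indicator (cball 0 (real m)) x \<partial>lborel)" .
    with f f1 show "\<exists>f. f \<in> borel_measurable ?\<sigma> \<and> (\<forall>\<xi>. norm (f \<xi>) \<le> 1) \<and>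
       ennreal (C * real m) \<le>
         (\<integral>\<^sup>+x. ennreal ((norm (extension_op ?\<sigma> f x))\<^sup>2) * indicator (cball 0 (real m)) x \<partial>lborel)"
      by blast
  qed
qed

text \<open>Below the threshold \<open>l\<close> the square is at most \<open>l\<^sup>2\<close>;
  above it, \<open>u powr (2 - q)\<close> is at most its value at \<open>l\<close> because q \<ge>
  2. Integrated over a ball with a suitable \<open>l\<close>, this does the work of Hoelder's
  inequality.\<close>

lemma power2_le_powr_split:
  fixes u l q :: real
  assumes "0 \<le> u" "0 < l" "2 \<le> q"
  shows "u\<^sup>2 \<le> l\<^sup>2 + l powr (2 - q) * u powr q"
proof (cases "u \<le> l")
  case True
  then have "u\<^sup>2 \<le> l\<^sup>2" using assms by (intro power_mono) auto
  then show ?thesis by (smt (verit) mult_nonneg_nonneg powr_ge_zero)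
next
  case False
  then have u: "l < u" "0 < u" using assms by auto
  have "u\<^sup>2 = u powr (2 - q) * u powr q"
    using u by (simp add: powr_add[symmetric])
  also have "\<dots> \<le> l powr (2 - q) * u powr q"
    using u assms by (intro mult_right_mono powr_mono2') auto
  finally show ?thesis by (simp add: add_increasing)
qed

text \<open>The exponent 1 of m is compared with (n - 1) (q - 2) / 2 + \<epsilon> + n - \<alpha>,
  which rearranges to 2 \<alpha> \<le> q (n - 1) + 2 \<epsilon>.\<close>

lemma local_estimate_exponent_ge:
  assumes \<alpha>: "0 < \<alpha>" "\<alpha> \<le> real DIM('a)" and q: "2 \<le> q"
    and loc: "local_estimate (sphere_measure :: 'a::euclidean_space measure) \<alpha> \<infinity> q"
  shows "2 * \<alpha> \<le> q * (real DIM('a) - 1)"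
proof -
  let ?n = "DIM('a)"
  let ?\<sigma> = "sphere_measure :: 'a measure"
  let ?V = "unit_ball_vol (real ?n)"
  have V: "?V > 0" by simp
  obtain c where c: "c > 0" and lower: "\<And>m :: nat. m \<ge> 1 \<Longrightarrow> \<exists>f. f \<in> borel_measurable ?\<sigma> \<and>
       (\<forall>\<xi>. norm (f \<xi>) \<le> 1) \<and> ennreal (c * real m) \<le>
         (\<integral>\<^sup>+x. ennreal ((norm (extension_op ?\<sigma> f x))\<^sup>2) * indicator (cball 0 (real m)) x \<partial>lborel)"
    using extension_square_lower[where 'a = 'a] by blast
  have "2 * \<alpha> \<le> q * (real ?n - 1) + 2 * \<epsilon>" if \<epsilon>: "\<epsilon> > 0" for \<epsilon>
  proof (rule local_estimate_set[OF loc _ \<epsilon>, of 1])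
    fix C :: real
    assume C: "C > 0" and est: "\<And>(f :: 'a \<Rightarrow> complex) Y R A. f \<in> borel_measurable ?\<sigma> \<Longrightarrow>
       (AE \<xi> in ?\<sigma>. norm (f \<xi>) \<le> 1) \<Longrightarrow> Y \<in> sets borel \<Longrightarrow>
       Y \<subseteq> cball 0 R \<Longrightarrow> R \<ge> 1 \<Longrightarrow> A \<ge> 0 \<Longrightarrow>
       (\<And>x0 r. r \<ge> 1 \<Longrightarrow> measure lborel (Y \<inter> cball x0 r) \<le> A * r powr \<alpha>) \<Longrightarrow>
       (\<integral>\<^sup>+x. ennreal (norm (extension_op ?\<sigma> f x) powr q) * indicator Y x \<partial>lborel)
         \<le> ennreal (C * R powr \<epsilon> * A)"
    \<comment> \<open>Chosen so that \<open>h\<^sup>2 * ?V = c / 2\<close>: the term with the square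
      of the threshold then takes half of the lower bound \<open>c * real m\<close>, and the other
      half must come from the powers with exponent \<open>q\<close>.\<close>
    define h where "h = sqrt (c / (2 * ?V))"
    have h: "h > 0" using c V by (simp add: h_def)
    have key: "(c / 2) * real m powr 1 \<le>
        (h powr (2 - q) * C * ?V) * real m powr ((real ?n - 1) * (q - 2) / 2 + \<epsilon> + (real ?n - \<alpha>))"
      if m: "m \<ge> 1" for m :: nat
    proof -
      obtain f where f: "f \<in> borel_measurable ?\<sigma>" "\<And>\<xi>. norm (f \<xi>) \<le> 1"
        and fl: "ennreal (c * real m) \<le>
         (\<integral>\<^sup>+x. ennreal ((norm (extension_op ?\<sigma> f x))\<^sup>2) * indicator (cball 0 (real m)) x \<partial>lborel)"
        using lower[OF m] by blast
      let ?u = "\<lambda>x. norm (extension_op ?\<sigma> f x)"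
      let ?Y = "cball (0::'a) (real m)"
      \<comment> \<open>The mass of order r^n divided by r^\<alpha> is largest at r = m, since
        \<alpha> \<le> n; beyond r = m the mass no longer grows.\<close>
      define A where "A = ?V * real m powr (real ?n - \<alpha>)"
      define l where "l = h * real m powr (- (real ?n - 1) / 2)"
      have A: "A \<ge> 0" unfolding A_def using V by simp
      have l: "l > 0" unfolding l_def using h m by simp
      have cont: "continuous_on UNIV (extension_op ?\<sigma> f)"
        using f by (intro continuous_extension_op[where B = 1]) auto
      have um [measurable]: "?u \<in> borel_measurable borel"
        by (intro borel_measurable_continuous_onI continuous_on_norm cont)
      have uq: "(\<lambda>x. ennreal (?u x powr q) * indicator ?Y x) \<in> borel_measurable lborel"
        by (intro borel_measurable_times_ennreal measurable_compose[OF _ measurable_ennreal] powr_real_measurable)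
          (use um in \<open>auto intro: borel_measurable_indicator\<close>)
      have mass: "measure lborel (?Y \<inter> cball y r) \<le> A * r powr \<alpha>" if r: "r \<ge> 1" for y r
      proof (cases "r \<le> real m")
        case True
        have "measure lborel (?Y \<inter> cball y r) \<le> measure lborel (cball y r)"
          by (intro measure_mono_fmeasurable) (auto intro!: fmeasurableI simp: emeasure_lborel_cball_finite[unfolded infinity_ennreal_def])
        also have "\<dots> = ?V * r powr real ?n" using r by (simp add: content_cball powr_realpow)
        also have "\<dots> = ?V * (r powr (real ?n - \<alpha>) * r powr \<alpha>)" by (simp add: powr_add[symmetric])
        also have "\<dots> \<le> ?V * (real m powr (real ?n - \<alpha>) * r powr \<alpha>)"
          using True r \<alpha> V by (intro mult_left_mono mult_right_mono powr_mono2) auto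
        finally show ?thesis by (simp add: A_def)
      next
        case False
        have "measure lborel (?Y \<inter> cball y r) \<le> measure lborel ?Y"
          by (intro measure_mono_fmeasurable) (auto intro!: fmeasurableI simp: emeasure_lborel_cball_finite[unfolded infinity_ennreal_def])
        also have "\<dots> = ?V * real m powr real ?n" using m by (simp add: content_cball powr_realpow)
        also have "\<dots> = ?V * (real m powr (real ?n - \<alpha>) * real m powr \<alpha>)" by (simp add: powr_add[symmetric])
        also have "\<dots> \<le> ?V * (real m powr (real ?n - \<alpha>) * r powr \<alpha>)"
          using False \<alpha> V by (intro mult_left_mono powr_mono2) auto
        finally show ?thesis by (simp add: A_def)
      qed
      have up: "(\<integral>\<^sup>+x. ennreal (?u x powr q) * indicator ?Y x \<partial>lborel) \<le> ennreal (C * real m powr \<epsilon> * A)"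
        using f m A mass by (intro est) auto
      have "ennreal (c * real m) \<le> (\<integral>\<^sup>+x. ennreal ((?u x)\<^sup>2) * indicator ?Y x \<partial>lborel)" by (rule fl)
      also have "\<dots> \<le> (\<integral>\<^sup>+x. ennreal (l\<^sup>2) * indicator ?Y x + ennreal (l powr (2 - q)) * (ennreal (?u x powr q) * indicator ?Y x) \<partial>lborel)"
      proof (rule nn_integral_mono)
        fix x
        have "ennreal ((?u x)\<^sup>2) \<le> ennreal (l\<^sup>2 + l powr (2 - q) * ?u x powr q)"
          using power2_le_powr_split[OF _ l q, of "?u x"] by (intro ennreal_leI) simp
        then show "ennreal ((?u x)\<^sup>2) * indicator ?Y x \<le>
            ennreal (l\<^sup>2) * indicator ?Y x + ennreal (l powr (2 - q)) * (ennreal (?u x powr q) * indicator ?Y x)"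
          by (simp add: indicator_def ennreal_mult)
      qed
      also have "\<dots> = (\<integral>\<^sup>+x. ennreal (l\<^sup>2) * indicator ?Y x \<partial>lborel) +
          (\<integral>\<^sup>+x. ennreal (l powr (2 - q)) * (ennreal (?u x powr q) * indicator ?Y x) \<partial>lborel)"
        by (intro nn_integral_add borel_measurable_times_ennreal uq) (auto intro: borel_measurable_indicator)
      also have "(\<integral>\<^sup>+x. ennreal (l powr (2 - q)) * (ennreal (?u x powr q) * indicator ?Y x) \<partial>lborel) =
          ennreal (l powr (2 - q)) * (\<integral>\<^sup>+x. ennreal (?u x powr q) * indicator ?Y x \<partial>lborel)"
        by (rule nn_integral_cmult[OF uq])
      also have "\<dots> \<le> ennreal (l powr (2 - q)) * ennreal (C * real m powr \<epsilon> * A)"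
        by (intro mult_left_mono up) simp
      also have "(\<integral>\<^sup>+x. ennreal (l\<^sup>2) * indicator ?Y x \<partial>lborel) = ennreal (l\<^sup>2 * (?V * real m ^ ?n))"
        by (simp add: nn_integral_cmult_indicator emeasure_cball ennreal_mult)
      also have "l\<^sup>2 * (?V * real m ^ ?n) = c * real m / 2"
      proof -
        have "(real m powr (- (real ?n - 1) / 2))\<^sup>2 = real m powr (- (real ?n - 1))"
          unfolding power2_eq_square powr_add[symmetric] by simp
        moreover have "real m powr (- (real ?n - 1)) * real m powr real ?n = real m"
          unfolding powr_add[symmetric] using m by simp
        ultimately have e: "(real m powr (- (real ?n - 1) / 2))\<^sup>2 * real m ^ ?n = real m"
          using m by (simp only: powr_realpow[symmetric] of_nat_0_less_iff)
        have "l\<^sup>2 * (?V * real m ^ ?n) = h\<^sup>2 * ?V * ((real m powr (- (real ?n - 1) / 2))\<^sup>2 * real m ^ ?n)"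
          unfolding l_def by (simp only: power_mult_distrib mult_ac)
        also have "\<dots> = h\<^sup>2 * ?V * real m" unfolding e ..
        also have "h\<^sup>2 * ?V = c / 2"
          using c less_imp_neq[OF V] by (simp add: h_def)
        finally show ?thesis by simp
      qed
      finally have "ennreal (c * real m) \<le> ennreal (c * real m / 2 + l powr (2 - q) * (C * real m powr \<epsilon> * A))"
        using c C A l by (simp add: ennreal_mult)
      then have "c * real m \<le> c * real m / 2 + l powr (2 - q) * (C * real m powr \<epsilon> * A)"
        using c C A l by (subst (asm) ennreal_le_iff) (auto intro!: add_nonneg_nonneg)
      then have "c / 2 * real m \<le> l powr (2 - q) * (C * real m powr \<epsilon> * A)" by simp
      also have "l powr (2 - q) = h powr (2 - q) * real m powr ((real ?n - 1) * (q - 2) / 2)"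
        unfolding l_def using h by (simp add: powr_mult powr_powr algebra_simps)
      also have "h powr (2 - q) * real m powr ((real ?n - 1) * (q - 2) / 2) * (C * real m powr \<epsilon> * A) =
          (h powr (2 - q) * C * ?V) * (real m powr ((real ?n - 1) * (q - 2) / 2) * real m powr \<epsilon> * real m powr (real ?n - \<alpha>))"
        unfolding A_def by (simp only: mult_ac)
      also have "real m powr ((real ?n - 1) * (q - 2) / 2) * real m powr \<epsilon> * real m powr (real ?n - \<alpha>) =
          real m powr ((real ?n - 1) * (q - 2) / 2 + \<epsilon> + (real ?n - \<alpha>))"
        by (simp only: powr_add)
      finally show ?thesis using m by simp
    qed
    have "\<exists>\<^sub>F m in sequentially. (c / 2) * real m powr 1 \<le>
        (h powr (2 - q) * C * ?V) * real m powr ((real ?n - 1) * (q - 2) / 2 + \<epsilon> + (real ?n - \<alpha>))"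
      unfolding frequently_sequentially using key by (meson max.cobounded1 max.cobounded2)
    then have "1 \<le> (real ?n - 1) * (q - 2) / 2 + \<epsilon> + (real ?n - \<alpha>)"
      by (rule powr_exponent_le[rotated]) (use c in simp)
    then show ?thesis by (simp add: field_simps)
  qed (use q in auto)
  then show ?thesis by (rule le_of_all_eps[rotated]) simp_all
qed

section \<open>The planar lower bound\<close>

lemma cos_ge_1_minus: "1 - y\<^sup>2 / 2 \<le> cos (y::real)"
proof -
  have "(sin (y / 2))\<^sup>2 \<le> (y / 2)\<^sup>2"
    using abs_sin_x_le_abs_x[of "y / 2"] by (rule abs_le_square_iff[THEN iffD1])
  moreover have "cos y = 1 - 2 * (sin (y / 2))\<^sup>2"
    using cos_double_sin[of "y / 2"] by simp
  ultimately show ?thesis by (simp add: power_divide)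
qed

lemma diff_sin_le: "0 \<le> y \<Longrightarrow> y - sin y \<le> y ^ 3 / (6::real)"
  using Maclaurin_sin_bound[of y 3]
  by (simp add: numeral_eq_Suc sin_coeff_def fact_numeral abs_if split: if_splits)

text \<open>
  With \<open>\<phi>\<close> the phase, the integrand is at least \<open>1 - \<phi>\<^sup>2 / 2\<close> up to \<open>\<tau> = 2 / M\<close>. Beyond this point \<open>\<phi>'\<close> is
  increasing, hence \<open>cos \<phi>\<close> dominates the derivative of \<open>(1 + sin \<phi>) / \<phi>'\<close>.
\<close>

lemma cos_phase_integral:
  fixes M r \<beta> :: real
  assumes M: "11 \<le> M" and r: "M ^ 3 - M / 10 \<le> r" "r \<le> M ^ 3" and \<beta>: "pi / 16 \<le> \<beta>" "\<beta> \<le> pi / 4"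
  shows "1 / (2 * M) \<le> integral {0..\<beta>} (\<lambda>\<tau>. cos (M ^ 3 * \<tau> - r * sin \<tau>))"
proof -
  define N where "N = M ^ 3"
  define \<phi> where "\<phi> \<tau> = N * \<tau> - r * sin \<tau>" for \<tau>
  \<comment> \<open>The cubic part of the phase lives on the scale 1/M. At 2/M the phase is still at
    most 8/6 + 2/10, below pi/2, while its derivative has already reached 1.96 M.\<close>
  define \<tau>0 where "\<tau>0 = 2 / M"
  have N: "M \<le> N" using self_le_power[of M 3] M by (simp add: N_def)
  have r0: "0 < r" using r N M unfolding N_def by linarith
  \<comment> \<open>The bound 11 on \<open>M\<close> comes from here: 2/11 < 3/16 < pi/16, so
    \<open>\<tau>0\<close> lies inside the interval.\<close>
  have "\<tau>0 \<le> 2 / 11" unfolding \<tau>0_def using M by (intro divide_left_mono) auto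
  then have \<tau>: "0 < \<tau>0" "\<tau>0 < \<beta>" using M \<beta> pi_gt3 by (auto simp: \<tau>0_def)
  have \<beta>1: "\<beta> \<le> 1" using \<beta> pi_less_4 by linarith
  have cont: "continuous_on S (\<lambda>\<tau>. cos (\<phi> \<tau>))" for S unfolding \<phi>_def by (intro continuous_intros)
  have I: "(\<lambda>\<tau>. cos (\<phi> \<tau>)) integrable_on {u..v}" for u v by (rule integrable_continuous_real[OF cont])

  define Q where "Q \<tau> = 1 - (M ^ 3 * \<tau> ^ 3 / 6 + M * \<tau> / 10)\<^sup>2 / 2" for \<tau>
  \<comment> \<open>The square in \<open>Q\<close> is expanded and integrated term by term; at 2/M
    this gives about 1.63 / M.\<close>
  have "(Q has_integral (\<tau>0 - (M ^ 6 * \<tau>0 ^ 7 / 252 + M ^ 4 * \<tau>0 ^ 5 / 150 + M ^ 2 * \<tau>0 ^ 3 / 300) / 2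
      - (0 - (M ^ 6 * 0 ^ 7 / 252 + M ^ 4 * 0 ^ 5 / 150 + M ^ 2 * 0 ^ 3 / 300) / 2))) {0..\<tau>0}"
  proof (rule fundamental_theorem_of_calculus)
    fix x
    have "((\<lambda>\<tau>. \<tau> - (M ^ 6 * \<tau> ^ 7 / 252 + M ^ 4 * \<tau> ^ 5 / 150 + M ^ 2 * \<tau> ^ 3 / 300) / 2)
        has_real_derivative Q x) (at x)"
      unfolding Q_def by (auto intro!: derivative_eq_intros simp: power2_eq_square power3_eq_cube algebra_simps eval_nat_numeral)
    then show "((\<lambda>\<tau>. \<tau> - (M ^ 6 * \<tau> ^ 7 / 252 + M ^ 4 * \<tau> ^ 5 / 150 + M ^ 2 * \<tau> ^ 3 / 300) / 2)
        has_vector_derivative Q x) (at x within {0..\<tau>0})"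
      by (simp add: has_real_derivative_iff_has_vector_derivative has_vector_derivative_at_within)
  qed (use \<tau> in simp)
  moreover have "\<tau>0 - (M ^ 6 * \<tau>0 ^ 7 / 252 + M ^ 4 * \<tau>0 ^ 5 / 150 + M ^ 2 * \<tau>0 ^ 3 / 300) / 2 \<ge> 16 / 10 / M"
    unfolding \<tau>0_def using M by (simp add: power_divide field_simps eval_nat_numeral)
  ultimately have Q: "(Q has_integral integral {0..\<tau>0} Q) {0..\<tau>0}" "16 / 10 / M \<le> integral {0..\<tau>0} Q"
    by (auto simp: has_integral_iff)
  have "integral {0..\<tau>0} Q \<le> integral {0..\<tau>0} (\<lambda>\<tau>. cos (\<phi> \<tau>))"
  proof (rule integral_le[OF _ I])
    show "Q integrable_on {0..\<tau>0}" using Q(1) by blast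
    fix x assume "x \<in> {0..\<tau>0}"
    then have x: "0 \<le> x" "x \<le> 1" using \<tau> \<beta>1 by auto
    have s: "0 \<le> sin x" "sin x \<le> x" "x - sin x \<le> x ^ 3 / 6"
      using x pi_gt3 diff_sin_le by (auto intro!: sin_ge_zero sin_x_le_x)
    have \<phi>x: "\<phi> x = N * (x - sin x) + (N - r) * sin x" by (simp add: \<phi>_def algebra_simps)
    have Nr: "0 \<le> N - r" "N - r \<le> M / 10" using r by (auto simp: N_def)
    have "N * (x - sin x) \<le> N * (x ^ 3 / 6)" using s N M by (intro mult_left_mono) auto
    moreover have "(N - r) * sin x \<le> (M / 10) * x" using s Nr M by (intro mult_mono) auto
    ultimately have "\<phi> x \<le> M ^ 3 * x ^ 3 / 6 + M * x / 10" unfolding \<phi>x N_def by simp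
    moreover have "0 \<le> \<phi> x" unfolding \<phi>x using s Nr N M by (intro add_nonneg_nonneg mult_nonneg_nonneg) auto
    ultimately have "(\<phi> x)\<^sup>2 \<le> (M ^ 3 * x ^ 3 / 6 + M * x / 10)\<^sup>2" by (intro power_mono)
    then show "Q x \<le> cos (\<phi> x)" unfolding Q_def using cos_ge_1_minus[of "\<phi> x"] by linarith
  qed
  with Q(2) have I1: "16 / 10 / M \<le> integral {0..\<tau>0} (\<lambda>\<tau>. cos (\<phi> \<tau>))" by linarith

  define D where "D x = N - r * cos x" for x
  \<comment> \<open>\<open>D\<close> is the derivative of the phase. Its size comes from 1 - cos
    (2/M) = 2 sin^2 (1/M) and sin (1/M) \<ge> 0.99 / M, together with 2 * 0.99^2 \<ge> 1.96.\<close>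
  have D0: "196 / 100 * M \<le> D \<tau>0"
  proof -
    have "99 / 100 * (1 / M) \<le> sin (1 / M)"
    proof -
      have "(1 / M) ^ 3 = 1 / M * (1 / M)\<^sup>2" by (simp add: power3_eq_cube power2_eq_square)
      also have "\<dots> \<le> 1 / M * (1 / 11)\<^sup>2" using M by (intro mult_left_mono power_mono divide_left_mono) auto
      finally have "(1 / M) ^ 3 / 6 \<le> 1 / 100 * (1 / M)"
        using M by (simp add: power2_eq_square field_simps)
      then show ?thesis using diff_sin_le[of "1 / M"] M by simp
    qed
    then have "(99 / 100 * (1 / M))\<^sup>2 \<le> (sin (1 / M))\<^sup>2" using M by (intro power_mono) auto
    moreover have "cos \<tau>0 = 1 - 2 * (sin (1 / M))\<^sup>2"
      using cos_double_sin[of "1 / M"] by (simp add: \<tau>0_def)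
    ultimately have "2 * (99 / 100 * (1 / M))\<^sup>2 \<le> 1 - cos \<tau>0" by linarith
    then have "N * (2 * (99 / 100 * (1 / M))\<^sup>2) \<le> N * (1 - cos \<tau>0)" using N M by (intro mult_left_mono) auto
    moreover have "N * (2 * (99 / 100 * (1 / M))\<^sup>2) \<ge> 196 / 100 * M"
      unfolding N_def using M by (simp add: power2_eq_square power3_eq_cube)
    moreover have "r * cos \<tau>0 \<le> N * cos \<tau>0"
      using r \<tau> \<beta>1 pi_gt3 by (intro mult_right_mono) (auto simp: N_def intro!: cos_ge_zero)
    ultimately show ?thesis unfolding D_def by (simp add: algebra_simps)
  qed
  have Dpos: "0 < D x" if "x \<in> {\<tau>0..\<beta>}" for x
  proof -
    have x: "0 < x" "x \<le> 1" using that \<tau> \<beta>1 by auto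
    have "cos x < 1" using cos_monotone_0_pi[of 0 x] x pi_gt3 by simp
    then have "r * cos x < r * 1" using r0 by (intro mult_strict_left_mono) auto
    then show ?thesis unfolding D_def using r by (simp add: N_def)
  qed
  \<comment> \<open>The summand 1 makes the numerator nonnegative: the second term of the derivative
    then has a sign, the boundary term at \<beta> can be discarded, and the one at
    \<open>\<tau>0\<close> costs at most 2 / (1.96 M) < 1.03 / M. Against the gain of 1.6 / M more
    than 1 / (2 M) is left.\<close>
  define \<Psi> where "\<Psi> x = (1 + sin (\<phi> x)) / D x" for x
  define \<Psi>' where "\<Psi>' x = cos (\<phi> x) - (1 + sin (\<phi> x)) * (r * sin x) / (D x)\<^sup>2" for x
  have H: "(\<Psi>' has_integral (\<Psi> \<beta> - \<Psi> \<tau>0)) {\<tau>0..\<beta>}"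
  proof (rule fundamental_theorem_of_calculus)
    fix x assume x: "x \<in> {\<tau>0..\<beta>}"
    have "(\<Psi> has_real_derivative \<Psi>' x) (at x)"
      unfolding \<Psi>_def \<Psi>'_def \<phi>_def using Dpos[OF x] unfolding D_def
      by (auto intro!: derivative_eq_intros simp: divide_simps power2_eq_square)
    then show "(\<Psi> has_vector_derivative \<Psi>' x) (at x within {\<tau>0..\<beta>})"
      by (simp add: has_real_derivative_iff_has_vector_derivative has_vector_derivative_at_within)
  qed (use \<tau> in simp)
  have "\<Psi> \<beta> - \<Psi> \<tau>0 \<le> integral {\<tau>0..\<beta>} (\<lambda>\<tau>. cos (\<phi> \<tau>))"
  proof (rule has_integral_le[OF H integrable_integral[OF I]])
    fix x assume x: "x \<in> {\<tau>0..\<beta>}"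
    then have "0 \<le> sin x" using \<tau> \<beta>1 pi_gt3 by (intro sin_ge_zero) auto
    moreover have "0 \<le> 1 + sin (\<phi> x)" using sin_ge_minus_one[of "\<phi> x"] by linarith
    ultimately have "0 \<le> (1 + sin (\<phi> x)) * (r * sin x) / (D x)\<^sup>2" using r0 by simp
    then show "\<Psi>' x \<le> cos (\<phi> x)" unfolding \<Psi>'_def by linarith
  qed
  moreover have "0 \<le> \<Psi> \<beta>"
  proof -
    have "0 \<le> 1 + sin (\<phi> \<beta>)" using sin_ge_minus_one[of "\<phi> \<beta>"] by linarith
    then show ?thesis unfolding \<Psi>_def using Dpos[of \<beta>] \<tau> by simp
  qed
  moreover have "\<Psi> \<tau>0 \<le> 2 / (196 / 100 * M)"
    unfolding \<Psi>_def using D0 M sin_le_one[of "\<phi> \<tau>0"] sin_ge_minus_one[of "\<phi> \<tau>0"] by (intro frac_le) auto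
  ultimately have I2: "- (2 / (196 / 100 * M)) \<le> integral {\<tau>0..\<beta>} (\<lambda>\<tau>. cos (\<phi> \<tau>))" by linarith
  have "integral {0..\<tau>0} (\<lambda>\<tau>. cos (\<phi> \<tau>)) + integral {\<tau>0..\<beta>} (\<lambda>\<tau>. cos (\<phi> \<tau>)) = integral {0..\<beta>} (\<lambda>\<tau>. cos (\<phi> \<tau>))"
    using \<tau> by (intro Henstock_Kurzweil_Integration.integral_combine I) auto
  moreover have "1 / (2 * M) \<le> 16 / 10 / M - 2 / (196 / 100 * M)" using M by (simp add: field_simps)
  ultimately show ?thesis using I1 I2 unfolding \<phi>_def N_def by linarith
qed

text \<open>The integrand is even about \<theta>, so the integral splits into two of the preceding
  kind, of lengths \<theta> and pi/4 - \<theta>; the range of \<theta> keeps both at least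
  pi/16.\<close>

lemma cos_phase_integral_shift:
  fixes M r \<theta> :: real
  assumes M: "11 \<le> M" and r: "M ^ 3 - M / 10 \<le> r" "r \<le> M ^ 3" and \<theta>: "pi / 16 \<le> \<theta>" "\<theta> \<le> 3 * pi / 16"
  shows "1 / M \<le> integral {0..pi/4} (\<lambda>x. cos (M ^ 3 * (x - \<theta>) - r * sin (x - \<theta>)))"
proof -
  define f where "f x = cos (M ^ 3 * x - r * sin x)" for x
  have cont: "continuous_on S f" for S unfolding f_def by (intro continuous_intros)
  have "((\<lambda>x. 1 *\<^sub>R f (x - \<theta>)) has_integral integral {0 - \<theta>..pi/4 - \<theta>} f) {0..pi/4}"
    by (rule has_integral_substitution[where c = "0 - \<theta>" and d = "pi/4 - \<theta>"])
      (auto intro!: cont derivative_eq_intros)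
  then have "integral {0..pi/4} (\<lambda>x. f (x - \<theta>)) = integral {-\<theta>..pi/4 - \<theta>} f"
    by (simp add: integral_unique)
  also have "\<dots> = integral {-\<theta>..0} f + integral {0..pi/4 - \<theta>} f"
    using \<theta> pi_gt_zero
    by (intro Henstock_Kurzweil_Integration.integral_combine[symmetric] integrable_continuous_real cont) linarith+
  also have "integral {-\<theta>..0} f = integral {0..\<theta>} f"
  proof -
    have "f (- x) = f x" for x
      unfolding f_def using cos_minus[of "M ^ 3 * x - r * sin x"] by simp
    then show ?thesis
      using Henstock_Kurzweil_Integration.integral_reflect_real[of \<theta> 0 f] by simp
  qed
  finally have "integral {0..pi/4} (\<lambda>x. f (x - \<theta>)) = integral {0..\<theta>} f + integral {0..pi/4 - \<theta>} f" .
  moreover have "1 / (2 * M) \<le> integral {0..\<theta>} f" "1 / (2 * M) \<le> integral {0..pi/4 - \<theta>} f"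
    unfolding f_def using \<theta> pi_gt_zero by (intro cos_phase_integral M r; linarith)+
  ultimately show ?thesis unfolding f_def using M by (simp add: field_simps)
qed

text \<open>Modulating the weight of \<open>sphere_arc\<close> by exp (i N \<theta>) keeps it
  bounded uniformly in \<open>N\<close>. In the plane, positivity of both coordinates recovers \<xi>
  from its latitude, which removes the surface measure from the formula.\<close>

lemma arc_extension:
  fixes a b :: "'a::euclidean_space"
  assumes ab: "Basis = {a, b}" "a \<noteq> b"
  obtains C where "\<And>N :: real. \<exists>f. f \<in> borel_measurable sphere_measure \<and>
     (AE \<xi> in sphere_measure. norm (f \<xi>) \<le> C) \<and>
     (\<forall>x. extension_op sphere_measure f x =
       integral {0..pi/4} (\<lambda>\<theta>. cis (N * \<theta> - 2 * pi * (x \<bullet> (cos \<theta> *\<^sub>R a + sin \<theta> *\<^sub>R b)))))"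
proof -
  have B: "a \<in> Basis" "b \<in> Basis" using ab by auto
  obtain w :: "'a \<Rightarrow> real" and C where w: "w \<in> borel_measurable sphere_measure"
    and wC: "\<And>\<xi>. \<xi> \<in> sphere 0 1 \<Longrightarrow> 0 \<le> w \<xi> \<and> w \<xi> \<le> C"
    and wI: "\<And>(F :: 'a \<Rightarrow> complex) G. F \<in> borel_measurable sphere_measure \<Longrightarrow> continuous_on UNIV G \<Longrightarrow>
       (\<And>\<xi>. norm \<xi> = 1 \<Longrightarrow> 0 < \<xi> \<bullet> a \<Longrightarrow> 0 < \<xi> \<bullet> b \<Longrightarrow> F \<xi> = G (arcsin (\<xi> \<bullet> b))) \<Longrightarrow>
       (\<integral>\<xi>. complex_of_real (w \<xi>) * F \<xi> \<partial>sphere_measure) = integral {0..pi/4} G"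
    using sphere_arc[OF B ab(2)] by blast
  have bd: "\<bar>\<xi> \<bullet> b\<bar> \<le> 1" if "norm \<xi> = 1" for \<xi> using Basis_le_norm[OF B(2), of \<xi>] that by simp
  show ?thesis
  proof (rule that[of C])
    fix N :: real
    define f where "f \<xi> = complex_of_real (w \<xi>) * cis (N * arcsin (\<xi> \<bullet> b))" for \<xi>
    have cis: "(\<lambda>\<xi>. cis (N * arcsin (\<xi> \<bullet> b))) \<in> borel_measurable (restrict_space borel (sphere 0 1))"
      by (intro borel_measurable_continuous_on_restrict continuous_intros continuous_on_arcsin)
        (use bd in \<open>auto simp: abs_le_iff\<close>)
    have f: "f \<in> borel_measurable sphere_measure"
      unfolding f_def[abs_def] using w cis by simp
    have fb: "AE \<xi> in sphere_measure. norm (f \<xi>) \<le> C"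
      using wC by (intro AE_I2) (auto simp: f_def norm_mult)
    have "extension_op sphere_measure f x =
       integral {0..pi/4} (\<lambda>\<theta>. cis (N * \<theta> - 2 * pi * (x \<bullet> (cos \<theta> *\<^sub>R a + sin \<theta> *\<^sub>R b))))" for x
    proof -
      define F where "F \<xi> = exp (- 2 * complex_of_real pi * \<i> * complex_of_real (x \<bullet> \<xi>)) * cis (N * arcsin (\<xi> \<bullet> b))" for \<xi>
      have e1: "(\<lambda>\<xi>. exp (- 2 * complex_of_real pi * \<i> * complex_of_real (x \<bullet> \<xi>))) \<in> borel_measurable (restrict_space borel (sphere 0 1))"
        by (intro measurable_restrict_space1) measurable
      have F: "F \<in> borel_measurable sphere_measure"
        unfolding F_def[abs_def] using cis e1 by simp
      have "extension_op sphere_measure f x = (\<integral>\<xi>. complex_of_real (w \<xi>) * F \<xi> \<partial>sphere_measure)"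
        unfolding extension_op_def
        by (intro Bochner_Integration.integral_cong) (auto simp: f_def F_def mult_ac)
      also have "\<dots> = integral {0..pi/4} (\<lambda>\<theta>. cis (N * \<theta> - 2 * pi * (x \<bullet> (cos \<theta> *\<^sub>R a + sin \<theta> *\<^sub>R b))))"
      proof (rule wI[OF F])
        show "continuous_on UNIV (\<lambda>\<theta>. cis (N * \<theta> - 2 * pi * (x \<bullet> (cos \<theta> *\<^sub>R a + sin \<theta> *\<^sub>R b))))"
          by (intro continuous_intros)
        fix \<xi> :: 'a assume n: "norm \<xi> = 1" and pos: "0 < \<xi> \<bullet> a" "0 < \<xi> \<bullet> b"
        have rep: "(\<xi> \<bullet> a) *\<^sub>R a + (\<xi> \<bullet> b) *\<^sub>R b = \<xi>"
          using euclidean_representation[of \<xi>, unfolded ab(1)] ab(2) by simp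
        have "\<xi> \<bullet> \<xi> = (\<xi> \<bullet> a)\<^sup>2 + (\<xi> \<bullet> b)\<^sup>2"
          using euclidean_inner[of \<xi> \<xi>, unfolded ab(1)] ab(2) by (simp add: power2_eq_square)
        then have "(\<xi> \<bullet> a)\<^sup>2 = 1 - (\<xi> \<bullet> b)\<^sup>2" using n by (simp add: norm_eq_1)
        then have "sqrt (1 - (\<xi> \<bullet> b)\<^sup>2) = \<xi> \<bullet> a" using pos by (intro real_sqrt_unique) auto
        moreover have "sin (arcsin (\<xi> \<bullet> b)) = \<xi> \<bullet> b" using bd[OF n] by (intro sin_arcsin) auto
        moreover have "cos (arcsin (\<xi> \<bullet> b)) = sqrt (1 - (\<xi> \<bullet> b)\<^sup>2)" using bd[OF n] by (intro cos_arcsin) auto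
        ultimately have e: "cos (arcsin (\<xi> \<bullet> b)) *\<^sub>R a + sin (arcsin (\<xi> \<bullet> b)) *\<^sub>R b = \<xi>" using rep by simp
        show "F \<xi> = cis (N * arcsin (\<xi> \<bullet> b) - 2 * pi * (x \<bullet> (cos (arcsin (\<xi> \<bullet> b)) *\<^sub>R a + sin (arcsin (\<xi> \<bullet> b)) *\<^sub>R b)))"
          unfolding e F_def by (simp add: cis_conv_exp exp_add[symmetric] algebra_simps)
      qed
      finally show ?thesis .
    qed
    with f fb show "\<exists>f. f \<in> borel_measurable sphere_measure \<and>
     (AE \<xi> in sphere_measure. norm (f \<xi>) \<le> C) \<and>
     (\<forall>x. extension_op sphere_measure f x =
       integral {0..pi/4} (\<lambda>\<theta>. cis (N * \<theta> - 2 * pi * (x \<bullet> (cos \<theta> *\<^sub>R a + sin \<theta> *\<^sub>R b)))))" by blast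
  qed
qed

section \<open>The turning circle and the mass of an annulus\<close>

lemma card_progression_le:
  fixes h d s0 s :: real and J :: nat
  assumes "0 < h" "0 \<le> d"
  shows "real (card {j. j < J \<and> \<bar>s0 + real j * h - s\<bar> \<le> d}) \<le> 2 * d / h + 1"
proof (cases "{j. j < J \<and> \<bar>s0 + real j * h - s\<bar> \<le> d} = {}")
  case True
  then show ?thesis using assms by (simp only: card.empty) simp
next
  case False
  let ?S = "{j. j < J \<and> \<bar>s0 + real j * h - s\<bar> \<le> d}"
  have fin: "finite ?S" by simp
  define u where "u = Min ?S"
  define v where "v = Max ?S"
  have u: "u \<in> ?S" and v: "v \<in> ?S" unfolding u_def v_def using Min_in[OF fin False] Max_in[OF fin False] by auto
  have "?S \<subseteq> {u..v}" unfolding u_def v_def using fin by auto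
  then have "card ?S \<le> card {u..v}" by (intro card_mono) auto
  moreover have uv: "u \<le> v" unfolding u_def using v by (intro Min_le fin)
  ultimately have "real (card ?S) \<le> real v - real u + 1" by simp
  also have "real v - real u \<le> 2 * d / h"
  proof -
    have "(real v - real u) * h \<le> 2 * d" using u v by (simp add: abs_le_iff algebra_simps)
    then show ?thesis using assms by (simp add: field_simps)
  qed
  finally show ?thesis by simp
qed

text \<open>Writing x = |x| (- sin t, cos t) turns the phase into M^3 \<theta> - r sin (\<theta> -
  t) with r = 2 pi |x|. For r = M^3 its first two derivatives vanish at \<theta> = t, which is the
  turning point of the Bessel function; the constant phase M^3 t drops out of the modulus.\<close>

lemma arc_extension_lower:
  fixes a b x :: "'a::euclidean_space" and M :: real
  assumes ab: "Basis = {a, b}" "a \<noteq> b" and M: "11 \<le> M"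
    and x: "M ^ 3 - M / 10 \<le> 2 * pi * norm x" "2 * pi * norm x \<le> M ^ 3"
      "norm x / 4 \<le> - (x \<bullet> a)" "- (x \<bullet> a) \<le> norm x / 2" "0 < x \<bullet> b"
  shows "1 / M \<le> norm (integral {0..pi/4} (\<lambda>\<theta>. cis (M ^ 3 * \<theta> - 2 * pi * (x \<bullet> (cos \<theta> *\<^sub>R a + sin \<theta> *\<^sub>R b)))))"
proof -
  define r where "r = 2 * pi * norm x"
  \<comment> \<open>The hypotheses say 1/4 \<le> sin t \<le> 1/2. Since pi/16 < 1/4 and sin (pi/6) =
    1/2 with pi/6 < 3 pi/16, the stationary point lies between pi/16 and 3 pi/16, well inside the
    arc.\<close>
  define t where "t = arcsin (- (x \<bullet> a) / norm x)"
  have "M \<le> M ^ 3" using self_le_power[of M 3] M by simp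
  then have "0 < r" using x(1) M unfolding r_def by linarith
  then have nx: "0 < norm x" by (simp add: r_def zero_less_mult_iff)
  have q: "1/4 \<le> - (x \<bullet> a) / norm x" "- (x \<bullet> a) / norm x \<le> 1/2"
    using x(3,4) nx by (simp_all add: field_simps)
  have q1: "- 1 \<le> - (x \<bullet> a) / norm x" "- (x \<bullet> a) / norm x \<le> 1" using q by linarith+
  have st: "sin t = - (x \<bullet> a) / norm x" unfolding t_def using q1 by (rule sin_arcsin)
  have tb: "- (pi/2) \<le> t" "t \<le> pi / 2" unfolding t_def using arcsin_bounded[OF q1] by auto
  have t1: "pi / 16 \<le> t"
  proof (rule ccontr)
    assume "\<not> pi / 16 \<le> t"
    then have "sin t < sin (pi / 16)" using tb pi_gt_zero by (intro sin_monotone_2pi) auto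
    also have "\<dots> \<le> pi / 16" using pi_gt_zero by (intro sin_x_le_x) auto
    also have "\<dots> < 1 / 4" using pi_less_4 by simp
    finally show False using q(1) st by simp
  qed
  have t2: "t \<le> 3 * pi / 16"
  proof (rule ccontr)
    assume "\<not> t \<le> 3 * pi / 16"
    then have "sin (pi / 6) < sin t" using tb pi_gt_zero by (intro sin_monotone_2pi) auto
    then show False using q(2) st by (simp add: sin_30)
  qed
  have "x \<bullet> x = (x \<bullet> a)\<^sup>2 + (x \<bullet> b)\<^sup>2"
    using euclidean_inner[of x x, unfolded ab(1)] ab(2) by (simp add: power2_eq_square)
  then have n2: "(norm x)\<^sup>2 = (x \<bullet> a)\<^sup>2 + (x \<bullet> b)\<^sup>2" by (simp add: power2_norm_eq_inner)
  have "cos t = sqrt (1 - (sin t)\<^sup>2)"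
    unfolding st unfolding t_def using q1 by (rule cos_arcsin)
  also have "\<dots> = x \<bullet> b / norm x"
  proof (rule real_sqrt_unique)
    show "(x \<bullet> b / norm x)\<^sup>2 = 1 - (sin t)\<^sup>2"
    proof -
      have "(x \<bullet> b)\<^sup>2 = (norm x)\<^sup>2 - (x \<bullet> a)\<^sup>2" using n2 by simp
      then show ?thesis unfolding st using nx by (simp add: power_divide diff_divide_distrib)
    qed
  qed (use x(5) in simp)
  finally have ct: "cos t = x \<bullet> b / norm x" .
  have ph: "2 * pi * (x \<bullet> (cos \<theta> *\<^sub>R a + sin \<theta> *\<^sub>R b)) = r * sin (\<theta> - t)" for \<theta>
    using nx by (simp add: sin_diff st ct r_def inner_add_right field_simps)
  let ?F = "\<lambda>\<theta>. cis (M ^ 3 * \<theta> - 2 * pi * (x \<bullet> (cos \<theta> *\<^sub>R a + sin \<theta> *\<^sub>R b)))"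
  let ?f = "\<lambda>\<theta>. M ^ 3 * (\<theta> - t) - r * sin (\<theta> - t)"
  have int: "(\<lambda>\<theta>. cis (?f \<theta>)) integrable_on {0..pi/4}"
    by (intro integrable_continuous_real continuous_intros)
  have "1 / M \<le> integral {0..pi/4} (\<lambda>\<theta>. cos (?f \<theta>))"
    using x(1,2) t1 t2 M unfolding r_def by (intro cos_phase_integral_shift)
  also have "\<dots> = integral {0..pi/4} (\<lambda>\<theta>. Re (cis (?f \<theta>)))" by simp
  also have "\<dots> = Re (integral {0..pi/4} (\<lambda>\<theta>. cis (?f \<theta>)))"
    using integral_linear[OF int bounded_linear_Re] by (simp add: o_def)
  also have "\<dots> \<le> norm (integral {0..pi/4} (\<lambda>\<theta>. cis (?f \<theta>)))" by (rule complex_Re_le_cmod)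
  also have "\<dots> = norm (cis (M ^ 3 * t) * integral {0..pi/4} (\<lambda>\<theta>. cis (?f \<theta>)))" by (simp add: norm_mult)
  also have "cis (M ^ 3 * t) * integral {0..pi/4} (\<lambda>\<theta>. cis (?f \<theta>)) = integral {0..pi/4} (\<lambda>\<theta>. cis (M ^ 3 * t) * cis (?f \<theta>))"
    by simp
  also have "(\<lambda>\<theta>. cis (M ^ 3 * t) * cis (?f \<theta>)) = ?F"
    unfolding ph cis_mult by (simp add: algebra_simps)
  finally show ?thesis .
qed

text \<open>Discs of radius m/300 about \<open>m\<^sup>2\<close> points of one circle fill a fixed
  proportion of a sector of the annulus. Even spacing in the coordinate along \<open>a\<close>
  reduces counting them in a ball to counting terms of an arithmetic progression.\<close>

lemma arc_points:
  fixes a b :: "'a::euclidean_space" and m :: nat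
  assumes ab: "Basis = {a, b}" "a \<noteq> b" and m: "11 \<le> m"
  obtains y :: "nat \<Rightarrow> 'a" where
    "\<And>j. y j \<bullet> a = y 0 \<bullet> a + real j * (- (real m / 100))"
    "\<And>j x. j < m\<^sup>2 \<Longrightarrow> dist (y j) x \<le> real m / 300 \<Longrightarrow>
       real m ^ 3 - real m / 10 \<le> 2 * pi * norm x \<and> 2 * pi * norm x \<le> real m ^ 3 \<and>
       norm x / 4 \<le> - (x \<bullet> a) \<and> - (x \<bullet> a) \<le> norm x / 2 \<and> 0 < x \<bullet> b"
proof -
  define M where "M = real m"
  have M: "11 \<le> M" using m by (simp add: M_def)
  \<comment> \<open>2 pi \<rho> is the midpoint of the window [M^3 - M/10, M^3]. Moving by M/300
    changes 2 pi |x| by at most 8 M/300, less than the half-width M/20.\<close>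
  define \<rho> where "\<rho> = (M ^ 3 - M / 20) / (2 * pi)"
  \<comment> \<open>\<open>m\<^sup>2\<close> steps of M/100 amount to M^3/100 \<le> 0.09 \<rho>, so
    \<open>s\<close> stays between 0.3 \<rho> and 0.39 \<rho>. This leaves room inside the required
    range from |x|/4 to |x|/2 for a disc of radius M/300.\<close>
  define s where "s j = 3 / 10 * \<rho> + real j * (M / 100)" for j
  define y where "y j = (- s j) *\<^sub>R a + sqrt (\<rho>\<^sup>2 - (s j)\<^sup>2) *\<^sub>R b" for j
  have M3: "121 * M \<le> M ^ 3"
  proof -
    have "11\<^sup>2 * M \<le> M\<^sup>2 * M" using M by (intro mult_right_mono power_mono) auto
    then show ?thesis by (simp add: power3_eq_cube power2_eq_square)
  qed
  have \<rho>1: "M ^ 3 \<le> 9 * \<rho>"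
  proof -
    have "2 * pi * M ^ 3 \<le> 8 * M ^ 3" using pi_less_4 M by (intro mult_right_mono) auto
    also have "\<dots> \<le> 9 * (M ^ 3 - M / 20)" using M3 M by (simp add: algebra_simps)
    finally show ?thesis unfolding \<rho>_def using pi_gt_zero by (simp add: field_simps)
  qed
  have \<rho>M: "13 * M \<le> \<rho>" using \<rho>1 M3 M by linarith
  have \<rho>0: "0 < \<rho>" using \<rho>M M by linarith
  have B: "a \<in> Basis" "b \<in> Basis" unfolding ab(1) by auto
  have ya: "y j \<bullet> a = - s j" and yb: "y j \<bullet> b = sqrt (\<rho>\<^sup>2 - (s j)\<^sup>2)" for j
    using B ab(2) by (simp_all add: y_def inner_add_left inner_diff_left inner_not_same_Basis)
  have main: "M ^ 3 - M / 10 \<le> 2 * pi * norm x \<and> 2 * pi * norm x \<le> M ^ 3 \<and>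
       norm x / 4 \<le> - (x \<bullet> a) \<and> - (x \<bullet> a) \<le> norm x / 2 \<and> 0 < x \<bullet> b"
    if j: "j < m\<^sup>2" and x: "dist (y j) x \<le> M / 300" for j x
  proof -
    have "real j \<le> real (m\<^sup>2)" using j by simp
    then have "real j * (M / 100) \<le> M\<^sup>2 * (M / 100)" unfolding M_def by (intro mult_right_mono) auto
    also have "\<dots> = M ^ 3 / 100" by (simp add: power2_eq_square power3_eq_cube)
    also have "\<dots> \<le> 9 / 100 * \<rho>" using \<rho>1 by simp
    finally have s2: "s j \<le> 39 / 100 * \<rho>" unfolding s_def by simp
    have "0 \<le> real j * (M / 100)" using M by simp
    then have s1: "3 / 10 * \<rho> \<le> s j" unfolding s_def by linarith
    have sq: "(s j)\<^sup>2 \<le> (39 / 100 * \<rho>)\<^sup>2" using s1 s2 \<rho>0 by (intro power_mono) auto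
    have "(9/10 * \<rho>)\<^sup>2 + (39 / 100 * \<rho>)\<^sup>2 \<le> \<rho>\<^sup>2" by (simp add: power_mult_distrib power_divide)
    then have c2: "(9/10 * \<rho>)\<^sup>2 \<le> \<rho>\<^sup>2 - (s j)\<^sup>2" using sq by linarith
    then have yb9: "9/10 * \<rho> \<le> y j \<bullet> b" unfolding yb by (rule real_le_rsqrt)
    have "0 \<le> \<rho>\<^sup>2 - (s j)\<^sup>2" using c2 zero_le_power2[of "9/10 * \<rho>"] by linarith
    moreover have "(norm (y j))\<^sup>2 = (y j \<bullet> a)\<^sup>2 + (y j \<bullet> b)\<^sup>2"
      unfolding power2_norm_eq_inner
      using euclidean_inner[of "y j" "y j", unfolded ab(1)] ab(2) by (simp add: power2_eq_square)
    ultimately have "(norm (y j))\<^sup>2 = \<rho>\<^sup>2" unfolding ya yb by simp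
    then have ny: "norm (y j) = \<rho>" using \<rho>0 by (intro power2_eq_imp_eq[of "norm (y j)"]) auto
    have d: "norm (x - y j) \<le> M / 300" using x by (simp add: dist_norm norm_minus_commute)
    have nx: "\<bar>norm x - \<rho>\<bar> \<le> M / 300" using norm_triangle_ineq3[of x "y j"] d ny by linarith
    have xa: "\<bar>x \<bullet> a + s j\<bar> \<le> M / 300"
      using Basis_le_norm[OF B(1), of "x - y j"] d by (simp add: inner_diff_left ya)
    have xb: "\<bar>x \<bullet> b - y j \<bullet> b\<bar> \<le> M / 300"
      using Basis_le_norm[OF B(2), of "x - y j"] d unfolding inner_diff_left by linarith
    have r: "2 * pi * \<rho> = M ^ 3 - M / 20" using pi_gt_zero by (simp add: \<rho>_def)
    have "\<bar>2 * pi * norm x - 2 * pi * \<rho>\<bar> = 2 * pi * \<bar>norm x - \<rho>\<bar>"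
      using pi_gt_zero by (simp add: abs_mult right_diff_distrib[symmetric])
    also have "\<dots> \<le> 8 * (M / 300)" using nx pi_less_4 by (intro mult_mono) auto
    finally have R: "\<bar>2 * pi * norm x - (M ^ 3 - M / 20)\<bar> \<le> 8 * (M / 300)" unfolding r .
    show ?thesis
      using R nx xa xb yb9 s1 s2 \<rho>M M by (intro conjI; linarith)
  qed
  show ?thesis
  proof (rule that[of y])
    show "y j \<bullet> a = y 0 \<bullet> a + real j * (- (real m / 100))" for j
      unfolding ya s_def M_def by simp
  qed (use main in \<open>simp_all add: M_def\<close>)
qed

text \<open>The three bounds are the mass of a full ball, of a ball meeting an annulus of width M,
  and of the whole set. After division by r^\<alpha> the middle one, r^(1 - \<alpha>) M, is maximal
  at r = M if \<alpha> \<ge> 1, giving M^(2 - \<alpha>), and at r = M^3 if \<alpha> < 1, giving M^(4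
  - 3 \<alpha>). Hence the change of behaviour at \<alpha> = 1 in the plane.\<close>

lemma annulus_mass_le:
  fixes \<alpha> r V M :: real
  assumes \<alpha>: "0 < \<alpha>" "\<alpha> \<le> 2" and r: "1 \<le> r" and V: "0 \<le> V" and M: "1 \<le> M"
    and X: "X \<le> V * r\<^sup>2" "M \<le> r \<Longrightarrow> X \<le> V * (r * M)" "X \<le> V * M ^ 4"
  shows "X \<le> V * M powr (max (2 - \<alpha>) (4 - 3 * \<alpha>)) * r powr \<alpha>"
proof -
  let ?e = "max (2 - \<alpha>) (4 - 3 * \<alpha>)"
  have e: "M powr (2 - \<alpha>) \<le> M powr ?e" "M powr (4 - 3 * \<alpha>) \<le> M powr ?e"
    using M by (auto intro: powr_mono)
  have "\<exists>Y. X \<le> V * Y \<and> Y \<le> M powr ?e * r powr \<alpha>"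
  proof (cases "r \<le> M")
    case True
    have "r\<^sup>2 = r powr (2 - \<alpha>) * r powr \<alpha>"
      using r by (simp add: powr_add[symmetric])
    also have "\<dots> \<le> M powr (2 - \<alpha>) * r powr \<alpha>" using True r \<alpha> by (intro mult_right_mono powr_mono2) auto
    also have "\<dots> \<le> M powr ?e * r powr \<alpha>" using e by (intro mult_right_mono) auto
    finally show ?thesis using X(1) by blast
  next
    case False
    then have Mr: "M \<le> r" by simp
    show ?thesis
    proof (cases "1 \<le> \<alpha>")
      case True
      have "r * M = r powr (1 - \<alpha>) * r powr \<alpha> * M" using r by (simp add: powr_add[symmetric])
      also have "\<dots> \<le> M powr (1 - \<alpha>) * r powr \<alpha> * M"
        using True Mr M by (intro mult_right_mono powr_mono2') auto
      also have "\<dots> = (M powr (1 - \<alpha>) * M powr 1) * r powr \<alpha>" using M by simp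
      also have "\<dots> = M powr (2 - \<alpha>) * r powr \<alpha>" unfolding powr_add[symmetric] by simp
      also have "\<dots> \<le> M powr ?e * r powr \<alpha>" using e by (intro mult_right_mono) auto
      finally show ?thesis using X(2)[OF Mr] by blast
    next
      case \<alpha>1: False
      show ?thesis
      proof (cases "r \<le> M ^ 3")
        case True
        have "r * M = r powr (1 - \<alpha>) * r powr \<alpha> * M" using r by (simp add: powr_add[symmetric])
        also have "\<dots> \<le> (M ^ 3) powr (1 - \<alpha>) * r powr \<alpha> * M"
          using True \<alpha>1 r M by (intro mult_right_mono powr_mono2) auto
        also have "(M ^ 3) powr (1 - \<alpha>) = M powr (3 * (1 - \<alpha>))"
          using M powr_realpow[of M 3] powr_powr[of M 3 "1 - \<alpha>"] by simp
        also have "M powr (3 * (1 - \<alpha>)) * r powr \<alpha> * M = (M powr (3 * (1 - \<alpha>)) * M powr 1) * r powr \<alpha>" using M by simp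
        also have "\<dots> = M powr (4 - 3 * \<alpha>) * r powr \<alpha>" unfolding powr_add[symmetric] by simp
        also have "\<dots> \<le> M powr ?e * r powr \<alpha>" using e by (intro mult_right_mono) auto
        finally show ?thesis using X(2)[OF Mr] by blast
      next
        case False
        have "M ^ 4 = M powr (4 - 3 * \<alpha>) * M powr (3 * \<alpha>)"
          using M powr_realpow[of M 4] by (simp add: powr_add[symmetric])
        also have "M powr (3 * \<alpha>) = (M ^ 3) powr \<alpha>"
          using M powr_realpow[of M 3] powr_powr[of M 3 \<alpha>] by simp
        also have "M powr (4 - 3 * \<alpha>) * \<dots> \<le> M powr ?e * r powr \<alpha>"
          using e False \<alpha> M by (intro mult_mono powr_mono2) auto
        finally show ?thesis using X(3) by blast
      qed
    qed
  qed
  then obtain Y where Y: "X \<le> V * Y" "Y \<le> M powr ?e * r powr \<alpha>" by blast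
  then have "V * Y \<le> V * (M powr ?e * r powr \<alpha>)" using V by (intro mult_left_mono)
  with Y(1) show ?thesis by (simp add: mult.assoc)
qed

text \<open>The extension is at least 1/M on a set of area about M^4 in a ball of radius M^3, so 4 -
  q \<le> e + 3 \<epsilon> with e = max (2 - \<alpha>) (4 - 3 \<alpha>); and 4 - e = min (\<alpha> +
  2) (3 \<alpha>). The 90000 below is 300^2, from the area of the discs.\<close>

lemma local_estimate_exponent_ge_planar:
  fixes a b :: "'a::euclidean_space"
  assumes ab: "Basis = {a, b}" "a \<noteq> b" and \<alpha>: "0 < \<alpha>" "\<alpha> \<le> 2" and q: "q > 0"
    and loc: "local_estimate (sphere_measure :: 'a measure) \<alpha> \<infinity> q"
  shows "min (\<alpha> + 2) (3 * \<alpha>) \<le> q"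
proof -
  let ?\<sigma> = "sphere_measure :: 'a measure"
  let ?V = "unit_ball_vol 2"
  let ?e = "max (2 - \<alpha>) (4 - 3 * \<alpha>)"
  have V: "?V > 0" by simp
  have dim: "DIM('a) = 2" unfolding ab(1) using ab(2) by simp
  have ball: "measure lborel (cball y r) = ?V * r\<^sup>2" if "0 \<le> r" for y :: 'a and r
    using that by (simp add: content_cball dim)
  obtain B where B: "\<And>N :: real. \<exists>f. f \<in> borel_measurable ?\<sigma> \<and> (AE \<xi> in ?\<sigma>. norm (f \<xi>) \<le> B) \<and>
     (\<forall>x. extension_op ?\<sigma> f x =
       integral {0..pi/4} (\<lambda>\<theta>. cis (N * \<theta> - 2 * pi * (x \<bullet> (cos \<theta> *\<^sub>R a + sin \<theta> *\<^sub>R b)))))"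
    using arc_extension[OF ab] by blast
  have "4 - q \<le> ?e + 3 * \<epsilon>" if \<epsilon>: "\<epsilon> > 0" for \<epsilon>
  proof (rule local_estimate_lower[OF loc q \<epsilon>, of "\<bar>B\<bar> + 1"])
    fix C :: real
    assume C: "C > 0" and est: "\<And>(f :: 'a \<Rightarrow> complex) Y R A l. f \<in> borel_measurable ?\<sigma> \<Longrightarrow>
       (AE \<xi> in ?\<sigma>. norm (f \<xi>) \<le> \<bar>B\<bar> + 1) \<Longrightarrow> Y \<in> sets borel \<Longrightarrow>
       Y \<subseteq> cball 0 R \<Longrightarrow> R \<ge> 1 \<Longrightarrow> A \<ge> 0 \<Longrightarrow> l \<ge> 0 \<Longrightarrow>
       (\<And>x0 r. r \<ge> 1 \<Longrightarrow> measure lborel (Y \<inter> cball x0 r) \<le> A * r powr \<alpha>) \<Longrightarrow>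
       (\<And>x. x \<in> Y \<Longrightarrow> l \<le> norm (extension_op ?\<sigma> f x)) \<Longrightarrow>
       l powr q * measure lborel Y \<le> C * R powr \<epsilon> * A"
    have key: "(1 / 90000) * real m powr (4 - q) \<le> C * real m powr (?e + 3 * \<epsilon>)" if m: "11 \<le> m" for m :: nat
    proof -
      define M where "M = real m"
      have M: "11 \<le> M" using m by (simp add: M_def)
      obtain f where f: "f \<in> borel_measurable ?\<sigma>" and fB: "AE \<xi> in ?\<sigma>. norm (f \<xi>) \<le> B"
        and Ef: "\<And>x. extension_op ?\<sigma> f x =
          integral {0..pi/4} (\<lambda>\<theta>. cis (M ^ 3 * \<theta> - 2 * pi * (x \<bullet> (cos \<theta> *\<^sub>R a + sin \<theta> *\<^sub>R b))))"
        using B[of "M ^ 3"] by blast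
      obtain y :: "nat \<Rightarrow> 'a" where ya: "\<And>j. y j \<bullet> a = y 0 \<bullet> a + real j * (- (M / 100))"
        and yx: "\<And>j x. j < m\<^sup>2 \<Longrightarrow> dist (y j) x \<le> M / 300 \<Longrightarrow>
         M ^ 3 - M / 10 \<le> 2 * pi * norm x \<and> 2 * pi * norm x \<le> M ^ 3 \<and>
         norm x / 4 \<le> - (x \<bullet> a) \<and> - (x \<bullet> a) \<le> norm x / 2 \<and> 0 < x \<bullet> b"
        unfolding M_def using arc_points[OF ab m] by blast
      define v where "v = ?V * (M / 300)\<^sup>2"
      have v: "v = measure lborel (cball (0::'a) (M / 300))" unfolding v_def using M by (simp add: ball)
      define Y where "Y = (\<Union>z\<in>y ` {..<m\<^sup>2}. cball z (M / 300))"
      have inB: "\<bar>z \<bullet> a\<bar> \<le> norm z" for z :: 'a by (rule Basis_le_norm) (simp add: ab(1))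
      have sep: "M / 100 \<le> dist (y i) (y j)" if "i \<noteq> j" for i j
      proof -
        have "1 \<le> \<bar>real i - real j\<bar>" using that by linarith
        then have "1 * (M / 100) \<le> \<bar>real i - real j\<bar> * (M / 100)" using M by (intro mult_right_mono) auto
        also have "\<dots> = \<bar>(y i - y j) \<bullet> a\<bar>"
        proof -
          have "(y i - y j) \<bullet> a = - ((real i - real j) * (M / 100))"
            using ya[of i] ya[of j] by (simp add: inner_diff_left field_simps)
          then show ?thesis using M by (simp add: abs_mult)
        qed
        also have "\<dots> \<le> dist (y i) (y j)" unfolding dist_norm by (rule inB)
        finally show ?thesis by simp
      qed
      have inj: "inj_on y {..<m\<^sup>2}"
      proof (rule inj_onI, rule ccontr)
        fix i j assume "y i = y j" "i \<noteq> j"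
        then show False using sep[of i j] M by simp
      qed
      have mY: "measure lborel Y = real (m\<^sup>2) * v"
      proof -
        have "measure lborel Y = real (card (y ` {..<m\<^sup>2})) * v"
          unfolding Y_def v
        proof (rule measure_Union_disjoint_cball)
          fix z w assume "z \<in> y ` {..<m\<^sup>2}" "w \<in> y ` {..<m\<^sup>2}" "z \<noteq> w"
          then obtain i j where "z = y i" "w = y j" "i \<noteq> j" by auto
          then have "M / 100 \<le> dist z w" using sep by simp
          then show "2 * (M / 300) < dist z w" using M by linarith
        qed (use M in auto)
        then show ?thesis using inj by (simp add: card_image)
      qed
      have mass: "measure lborel (Y \<inter> cball z r) \<le> ?V * M powr ?e * r powr \<alpha>" if r: "r \<ge> 1" for z r
      proof (rule annulus_mass_le[OF \<alpha> r])
        have Yb: "Y \<in> sets borel" unfolding Y_def by (intro sets.finite_UN) auto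
        have "measure lborel (Y \<inter> cball z r) \<le> measure lborel (cball z r)"
          using Yb by (intro measure_mono_fmeasurable) (auto intro!: fmeasurableI simp: emeasure_lborel_cball_finite[unfolded infinity_ennreal_def])
        then show "measure lborel (Y \<inter> cball z r) \<le> ?V * r\<^sup>2" using r by (simp add: ball)
        let ?X = "{w \<in> y ` {..<m\<^sup>2}. dist w z \<le> r + M / 300}"
        have le: "measure lborel (Y \<inter> cball z r) \<le> real (card ?X) * v"
          unfolding Y_def v using M by (intro measure_Union_cball_Int_le) auto
        have v0: "0 \<le> v" unfolding v by simp
        have "card ?X \<le> card (y ` {..<m\<^sup>2})" by (intro card_mono) auto
        also have "\<dots> \<le> m\<^sup>2" using card_image_le[of "{..<m\<^sup>2}" y] by simp
        finally have "real (card ?X) \<le> M\<^sup>2" unfolding M_def by (metis of_nat_mono of_nat_power)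
        then have "real (card ?X) * v \<le> M\<^sup>2 * v" using v0 by (intro mult_right_mono)
        also have "\<dots> \<le> ?V * M ^ 4"
          unfolding v_def using V M by (simp add: power2_eq_square eval_nat_numeral field_simps)
        finally show "measure lborel (Y \<inter> cball z r) \<le> ?V * M ^ 4" using le by linarith
        assume Mr: "M \<le> r"
        \<comment> \<open>Projection to the axis of \<open>a\<close> does not increase distances, so
          the centres near \<open>z\<close> have their indices in this set; the sign is reversed to
          make the step M/100 positive.\<close>
        let ?S = "{j. j < m\<^sup>2 \<and> \<bar>- (y 0 \<bullet> a) + real j * (M / 100) - (- (z \<bullet> a))\<bar> \<le> r + M / 300}"
        have "?X \<subseteq> y ` ?S"
        proof
          fix w assume "w \<in> ?X"
          then obtain j where j: "j < m\<^sup>2" "w = y j" "dist (y j) z \<le> r + M / 300" by auto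
          have "\<bar>(y j - z) \<bullet> a\<bar> \<le> r + M / 300" using inB[of "y j - z"] j(3) by (simp add: dist_norm)
          then have "\<bar>- (y 0 \<bullet> a) + real j * (M / 100) - (- (z \<bullet> a))\<bar> \<le> r + M / 300"
            using ya[of j] by (simp add: inner_diff_left abs_le_iff)
          then show "w \<in> y ` ?S" using j by blast
        qed
        then have "card ?X \<le> card (y ` ?S)" by (intro card_mono) auto
        also have "\<dots> \<le> card ?S" by (intro card_image_le) auto
        finally have "real (card ?X) \<le> real (card ?S)" by simp
        also have "\<dots> \<le> 2 * (r + M / 300) / (M / 100) + 1"
          using M r by (intro card_progression_le) auto
        \<comment> \<open>The left side is 200 r/M + 5/3, and r \<ge> M. The factor 203 is then
          absorbed by the 300^2 in the disc area, so that the constant is just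
          \<open>?V\<close>.\<close>
        also have "\<dots> \<le> 203 * (r / M)" using M Mr by (simp add: field_simps)
        finally have "real (card ?X) * v \<le> 203 * (r / M) * v" using v0 by (intro mult_right_mono)
        also have "\<dots> \<le> ?V * (r * M)"
          unfolding v_def using V M r by (simp add: power2_eq_square field_simps)
        finally show "measure lborel (Y \<inter> cball z r) \<le> ?V * (r * M)" using le by linarith
      qed (use V M in auto)
      have M3: "M \<le> M ^ 3" using self_le_power[of M 3] M by simp
      have "(1 / M) powr q * measure lborel Y \<le> C * (M ^ 3) powr \<epsilon> * (?V * M powr ?e)"
      proof (rule est[OF f _ _ _ _ _ _ mass])
        show "AE \<xi> in ?\<sigma>. norm (f \<xi>) \<le> \<bar>B\<bar> + 1" using fB by eventually_elim linarith
        show "Y \<in> sets borel" unfolding Y_def by (intro sets.finite_UN) auto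
        show "Y \<subseteq> cball 0 (M ^ 3)"
        proof
          fix x assume "x \<in> Y"
          then obtain j where j: "j < m\<^sup>2" "dist (y j) x \<le> M / 300" by (auto simp: Y_def)
          have "1 * norm x \<le> 2 * pi * norm x" using pi_gt3 by (intro mult_right_mono) auto
          then show "x \<in> cball 0 (M ^ 3)" using yx[OF j] by simp
        qed
        show "1 \<le> M ^ 3" using M3 M by linarith
        show "0 \<le> ?V * M powr ?e" using V by simp
        show "0 \<le> 1 / M" using M by simp
        fix x assume "x \<in> Y"
        then obtain j where j: "j < m\<^sup>2" "dist (y j) x \<le> M / 300" by (auto simp: Y_def)
        show "1 / M \<le> norm (extension_op ?\<sigma> f x)"
          unfolding Ef using yx[OF j] M by (intro arc_extension_lower ab) auto
      qed
      also have "C * (M ^ 3) powr \<epsilon> * (?V * M powr ?e) = ?V * (C * M powr (?e + 3 * \<epsilon>))"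
      proof -
        have "(M ^ 3) powr \<epsilon> = M powr (3 * \<epsilon>)" using M powr_realpow[of M 3] powr_powr[of M 3 \<epsilon>] by simp
        then show ?thesis by (simp add: powr_add mult_ac)
      qed
      also have "(1 / M) powr q * measure lborel Y = ?V * ((1 / 90000) * M powr (4 - q))"
      proof -
        have "M powr (4 - q) = M powr (- q) * M powr 4" unfolding powr_add[symmetric] by simp
        also have "M powr 4 = M ^ 4" using M powr_realpow[of M 4] by simp
        finally have e: "M powr (4 - q) = M powr (- q) * M ^ 4" .
        have "(1 / M) powr q = M powr (- q)" using M by (simp add: powr_divide powr_minus_divide)
        moreover have "measure lborel Y = ?V * (M ^ 4 / 90000)"
          unfolding mY v_def by (simp add: M_def power2_eq_square eval_nat_numeral)
        ultimately show ?thesis unfolding e by simp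
      qed
      finally have "(1 / 90000) * M powr (4 - q) \<le> C * M powr (?e + 3 * \<epsilon>)"
        using V by (rule mult_left_le_imp_le)
      then show ?thesis by (simp add: M_def)
    qed
    have "\<exists>\<^sub>F m in sequentially. (1 / 90000) * real m powr (4 - q) \<le> C * real m powr (?e + 3 * \<epsilon>)"
      unfolding frequently_sequentially using key by (meson max.cobounded1 max.cobounded2)
    then show ?thesis by (rule powr_exponent_le[rotated]) simp
  qed simp
  then have "4 - q \<le> ?e" by (rule le_of_all_eps[rotated]) simp_all
  then show ?thesis by (simp add: min_def max_def split: if_splits)
qed

theorem theorem2p3:
  fixes \<alpha> :: real and n :: nat and \<sigma> :: "(real ^ 'n) measure"
  assumes "n = CARD('n)" and "n \<ge> 2" and "\<sigma> = sphere_measure"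
  shows "(n \<ge> 3 \<and> 0 < \<alpha> \<and> \<alpha> \<le> (real n - 1)\<^sup>2 / (2 * real n) \<longrightarrow>
            Q_loc \<sigma> \<alpha> \<infinity> \<ge> ereal ((real n - 1) / real n)) \<and>
         (n \<ge> 3 \<and> (real n - 1)\<^sup>2 / (2 * real n) \<le> \<alpha> \<and> \<alpha> \<le> real n \<longrightarrow>
            Q_loc \<sigma> \<alpha> \<infinity> \<ge> ereal (2 * \<alpha> / (real n - 1))) \<and>
         (n = 2 \<and> 0 < \<alpha> \<and> \<alpha> \<le> 1 / 6 \<longrightarrow> Q_loc \<sigma> \<alpha> \<infinity> \<ge> ereal (1 / 2)) \<and>
         (n = 2 \<and> 1 / 6 \<le> \<alpha> \<and> \<alpha> \<le> 1 \<longrightarrow> Q_loc \<sigma> \<alpha> \<infinity> \<ge> ereal (3 * \<alpha>)) \<and>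
         (n = 2 \<and> 1 \<le> \<alpha> \<and> \<alpha> \<le> 2 \<longrightarrow> Q_loc \<sigma> \<alpha> \<infinity> \<ge> ereal (\<alpha> + 2))"
proof -
  have \<sigma>: "\<sigma> = sphere_measure" by fact
  have dim: "DIM(real ^ 'n) = n" using assms(1) by simp
  obtain a b :: "real ^ 'n" where ab: "a \<in> Basis" "b \<in> Basis" "a \<noteq> b"
  proof -
    have "Suc 0 < card (Basis :: (real ^ 'n) set)" using dim assms(2) by simp
    then obtain a :: "real ^ 'n" where a: "a \<in> Basis" by (metis card.empty equals0I not_less_zero)
    have "Basis \<noteq> {a}"
    proof
      assume e: "Basis = {a}"
      have "card (Basis :: (real ^ 'n) set) = 1" unfolding e by simp
      with \<open>Suc 0 < card (Basis :: (real ^ 'n) set)\<close> show False by linarith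
    qed
    then show thesis using a that by blast
  qed
  have two: "2 \<le> q" if "0 < \<alpha>" "0 < q" "local_estimate \<sigma> \<alpha> \<infinity> q" for q
    using local_estimate_exponent_ge_2[OF ab] that unfolding \<sigma> by blast
  have large: "2 * \<alpha> / (real n - 1) \<le> q" if "0 < \<alpha>" "\<alpha> \<le> real n" "0 < q" "local_estimate \<sigma> \<alpha> \<infinity> q" for q
  proof -
    have "2 * \<alpha> \<le> q * (real DIM(real ^ 'n) - 1)"
      using that two[of q] unfolding \<sigma> by (intro local_estimate_exponent_ge) (auto simp: dim[simplified])
    then have "2 * \<alpha> \<le> q * (real n - 1)" unfolding dim .
    then show ?thesis using assms(2) by (simp add: field_simps)
  qed
  have planar: "min (\<alpha> + 2) (3 * \<alpha>) \<le> q" if "n = 2" "0 < \<alpha>" "\<alpha> \<le> 2" "0 < q" "local_estimate \<sigma> \<alpha> \<infinity> q" for q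
  proof -
    have "Basis = {a, b}"
    proof (rule card_seteq[symmetric])
      show "card (Basis :: (real ^ 'n) set) \<le> card {a, b}" using ab dim that(1) by simp
    qed (use ab in auto)
    then show ?thesis
      using that ab unfolding \<sigma> by (intro local_estimate_exponent_ge_planar) auto
  qed
  have "Q_loc \<sigma> \<alpha> \<infinity> \<ge> ereal ((real n - 1) / real n)" if "0 < \<alpha>"
  proof (rule Q_loc_ge)
    fix q assume "0 < q" "local_estimate \<sigma> \<alpha> \<infinity> q"
    then have "2 \<le> q" using two that by blast
    moreover have "(real n - 1) / real n \<le> 1" using assms(2) by (simp add: field_simps)
    ultimately show "(real n - 1) / real n \<le> q" by linarith
  qed
  moreover have "Q_loc \<sigma> \<alpha> \<infinity> \<ge> ereal (2 * \<alpha> / (real n - 1))"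
    if "n \<ge> 3" "(real n - 1)\<^sup>2 / (2 * real n) \<le> \<alpha>" "\<alpha> \<le> real n"
  proof (rule Q_loc_ge)
    \<comment> \<open>The lower end of this range is positive, and this is how \<alpha> > 0 is
      obtained here.\<close>
    have "0 < (real n - 1)\<^sup>2 / (2 * real n)" using that(1) by simp
    then show "2 * \<alpha> / (real n - 1) \<le> q" if "0 < q" "local_estimate \<sigma> \<alpha> \<infinity> q" for q
      using large \<open>(real n - 1)\<^sup>2 / (2 * real n) \<le> \<alpha>\<close> \<open>\<alpha> \<le> real n\<close> that by (meson less_le_trans)
  qed
  moreover have "Q_loc \<sigma> \<alpha> \<infinity> \<ge> ereal (1 / 2)" if "0 < \<alpha>"
    using two[OF that] by (intro Q_loc_ge) fastforce
  moreover have "Q_loc \<sigma> \<alpha> \<infinity> \<ge> ereal (3 * \<alpha>)" if "n = 2" "1 / 6 \<le> \<alpha>" "\<alpha> \<le> 1"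
  proof (rule Q_loc_ge)
    fix q assume "0 < q" "local_estimate \<sigma> \<alpha> \<infinity> q"
    then have "min (\<alpha> + 2) (3 * \<alpha>) \<le> q" using that by (intro planar) auto
    then show "3 * \<alpha> \<le> q" using that(3) by linarith
  qed
  moreover have "Q_loc \<sigma> \<alpha> \<infinity> \<ge> ereal (\<alpha> + 2)" if "n = 2" "1 \<le> \<alpha>" "\<alpha> \<le> 2"
  proof (rule Q_loc_ge)
    fix q assume "0 < q" "local_estimate \<sigma> \<alpha> \<infinity> q"
    then have "min (\<alpha> + 2) (3 * \<alpha>) \<le> q" using that by (intro planar) auto
    then show "\<alpha> + 2 \<le> q" using that(2) by linarith
  qed
  ultimately show ?thesis by blast
qed

end
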